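(* For rule $234$ on the square grid, the problem \textsc{Stability} is in $\mathbf{NC}$.
   Context: Square grid: cells are the elements of $\mathbb{Z}^2$; the neighbors $N(u)$ of $u$ are the four cells at Manhattan distance $1$. A configuration assigns to every cell a state in $\{0,1\}$ (1 = active, 0 = inactive). A freezing totalistic cellular automaton is given by $\mathcal{I}\subseteq\{1,2,3,4\}$ and acts synchronously by $F(c)_u=1$ if $c_u=1$ or $\sum_{v\in N(u)}c_v\in\mathcal{I}$, and $F(c)_u=0$ otherwise; rule $234$ means $\mathcal{I}=\{2,3,4\}$. A finite configuration of dimension $n\times n$ is $x:\{0,\dots,n-1\}^2\to\{0,1\}$, and $c(x)$ is the periodic configuration obtained by repeating $x$ in all directions. A cell $u$ with $c_u=0$ is stable for $c$ if $F^t(c)_u=0$ for all $t\ge0$. \textsc{Stability}: given $x$ and $u\in\{0,\dots,n-1\}^2$ with $x_u=0$, decide whether $u$ is stable for $c(x)$. $\mathbf{NC}$ is the class of decision problems solvable on a PRAM in time $(\log n)^{O(1)}$ with $n^{O(1)}$ processors. *)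

theory Defs
  imports Complex_Main
begin

type_synonym cell = "int \<times> int"
type_synonym configuration = "cell \<Rightarrow> bool"  (* True = state 1 = active *)

definition neighbors :: "cell \<Rightarrow> cell set" where
  "neighbors u = {v. \<bar>fst v - fst u\<bar> + \<bar>snd v - snd u\<bar> = 1}"

definition ftca :: "nat set \<Rightarrow> configuration \<Rightarrow> configuration" where
  "ftca \<I> c = (\<lambda>u. c u \<or> (\<Sum>v\<in>neighbors u. of_bool (c v)) \<in> \<I>)"

definition stable :: "nat set \<Rightarrow> configuration \<Rightarrow> cell \<Rightarrow> bool" where
  "stable \<I> c u \<longleftrightarrow> (\<forall>t. \<not> (ftca \<I> ^^ t) c u)"

(* A finite configuration of dimension n x n is a function x of which only the
   values on {0..<n} x {0..<n} are ever used. *)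
definition periodic :: "nat \<Rightarrow> (nat \<times> nat \<Rightarrow> bool) \<Rightarrow> configuration" where
  "periodic n x = (\<lambda>(i, j). x (nat (i mod int n), nat (j mod int n)))"

text \<open>
  All processors run the same program, each with its own program counter and its own
  registers; they communicate through the shared memory.  A processor halts by moving
  its program counter beyond the end of the program.  Multiplication is deliberately not
  an instruction: with unit cost it would produce numbers of superpolylogarithmic
  bit length within polylogarithmic time, and the class defined below would no longer be
  the usual one.
\<close>

datatype instr =
    Const nat nat
  | Add nat nat nat
  | Sub nat nat nat
  | Half nat nat
  | Load nat nat
  | Store nat nat
  | JumpZero nat nat

type_synonym program = "instr list"
type_synonym registers = "nat \<Rightarrow> nat"
type_synonym memory = "nat \<Rightarrow> nat"

record proc =
  pc :: nat
  regs :: registers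

record pram =
  procs :: "nat \<Rightarrow> proc"
  mem :: memory

definition halted :: "program \<Rightarrow> proc \<Rightarrow> bool" where
  "halted prog s \<longleftrightarrow> length prog \<le> pc s"

fun exec :: "instr \<Rightarrow> memory \<Rightarrow> proc \<Rightarrow> proc" where
  "exec (Const r k) m s = s\<lparr>pc := pc s + 1, regs := (regs s)(r := k)\<rparr>"
| "exec (Add r a b) m s = s\<lparr>pc := pc s + 1, regs := (regs s)(r := regs s a + regs s b)\<rparr>"
| "exec (Sub r a b) m s = s\<lparr>pc := pc s + 1, regs := (regs s)(r := regs s a - regs s b)\<rparr>"
| "exec (Half r a) m s = s\<lparr>pc := pc s + 1, regs := (regs s)(r := regs s a div 2)\<rparr>"
| "exec (Load r a) m s = s\<lparr>pc := pc s + 1, regs := (regs s)(r := m (regs s a))\<rparr>"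
| "exec (Store a b) m s = s\<lparr>pc := pc s + 1\<rparr>"
| "exec (JumpZero r l) m s = s\<lparr>pc := (if regs s r = 0 then l else pc s + 1)\<rparr>"

definition step_proc :: "program \<Rightarrow> memory \<Rightarrow> proc \<Rightarrow> proc" where
  "step_proc prog m s = (if halted prog s then s else exec (prog ! pc s) m s)"

(* The address and the value of the store performed in the next step, if any. *)
definition store_request :: "program \<Rightarrow> proc \<Rightarrow> (nat \<times> nat) option" where
  "store_request prog s =
     (if halted prog s then None
      else case prog ! pc s of Store a b \<Rightarrow> Some (regs s a, regs s b) | _ \<Rightarrow> None)"

definition writes_to :: "program \<Rightarrow> proc \<Rightarrow> nat \<Rightarrow> bool" where
  "writes_to prog s a \<longleftrightarrow> (\<exists>v. store_request prog s = Some (a, v))"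

text \<open>
  One synchronous step with \<open>P\<close> processors: all loads see the memory as it was before
  the step.  Concurrent reads and writes are allowed; among concurrent writes to
  the same memory cell the processor with the least index succeeds (priority CRCW).
\<close>

definition step :: "program \<Rightarrow> nat \<Rightarrow> pram \<Rightarrow> pram" where
  "step prog P s =
     \<lparr>procs = (\<lambda>p. step_proc prog (mem s) (procs s p)),
      mem = (\<lambda>a. if \<exists>p<P. writes_to prog (procs s p) a
                 then snd (the (store_request prog
                        (procs s (LEAST p. p < P \<and> writes_to prog (procs s p) a))))
                 else mem s a)\<rparr>"

(* Initially the processor index is in register 0, the input length in register 1, and
   the i-th input bit in memory cell i; everything else is 0. *)
definition initial :: "bool list \<Rightarrow> pram" where
  "initial w =
     \<lparr>procs = (\<lambda>p. \<lparr>pc = 0, regs = (\<lambda>_. 0)(0 := p, 1 := length w)\<rparr>),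
      mem = (\<lambda>i. if i < length w then of_bool (w ! i) else 0)\<rparr>"

definition all_halted :: "program \<Rightarrow> nat \<Rightarrow> pram \<Rightarrow> bool" where
  "all_halted prog P s \<longleftrightarrow> (\<forall>p<P. halted prog (procs s p))"

(* Within T steps all P processors have halted, and memory cell 0 holds the answer. *)
definition decides_within ::
    "program \<Rightarrow> nat \<Rightarrow> real \<Rightarrow> bool list set \<Rightarrow> bool list \<Rightarrow> bool" where
  "decides_within prog P T L w \<longleftrightarrow>
     (\<exists>t. real t \<le> T \<and>
          all_halted prog P ((step prog P ^^ t) (initial w)) \<and>
          mem ((step prog P ^^ t) (initial w)) 0 = of_bool (w \<in> L))"

text \<open>
  One program serves all input lengths, and the number of processors is a fixed
  polynomial of the input length rather than any polynomially bounded function, which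
  could act as a nonuniform advice.  The summand 2 only serves to make the bound positive
  on short inputs.
\<close>

definition NC :: "bool list set set" where
  "NC = {L. \<exists>prog k c d. \<forall>w.
              decides_within prog (length w ^ k + k)
                (real c * log 2 (real (length w) + 2) ^ d) L w}"

(* n and the coordinates of the cell in unary, each followed by False, and then the bits
   of x row by row; the length is polynomially related to n. *)
definition encode :: "nat \<Rightarrow> (nat \<times> nat \<Rightarrow> bool) \<Rightarrow> nat \<times> nat \<Rightarrow> bool list" where
  "encode n x u =
     replicate n True @ [False] @
     replicate (fst u) True @ [False] @
     replicate (snd u) True @ [False] @
     [x (i, j). i \<leftarrow> [0..<n], j \<leftarrow> [0..<n]]"

definition STABILITY :: "nat set \<Rightarrow> bool list set" where
  "STABILITY \<I> =
     {encode n x (i, j) | n x i j.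
        i < n \<and> j < n \<and> \<not> x (i, j) \<and> stable \<I> (periodic n x) (int i, int j)}"

lemma unary_prefix_inject:
  "replicate a True @ False # xs = replicate b True @ False # ys \<longleftrightarrow> a = b \<and> xs = ys"
proof (induction a arbitrary: b)
  case 0
  then show ?case by (cases b) auto
next
  case (Suc a)
  then show ?case by (cases b) auto
qed

lemma row_major_inject:
  assumes "[x (i, j). i \<leftarrow> [0..<m], j \<leftarrow> [0..<n]] = [y (i, j). i \<leftarrow> [0..<m], j \<leftarrow> [0..<n]]"
    and "i < m" "j < n"
  shows "x (i, j) = y (i, j)"
  using assms
proof (induction m)
  case 0
  then show ?case by simp
next
  case (Suc m)
  then show ?case by (auto simp: less_Suc_eq)
qed

lemma encode_inject:
  assumes "encode n x u = encode n' x' u'"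
  shows "n = n' \<and> u = u' \<and> (\<forall>i<n. \<forall>j<n. x (i, j) = x' (i, j))"
proof -
  from assms have nu: "n = n'" "u = u'"
    and rows: "[x (i, j). i \<leftarrow> [0..<n], j \<leftarrow> [0..<n]] = [x' (i, j). i \<leftarrow> [0..<n], j \<leftarrow> [0..<n]]"
    by (auto simp: encode_def unary_prefix_inject prod_eq_iff)
  from nu row_major_inject[OF rows] show ?thesis by blast
qed

end

theory Submission
  imports Defs
begin

text \<open>
  Rule 234 is bootstrap percolation with threshold two.  An unstable cell of \<open>c(x)\<close> becomes active
  within \<open>n\<^sup>2\<close> steps, since every step before the dynamics stops activates a new cell modulo the
  period.  So its fate is decided in a window of polynomial size, and the torus can be replaced by a
  finite set \<open>A\<close> of active cells of the plane.

  The closure of \<open>A\<close> is the union of the rectangles that arise from the points of \<open>A\<close> by replacing two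
  rectangles at distance at most two by their bounding box, and each of them has a derivation tree
  with disjoint leaf sets, hence with polynomially many leaves.  There are polynomially many
  rectangles.  A table \<open>G\<close> of pairs \<open>(R, S)\<close>, meaning that \<open>S\<close> gets filled once \<open>R\<close> is, is closed
  under composition and under joining \<open>R\<close> with a rectangle already known to be filled.  By the
  heavy path argument, doubling the number of leaves that are accounted for costs logarithmically
  many composition rounds, so that \<open>O(log\<^sup>2 n)\<close> rounds suffice, with one processor per triple of
  rectangles.
\<close>

section \<open>Structured programs in lockstep\<close>

text \<open>The obstacle is depth: a derivation may be a path of very many joins, so evaluating it
  join by join is as slow as running the automaton. Recording the conditional facts
  \<open>(R, S)\<close> turns such a path into a composition of relations, which repeated squaring
  shortens. Distance two is the right threshold because two neighbors of one cell are at distance at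
  most two; once no two rectangles are that near, their union is closed under the rule. Disjoint
  leaf sets bound the number of leaves by the number of cells, hence the number of doublings by a
  logarithm. On the machine side every processor has its own program counter, so loops are
  restricted to counters with a common value and conditionals to single padded instructions; one
  semantics then describes all processors at once. With \<open>b\<close> bits per coordinate a
  rectangle takes \<open>4 * b\<close> bits, and this one number serves as the digit width of
  addresses, the number of passes of a product and the bound of both loops over rounds.\<close>

fun local_exec :: "instr \<Rightarrow> memory \<Rightarrow> registers \<Rightarrow> registers" where
  "local_exec (Const r k) m rg = rg(r := k)"
| "local_exec (Add r a b) m rg = rg(r := rg a + rg b)"
| "local_exec (Sub r a b) m rg = rg(r := rg a - rg b)"
| "local_exec (Half r a) m rg = rg(r := rg a div 2)"
| "local_exec (Load r a) m rg = rg(r := m (rg a))"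
| "local_exec (Store a b) m rg = rg"
| "local_exec (JumpZero r l) m rg = rg"

text \<open>\<open>LEAST\<close> is the priority rule of the machine; \<open>act\<close> selects the
  processors that really execute the store.\<close>

definition par_write ::
    "nat \<Rightarrow> (nat \<Rightarrow> bool) \<Rightarrow> (nat \<Rightarrow> nat) \<Rightarrow> (nat \<Rightarrow> nat) \<Rightarrow> memory \<Rightarrow> memory" where
  "par_write P act ad vl m =
     (\<lambda>x. if \<exists>p<P. act p \<and> ad p = x then vl (LEAST p. p < P \<and> act p \<and> ad p = x) else m x)"

fun mem_exec :: "nat \<Rightarrow> instr \<Rightarrow> (nat \<Rightarrow> bool) \<Rightarrow> (nat \<Rightarrow> registers) \<Rightarrow> memory \<Rightarrow> memory" where
  "mem_exec P (Store a b) act rg m = par_write P act (\<lambda>p. rg p a) (\<lambda>p. rg p b) m"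
| "mem_exec P _ act rg m = m"

text \<open>Register 2 is reserved: it always contains 0, so that \<open>JumpZero 2\<close> is an unconditional
  jump.\<close>

fun plain :: "instr \<Rightarrow> bool" where
  "plain (Const r k) = (r \<noteq> 2)"
| "plain (Add r a b) = (r \<noteq> 2)"
| "plain (Sub r a b) = (r \<noteq> 2)"
| "plain (Half r a) = (r \<noteq> 2)"
| "plain (Load r a) = (r \<noteq> 2)"
| "plain (Store a b) = True"
| "plain (JumpZero r l) = False"

datatype com =
    Instr instr
  | Guarded nat instr
  | Seq com com  (infixr \<open>;;\<close> 60)
  | While nat com

fun code_size :: "com \<Rightarrow> nat" where
  "code_size (Instr ins) = 1"
| "code_size (Guarded r ins) = 5"
| "code_size (c1 ;; c2) = code_size c1 + code_size c2"
| "code_size (While r c) = code_size c + 2"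

text \<open>Both branches of a guarded instruction take three steps, which keeps the processors
  in lockstep.\<close>

fun code :: "nat \<Rightarrow> com \<Rightarrow> program" where
  "code i (Instr ins) = [ins]"
| "code i (Guarded r ins) =
     [JumpZero r (i + 3), ins, JumpZero 2 (i + 5), Add 2 2 2, Add 2 2 2]"
| "code i (c1 ;; c2) = code i c1 @ code (i + code_size c1) c2"
| "code i (While r c) =
     JumpZero r (i + code_size c + 2) # code (i + 1) c @ [JumpZero 2 i]"

lemma length_code [simp]: "length (code i c) = code_size c"
  by (induction c arbitrary: i) auto

text \<open>Big-step semantics with an exact step count. The tests of \<open>While\<close> quantify
  over every \<open>p\<close>, not only \<open>p < P\<close>, because \<open>step\<close> moves all
  processors; their agreement keeps the program counters equal.\<close>

inductive run :: "nat \<Rightarrow> com \<Rightarrow> (nat \<Rightarrow> registers) \<Rightarrow> memory \<Rightarrow> nat \<Rightarrow>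
    (nat \<Rightarrow> registers) \<Rightarrow> memory \<Rightarrow> bool" for P where
  Instr: "plain ins \<Longrightarrow>
    run P (Instr ins) rg m 1 (\<lambda>p. local_exec ins m (rg p)) (mem_exec P ins (\<lambda>_. True) rg m)"
| Guarded: "plain ins \<Longrightarrow>
    run P (Guarded r ins) rg m 3 (\<lambda>p. if rg p r = 0 then rg p else local_exec ins m (rg p))
      (mem_exec P ins (\<lambda>p. rg p r \<noteq> 0) rg m)"
| Seq: "run P c1 rg m t rg' m' \<Longrightarrow> run P c2 rg' m' t' rg'' m'' \<Longrightarrow>
    run P (c1 ;; c2) rg m (t + t') rg'' m''"
| While_stop: "\<forall>p. rg p r = 0 \<Longrightarrow> run P (While r c) rg m 1 rg m"
| While_step: "\<forall>p. rg p r \<noteq> 0 \<Longrightarrow> run P c rg m t rg' m' \<Longrightarrow>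
    run P (While r c) rg' m' t' rg'' m'' \<Longrightarrow>
    run P (While r c) rg m (1 + (t + (1 + t'))) rg'' m''"

definition lockstep :: "nat \<Rightarrow> (nat \<Rightarrow> registers) \<Rightarrow> memory \<Rightarrow> pram" where
  "lockstep i rg m = \<lparr>procs = (\<lambda>p. \<lparr>pc = i, regs = rg p\<rparr>), mem = m\<rparr>"

lemma step_lockstep:
  assumes "i < length prog" "plain (prog ! i)"
  shows "step prog P (lockstep i rg m) =
    lockstep (Suc i) (\<lambda>p. local_exec (prog ! i) m (rg p))
      (mem_exec P (prog ! i) (\<lambda>_. True) rg m)"
  using assms
  by (cases "prog ! i")
    (auto simp: step_def lockstep_def step_proc_def halted_def writes_to_def store_request_def
      par_write_def fun_eq_iff)

lemma step_jump:
  assumes "i < length prog" "prog ! i = JumpZero r l"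
  shows "step prog P (lockstep i rg m) =
    \<lparr>procs = (\<lambda>p. \<lparr>pc = if rg p r = 0 then l else Suc i, regs = rg p\<rparr>), mem = m\<rparr>"
  using assms
  by (auto simp: step_def lockstep_def step_proc_def halted_def writes_to_def store_request_def
      fun_eq_iff)

text \<open>The processors split at the test and meet again after three steps: one branch runs
  \<open>ins\<close> and jumps, the other runs \<open>Add 2 2 2\<close> twice, which changes nothing
  as register 2 is 0. \<open>s1\<close> and \<open>s2\<close> are the two states in between.\<close>

lemma steps_guarded:
  assumes prog: "prog = pre @ code i (Guarded r ins) @ post" "length pre = i"
    and ins: "plain ins" and zero: "\<forall>p. rg p 2 = 0"
  shows "(step prog P ^^ 3) (lockstep i rg m) =
    lockstep (i + 5) (\<lambda>p. if rg p r = 0 then rg p else local_exec ins m (rg p))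
      (mem_exec P ins (\<lambda>p. rg p r \<noteq> 0) rg m)"
proof -
  have len: "i + 5 \<le> length prog" using prog by auto
  have nth: "prog ! i = JumpZero r (i + 3)" "prog ! Suc i = ins"
    "prog ! (i + 2) = JumpZero 2 (i + 5)" "prog ! (i + 3) = Add 2 2 2" "prog ! (i + 4) = Add 2 2 2"
    using prog by (auto simp: nth_append)
  define s1 where "s1 = \<lparr>procs = (\<lambda>p. \<lparr>pc = if rg p r = 0 then i + 3 else Suc i, regs = rg p\<rparr>), mem = m\<rparr>"
  define s2 where "s2 = \<lparr>procs = (\<lambda>p. if rg p r = 0 then \<lparr>pc = i + 4, regs = rg p\<rparr>
      else \<lparr>pc = i + 2, regs = local_exec ins m (rg p)\<rparr>),
      mem = mem_exec P ins (\<lambda>p. rg p r \<noteq> 0) rg m\<rparr>"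
  have 1: "step prog P (lockstep i rg m) = s1"
    unfolding s1_def using step_jump[of i prog r "i + 3" P rg m] len nth by simp
  have triv: "(rg p)(2 := 0) = rg p" for p using zero by (auto simp: fun_eq_iff)
  have rq: "store_request prog \<lparr>pc = if rg p r = 0 then i + 3 else Suc i, regs = rg p\<rparr> =
      (if rg p r = 0 then None else case ins of Store a b \<Rightarrow> Some (rg p a, rg p b) | _ \<Rightarrow> None)" for p
    using len nth by (auto simp: store_request_def halted_def split: instr.split)
  have m2: "mem (step prog P s1) = mem s2"
  proof (cases "\<exists>a b. ins = Store a b")
    case True
    then obtain a b where Store: "ins = Store a b" by blast
    have wt: "writes_to prog \<lparr>pc = if rg p r = 0 then i + 3 else Suc i, regs = rg p\<rparr> x
        \<longleftrightarrow> rg p r \<noteq> 0 \<and> rg p a = x" for p x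
      unfolding writes_to_def rq using Store by auto
    show ?thesis
    proof
      fix x
      show "mem (step prog P s1) x = mem s2 x"
      proof (cases "\<exists>p<P. rg p r \<noteq> 0 \<and> rg p a = x")
        case True
        \<comment> \<open>Only processors with \<open>rg p r \<noteq> 0\<close> stand at the store
          in this step, so the machine's priority choice is the one made by
          \<open>par_write\<close>.\<close>
        define q where "q = (LEAST p. p < P \<and> 0 < rg p r \<and> rg p a = x)"
        have "q < P \<and> 0 < rg q r \<and> rg q a = x"
          unfolding q_def by (rule LeastI_ex) (use True in auto)
        then have "snd (the (store_request prog
            \<lparr>pc = if rg q r = 0 then i + 3 else Suc i, regs = rg q\<rparr>)) = rg q b"
          unfolding rq using Store by simp
        with True show ?thesis
          by (simp add: step_def s1_def s2_def wt Store par_write_def flip: q_def)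
      next
        case False
        then show ?thesis
          by (auto simp: step_def s1_def s2_def wt Store par_write_def)
      qed
    qed
  next
    case False
    then have "store_request prog (procs s1 p) = None" for p
      by (auto simp: s1_def rq split: instr.split)
    then have "mem (step prog P s1) = m"
      by (simp add: step_def writes_to_def) (simp add: s1_def)
    moreover have "mem_exec P ins act rg m = m" for act
      using False by (cases ins) auto
    ultimately show ?thesis by (simp add: s2_def)
  qed
  have p2: "procs (step prog P s1) = procs s2"
  proof
    fix p
    have "exec ins m \<lparr>pc = Suc i, regs = rg p\<rparr> = \<lparr>pc = i + 2, regs = local_exec ins m (rg p)\<rparr>"
      using ins by (cases ins) auto
    then show "procs (step prog P s1) p = procs s2 p"
      using len nth zero triv by (auto simp: step_def s1_def s2_def step_proc_def halted_def)
  qed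
  have 2: "step prog P s1 = s2" using m2 p2 by simp
  have z': "local_exec ins m (rg p) 2 = 0" for p
    using ins zero by (cases ins) auto
  have n3: "writes_to prog (procs s2 p) x \<longleftrightarrow> False" for p x
    using len nth by (auto simp: writes_to_def store_request_def s2_def halted_def)
  have p3: "step_proc prog mm (procs s2 p) =
      \<lparr>pc = i + 5, regs = if rg p r = 0 then rg p else local_exec ins m (rg p)\<rparr>" for p mm
    using len nth zero triv z' by (auto simp: s2_def step_proc_def halted_def)
  have 3: "step prog P s2 = lockstep (i + 5)
      (\<lambda>p. if rg p r = 0 then rg p else local_exec ins m (rg p))
      (mem_exec P ins (\<lambda>p. rg p r \<noteq> 0) rg m)"
    by (simp add: step_def n3 p3 lockstep_def) (simp add: s2_def)
  show ?thesis by (simp add: eval_nat_numeral 1 2 3)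
qed

text \<open>Jump targets are absolute, so the induction places the code at an arbitrary offset
  inside a larger program. That register 2 stays 0 is carried along because the unconditional jumps
  rely on it.\<close>

lemma run_code:
  assumes "run P c rg m t rg' m'"
    and "\<forall>p. rg p 2 = 0"
    and "prog = pre @ code i c @ post" "length pre = i"
  shows "(step prog P ^^ t) (lockstep i rg m) = lockstep (i + code_size c) rg' m' \<and>
    (\<forall>p. rg' p 2 = 0)"
  using assms
proof (induction arbitrary: i pre post rule: run.induct)
  case (Instr ins rg m)
  have "prog ! i = ins" "i < length prog" using Instr by (auto simp: nth_append)
  moreover have "local_exec ins m (rg p) 2 = 0" for p
    using Instr by (cases ins) auto
  ultimately show ?case using step_lockstep[of i prog P rg m] Instr by simp
next
  case (Guarded ins r rg m)
  have "local_exec ins m (rg p) 2 = 0" for p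
    using Guarded by (cases ins) auto
  moreover have "(step prog P ^^ 3) (lockstep i rg m) = lockstep (i + 5)
      (\<lambda>p. if rg p r = 0 then rg p else local_exec ins m (rg p))
      (mem_exec P ins (\<lambda>p. rg p r \<noteq> 0) rg m)"
    by (rule steps_guarded) (fact Guarded)+
  ultimately show ?case using Guarded(2) by simp
next
  case (Seq c1 rg m t rg' m' c2 t' rg'' m'')
  have 1: "(step prog P ^^ t) (lockstep i rg m) = lockstep (i + code_size c1) rg' m' \<and>
    (\<forall>p. rg' p 2 = 0)"
    by (rule Seq.IH(1)[of pre _ "code (i + code_size c1) c2 @ post"]) (use Seq.prems in auto)
  have 2: "(step prog P ^^ t') (lockstep (i + code_size c1) rg' m') =
      lockstep ((i + code_size c1) + code_size c2) rg'' m'' \<and> (\<forall>p. rg'' p 2 = 0)"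
    by (rule Seq.IH(2)[of "pre @ code i c1" _ post]) (use Seq.prems 1 in auto)
  have "(step prog P ^^ (t + t')) (lockstep i rg m) =
      (step prog P ^^ t') ((step prog P ^^ t) (lockstep i rg m))"
    by (simp only: add.commute[of t t'] funpow_add o_apply)
  also have "\<dots> = lockstep (i + code_size (c1 ;; c2)) rg'' m''"
    using 1 2 by (simp add: add.assoc)
  finally show ?case using 2 by blast
next
  case (While_stop rg r c m)
  have "prog ! i = JumpZero r (i + code_size c + 2)" "i < length prog"
    using While_stop by (auto simp: nth_append)
  then show ?case using step_jump[of i prog r _ P rg m] While_stop by (simp add: lockstep_def)
next
  case (While_step rg r c m t rg' m' t' rg'' m'')
  have nth: "prog ! i = JumpZero r (i + code_size c + 2)" "i < length prog"
    using While_step by (auto simp: nth_append)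
  have 1: "step prog P (lockstep i rg m) = lockstep (Suc i) rg m"
    using step_jump[OF nth(2,1), of P rg m] While_step.hyps(1) by (simp add: lockstep_def)
  have 2: "(step prog P ^^ t) (lockstep (Suc i) rg m) = lockstep (Suc i + code_size c) rg' m' \<and>
    (\<forall>p. rg' p 2 = 0)"
    by (rule While_step.IH(1)[of "pre @ [JumpZero r (i + code_size c + 2)]" _ "JumpZero 2 i # post"])
      (use While_step.prems in auto)
  have nth': "prog ! (Suc i + code_size c) = JumpZero 2 i" "Suc i + code_size c < length prog"
    using While_step.prems by (auto simp: nth_append nth_Cons')
  have 3: "step prog P (lockstep (Suc i + code_size c) rg' m') = lockstep i rg' m'"
    using step_jump[OF nth'(2,1), of P rg' m'] 2 by (simp add: lockstep_def)
  have 4: "(step prog P ^^ t') (lockstep i rg' m') =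
      lockstep (i + code_size (While r c)) rg'' m'' \<and> (\<forall>p. rg'' p 2 = 0)"
    by (rule While_step.IH(2)) (use While_step.prems 2 in auto)
  have "(step prog P ^^ (t + (1 + t'))) (lockstep (Suc i) rg m) =
      (step prog P ^^ (1 + t')) ((step prog P ^^ t) (lockstep (Suc i) rg m))"
    by (simp only: add.commute[of t "1 + t'"] funpow_add o_apply)
  also have "\<dots> = (step prog P ^^ t') (lockstep i rg' m')"
    using 2 3 by (simp only: plus_1_eq_Suc funpow_Suc_right o_apply)
  finally have h: "(step prog P ^^ (1 + (t + (1 + t')))) (lockstep i rg m) =
      (step prog P ^^ t') (lockstep i rg' m')"
    by (simp only: plus_1_eq_Suc funpow_Suc_right o_apply 1)
  show ?case by (rule conjI[OF trans[OF h conjunct1[OF 4]] conjunct2[OF 4]])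
qed

section \<open>Total correctness with a bound on the running time\<close>

definition reaches :: "nat \<Rightarrow> com \<Rightarrow> (nat \<Rightarrow> registers) \<Rightarrow> memory \<Rightarrow> nat \<Rightarrow>
    ((nat \<Rightarrow> registers) \<Rightarrow> memory \<Rightarrow> bool) \<Rightarrow> bool" where
  "reaches P c rg m T Q \<longleftrightarrow> (\<exists>t rg' m'. run P c rg m t rg' m' \<and> t \<le> T \<and> Q rg' m')"

lemma reaches_mono:
  assumes "reaches P c rg m T Q" "T \<le> T'" "\<And>rg m. Q rg m \<Longrightarrow> Q' rg m"
  shows "reaches P c rg m T' Q'"
  using assms unfolding reaches_def by (meson order_trans)

lemma reaches_Instr:
  assumes "plain ins" "1 \<le> T"
    "Q (\<lambda>p. local_exec ins m (rg p)) (mem_exec P ins (\<lambda>_. True) rg m)"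
  shows "reaches P (Instr ins) rg m T Q"
  using assms run.Instr unfolding reaches_def by blast

lemma reaches_Guarded:
  assumes "plain ins" "3 \<le> T"
    "Q (\<lambda>p. if rg p r = 0 then rg p else local_exec ins m (rg p))
       (mem_exec P ins (\<lambda>p. rg p r \<noteq> 0) rg m)"
  shows "reaches P (Guarded r ins) rg m T Q"
  using assms run.Guarded unfolding reaches_def by blast

lemma reaches_Seq:
  assumes "reaches P c1 rg m T1 (\<lambda>rg' m'. reaches P c2 rg' m' T2 Q)" "T1 + T2 \<le> T"
  shows "reaches P (c1 ;; c2) rg m T Q"
proof -
  from assms obtain t rg' m' t' rg'' m'' where
    "run P c1 rg m t rg' m'" "t \<le> T1" "run P c2 rg' m' t' rg'' m''" "t' \<le> T2" "Q rg'' m''"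
    unfolding reaches_def by blast
  moreover from this have "t + t' \<le> T" using assms(2) by linarith
  ultimately show ?thesis unfolding reaches_def using run.Seq by blast
qed

lemma reaches_Instr_Seq:
  assumes "plain ins" "1 \<le> T"
    "reaches P c (\<lambda>p. local_exec ins m (rg p)) (mem_exec P ins (\<lambda>_. True) rg m) (T - 1) Q"
  shows "reaches P (Instr ins ;; c) rg m T Q"
  by (rule reaches_Seq[of _ _ _ _ 1 _ "T - 1"], rule reaches_Instr) (use assms in auto)

lemma reaches_Instr_Seq_eq:
  assumes "plain ins" "\<And>p. local_exec ins m (rg p) = rg1 p"
    "mem_exec P ins (\<lambda>_. True) rg m = m1" "reaches P c rg1 m1 T Q" "T + 1 \<le> T'"
  shows "reaches P (Instr ins ;; c) rg m T' Q"
proof -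
  have "(\<lambda>p. local_exec ins m (rg p)) = rg1" using assms(2) by auto
  moreover have "reaches P c rg1 m1 (T' - 1) Q"
    by (rule reaches_mono[OF assms(4)]) (use assms(5) in simp_all)
  ultimately have "reaches P c (\<lambda>p. local_exec ins m (rg p))
      (mem_exec P ins (\<lambda>_. True) rg m) (T' - 1) Q"
    unfolding assms(3) by (simp only:)
  then show ?thesis
    by (rule reaches_Instr_Seq[rotated 2]) (use assms(1,5) in simp_all)
qed

text \<open>\<open>count\<close> pins the loop register to the same \<open>k\<close> in all
  processors, so they leave the loop together. The 2 added to \<open>T\<close> pays for the test and
  the jump back, the final 1 for the test that ends the loop.\<close>

lemma reaches_While:
  assumes count: "\<And>k rg m p. I k rg m \<Longrightarrow> rg p r = k"
    and body: "\<And>k rg m. I (Suc k) rg m \<Longrightarrow> Suc k \<le> n \<Longrightarrow> reaches P c rg m T (I k)"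
    and "I n rg m" "n * (T + 2) + 1 \<le> T'"
  shows "reaches P (While r c) rg m T' (I 0)"
proof -
  have "k \<le> n \<Longrightarrow> I k rg m \<Longrightarrow> reaches P (While r c) rg m (k * (T + 2) + 1) (I 0)" for k rg m
  proof (induction k arbitrary: rg m)
    case 0
    then have "\<forall>p. rg p r = 0" using count by blast
    then have "run P (While r c) rg m 1 rg m" by (rule run.While_stop)
    with 0 show ?case unfolding reaches_def by (intro exI conjI) auto
  next
    case (Suc k)
    from body[OF Suc.prems(2) Suc.prems(1)] obtain t rg' m' where
      1: "run P c rg m t rg' m'" "t \<le> T" "I k rg' m'" unfolding reaches_def by blast
    have "k \<le> n" using Suc.prems(1) by simp
    from Suc.IH[OF this 1(3)] obtain t' rg'' m'' where
      2: "run P (While r c) rg' m' t' rg'' m''" "t' \<le> k * (T + 2) + 1" "I 0 rg'' m''"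
      unfolding reaches_def by blast
    have "\<forall>p. rg p r \<noteq> 0" by (simp add: count[OF Suc.prems(2)])
    then have "run P (While r c) rg m (1 + (t + (1 + t'))) rg'' m''"
      using 1(1) 2(1) by (rule run.While_step)
    moreover have "1 + (t + (1 + t')) \<le> Suc k * (T + 2) + 1" using 1 2 by simp
    ultimately show ?case unfolding reaches_def by (intro exI conjI) (use 2(3) in auto)
  qed
  from this[OF order_refl assms(3)] show ?thesis
    by (rule reaches_mono) (use assms(4) in auto)
qed

section \<open>Arithmetic expressions with shifts and products\<close>

datatype expr =
    Reg nat
  | Lit nat
  | Sum expr expr
  | Diff expr expr
  | Fetch expr
  | Shl nat expr
  | Shr nat expr
  | Prod expr expr

text \<open>Shifts and products take a number of steps that depends on a counter register, which has
  to hold the same value in all processors.  Only the registers 3 and 4 serve as counters; the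
  product truncates its first factor to as many bits as register 3 says.\<close>

fun eval :: "expr \<Rightarrow> registers \<Rightarrow> memory \<Rightarrow> nat" where
  "eval (Reg r) rg m = rg r"
| "eval (Lit k) rg m = k"
| "eval (Sum a b) rg m = eval a rg m + eval b rg m"
| "eval (Diff a b) rg m = eval a rg m - eval b rg m"
| "eval (Fetch a) rg m = m (eval a rg m)"
| "eval (Shl r a) rg m = eval a rg m * 2 ^ rg r"
| "eval (Shr r a) rg m = eval a rg m div 2 ^ rg r"
| "eval (Prod a b) rg m = (eval a rg m mod 2 ^ rg 3) * eval b rg m"

fun regs_below :: "nat \<Rightarrow> expr \<Rightarrow> bool" where
  "regs_below d (Reg r) = (r < d)"
| "regs_below d (Lit k) = True"
| "regs_below d (Sum a b) = (regs_below d a \<and> regs_below d b)"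
| "regs_below d (Diff a b) = (regs_below d a \<and> regs_below d b)"
| "regs_below d (Fetch a) = regs_below d a"
| "regs_below d (Shl r a) = (regs_below d a \<and> (r = 3 \<or> r = 4))"
| "regs_below d (Shr r a) = (regs_below d a \<and> (r = 3 \<or> r = 4))"
| "regs_below d (Prod a b) = (regs_below d a \<and> regs_below d b)"

text \<open>Registers from \<open>d\<close> upwards serve as a stack: the value ends up in
  \<open>d\<close> and nothing below is touched, so a second operand goes to \<open>d + 1\<close>.
  \<open>Prod\<close> is shift-and-add: \<open>d + 6\<close> receives the lowest bit of the first
  factor, \<open>d + 2\<close> accumulates, and the number of passes comes from register 3, not from
  the data.\<close>

fun compute :: "nat \<Rightarrow> expr \<Rightarrow> com" where
  "compute d (Reg r) = Instr (Add d r 2)"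
| "compute d (Lit k) = Instr (Const d k)"
| "compute d (Sum a b) = compute d a ;; compute (d + 1) b ;; Instr (Add d d (d + 1))"
| "compute d (Diff a b) = compute d a ;; compute (d + 1) b ;; Instr (Sub d d (d + 1))"
| "compute d (Fetch a) = compute d a ;; Instr (Load d d)"
| "compute d (Shl r a) =
     compute d a ;; Instr (Add (d + 1) r 2) ;; Instr (Const (d + 2) 1) ;;
     While (d + 1) (Instr (Add d d d) ;; Instr (Sub (d + 1) (d + 1) (d + 2)))"
| "compute d (Shr r a) =
     compute d a ;; Instr (Add (d + 1) r 2) ;; Instr (Const (d + 2) 1) ;;
     While (d + 1) (Instr (Half d d) ;; Instr (Sub (d + 1) (d + 1) (d + 2)))"
| "compute d (Prod a b) =
     compute d a ;; compute (d + 1) b ;;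
     Instr (Const (d + 2) 0) ;; Instr (Add (d + 3) 3 2) ;; Instr (Const (d + 4) 1) ;;
     While (d + 3)
       (Instr (Half (d + 5) d) ;; Instr (Add (d + 6) (d + 5) (d + 5)) ;;
        Instr (Sub (d + 6) d (d + 6)) ;; Guarded (d + 6) (Add (d + 2) (d + 2) (d + 1)) ;;
        Instr (Add (d + 1) (d + 1) (d + 1)) ;; Instr (Add d (d + 5) 2) ;;
        Instr (Sub (d + 3) (d + 3) (d + 4))) ;;
     Instr (Add d (d + 2) 2)"

text \<open>Counted in units of \<open>B + 1\<close>, where \<open>B\<close> bounds registers 3 and
  4, since a shift or a product makes up to \<open>B\<close> passes.\<close>

fun expr_cost :: "expr \<Rightarrow> nat" where
  "expr_cost (Reg r) = 1"
| "expr_cost (Lit k) = 1"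
| "expr_cost (Sum a b) = expr_cost a + expr_cost b + 1"
| "expr_cost (Diff a b) = expr_cost a + expr_cost b + 1"
| "expr_cost (Fetch a) = expr_cost a + 1"
| "expr_cost (Shl r a) = expr_cost a + 7"
| "expr_cost (Shr r a) = expr_cost a + 7"
| "expr_cost (Prod a b) = expr_cost a + expr_cost b + 16"

lemma regs_below_mono: "regs_below d e \<Longrightarrow> d \<le> d' \<Longrightarrow> regs_below d' e"
  by (induction e) auto

text \<open>\<open>4 < d\<close> keeps the counters 3 and 4, which shifts and products read, among
  the registers that agree.\<close>

lemma eval_cong:
  assumes "regs_below d e" "\<And>r. r < d \<Longrightarrow> rg r = rg' r" "4 < d"
  shows "eval e rg m = eval e rg' m"
  using assms by (induction e) auto

definition counters_le :: "nat \<Rightarrow> (nat \<Rightarrow> registers) \<Rightarrow> bool" where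
  "counters_le B rg \<longleftrightarrow> (\<exists>a b. a \<le> B \<and> b \<le> B \<and> (\<forall>p. rg p 3 = a \<and> rg p 4 = b))"

definition zeroed :: "(nat \<Rightarrow> registers) \<Rightarrow> bool" where
  "zeroed rg \<longleftrightarrow> (\<forall>p. rg p 2 = 0)"

text \<open>Treats \<open>Shl\<close> and \<open>Shr\<close> together: both iterate an instruction
  on one register, with \<open>f\<close> doubling or halving it.\<close>

lemma reaches_shift:
  assumes "n \<le> B" "\<forall>p. rg p r = n" "r < d" "zeroed rg" "2 < d"
    and ins: "\<And>rg. local_exec ins m rg = rg(d := f (rg d))"
      "\<And>act rg. mem_exec P ins act rg m = m" "plain ins"
  shows "reaches P (Instr (Add (d + 1) r 2) ;; Instr (Const (d + 2) 1) ;;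
      While (d + 1) (Instr ins ;; Instr (Sub (d + 1) (d + 1) (d + 2)))) rg m (7 * (B + 1))
     (\<lambda>rg' m'. m' = m \<and> (\<forall>p. rg' p d = (f ^^ n) (rg p d) \<and> (\<forall>q<d. rg' p q = rg p q)))"
proof -
  define I where "I k rg' m' \<longleftrightarrow> m' = m \<and> k \<le> n \<and> (\<forall>p. rg' p (d + 1) = k \<and> rg' p (d + 2) = 1 \<and>
    rg' p d = (f ^^ (n - k)) (rg p d) \<and> (\<forall>q<d. rg' p q = rg p q))" for k rg' m'
  have loop: "reaches P (While (d + 1) (Instr ins ;; Instr (Sub (d + 1) (d + 1) (d + 2))))
      rg' m (4 * n + 1) (I 0)" if "I n rg' m" for rg'
  proof (rule reaches_While[where n = n and T = 2 and I = I])
    fix k rg' m'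
    assume I: "I (Suc k) rg' m'" and "Suc k \<le> n"
    then have "(f ^^ (n - k)) x = f ((f ^^ (n - Suc k)) x)" for x
      by (metis Suc_diff_Suc Suc_le_lessD funpow.simps(2) o_apply)
    with I ins \<open>2 < d\<close> show "reaches P (Instr ins ;; Instr (Sub (d + 1) (d + 1) (d + 2))) rg' m' 2 (I k)"
      by (intro reaches_Instr_Seq reaches_Instr) (auto simp: I_def)
  qed (use that in \<open>auto simp: I_def\<close>)
  have "I n (\<lambda>p. (rg p)(d + 1 := n, d + 2 := 1)) m" by (simp add: I_def)
  from loop[OF this] have "reaches P (While (d + 1) (Instr ins ;; Instr (Sub (d + 1) (d + 1) (d + 2))))
      (\<lambda>p. (rg p)(d + 1 := n, d + 2 := 1)) m (7 * (B + 1) - 1 - 1)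
     (\<lambda>rg' m'. m' = m \<and> (\<forall>p. rg' p d = (f ^^ n) (rg p d) \<and> (\<forall>q<d. rg' p q = rg p q)))"
    by (rule reaches_mono) (use assms(1) in \<open>auto simp: I_def\<close>)
  then show ?thesis
    using assms by (intro reaches_Instr_Seq) (auto simp: zeroed_def)
qed

lemma reaches_prod:
  assumes "n \<le> B" "\<forall>p. rg p 3 = n" "3 < d" "zeroed rg"
  shows "reaches P (Instr (Const (d + 2) 0) ;; Instr (Add (d + 3) 3 2) ;; Instr (Const (d + 4) 1) ;;
     While (d + 3)
       (Instr (Half (d + 5) d) ;; Instr (Add (d + 6) (d + 5) (d + 5)) ;;
        Instr (Sub (d + 6) d (d + 6)) ;; Guarded (d + 6) (Add (d + 2) (d + 2) (d + 1)) ;;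
        Instr (Add (d + 1) (d + 1) (d + 1)) ;; Instr (Add d (d + 5) 2) ;;
        Instr (Sub (d + 3) (d + 3) (d + 4))) ;;
     Instr (Add d (d + 2) 2)) rg m (16 * (B + 1))
    (\<lambda>rg' m'. m' = m \<and>
      (\<forall>p. rg' p d = (rg p d mod 2 ^ n) * rg p (d + 1) \<and> (\<forall>q<d. rg' p q = rg p q)))"
    (is "reaches P (_ ;; _ ;; _ ;; While _ ?body ;; _) _ _ _ ?Q")
proof -
  \<comment> \<open>With \<open>k\<close> passes left, the low \<open>n - k\<close> bits of the
    first factor have been multiplied out; its remaining bits are in \<open>d\<close>, and the
    second factor has been shifted to match.\<close>
  define I where "I k rg' m' \<longleftrightarrow> m' = m \<and> k \<le> n \<and> (\<forall>p. rg' p (d + 3) = k \<and> rg' p (d + 4) = 1 \<and>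
    rg' p d = rg p d div 2 ^ (n - k) \<and> rg' p (d + 1) = rg p (d + 1) * 2 ^ (n - k) \<and>
    rg' p (d + 2) = (rg p d mod 2 ^ (n - k)) * rg p (d + 1) \<and>
    (\<forall>q<d. rg' p q = rg p q))" for k rg' m'
  have loop: "reaches P (While (d + 3) ?body) rg' m (11 * n + 1) (I 0)" if "I n rg' m" for rg'
  proof (rule reaches_While[where n = n and T = 9 and I = I])
    fix k rg' m'
    assume I: "I (Suc k) rg' m'" and "Suc k \<le> n"
    then have nk: "n - k = Suc (n - Suc k)" by simp
    have half: "x - 2 * (x div 2) = x mod 2" for x :: nat by (simp add: minus_mult_div_eq_mod)
    have m: "m' = m" using I by (simp add: I_def)
    define e where "e = n - Suc k"
    have r: "rg' p (d + 3) = Suc k" "rg' p (d + 4) = 1"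
      "rg' p d = rg p d div 2 ^ e" "rg' p (d + 1) = rg p (d + 1) * 2 ^ e"
      "rg' p (d + 2) = (rg p d mod 2 ^ e) * rg p (d + 1)" "\<forall>q<d. rg' p q = rg p q"
      "rg' p 2 = 0" "rg' p 3 = n" for p
      using I assms unfolding I_def e_def zeroed_def by auto
    have z: "rg p (Suc (Suc 0)) = 0" for p using assms by (simp add: zeroed_def numeral_2_eq_2)
    have d1: "rg p d div 2 ^ e div 2 = rg p d div 2 ^ Suc e" for p
      by (simp flip: div_mult2_eq add: mult.commute)
    have d2: "rg p d mod 2 ^ Suc e = rg p d mod 2 ^ e + 2 ^ e * (rg p d div 2 ^ e mod 2)" for p
      by (metis mod_mult2_eq mult.commute power_Suc add.commute)
    have d3: "a - (a div 2 + a div 2) = a mod 2" for a :: nat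
      by (metis half mult_2)
    \<comment> \<open>\<open>rg1\<close>, \<open>rg2\<close> and \<open>rg3\<close> are the
      registers after extracting the low bit, after the guarded addition and at the end of the
      pass.\<close>
    define rg1 where "rg1 = (\<lambda>p. (rg' p)(d + 5 := rg' p d div 2, d + 6 := rg' p d mod 2))"
    define rg2 where "rg2 = (\<lambda>p. if rg1 p (d + 6) = 0 then rg1 p
        else (rg1 p)(d + 2 := rg1 p (d + 2) + rg1 p (d + 1)))"
    define rg3 where "rg3 = (\<lambda>p. (rg2 p)(d + 1 := rg2 p (d + 1) + rg2 p (d + 1),
        d := rg1 p (d + 5), d + 3 := k))"
    have 2: "I k rg3 m"
      unfolding I_def nk e_def[symmetric] d2
    proof (intro conjI allI impI)
      fix p
      show "rg3 p (d + 2) = (rg p d mod 2 ^ e + 2 ^ e * (rg p d div 2 ^ e mod 2)) * rg p (d + 1)"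
      proof (cases "rg p d div 2 ^ e mod 2 = 0")
        case True
        with r[of p] show ?thesis by (simp add: rg3_def rg2_def rg1_def)
      next
        case False
        then have "rg p d div 2 ^ e mod 2 = 1" by simp
        with r[of p] show ?thesis by (simp add: rg3_def rg2_def rg1_def algebra_simps)
      qed
    qed (use r \<open>Suc k \<le> n\<close> d1 in \<open>simp_all add: rg3_def rg2_def rg1_def\<close>)
    have 1: "reaches P ?body rg' m 9 (\<lambda>rg' m'. rg' = rg3 \<and> m' = m)"
    proof -
      let ?Q' = "\<lambda>rg' m'. rg' = rg3 \<and> m' = m"
      let ?c = "Instr (Add (d + 1) (d + 1) (d + 1)) ;; Instr (Add d (d + 5) 2) ;;
        Instr (Sub (d + 3) (d + 3) (d + 4))"
      have rg2: "rg2 p (d + 4) = 1" "rg2 p (d + 3) = Suc k" "rg2 p 2 = 0" "rg2 p (d + 5) = rg1 p (d + 5)" for p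
        using r[of p] assms(3) by (auto simp: rg2_def rg1_def)
      have A: "reaches P ?c rg2 m 3 ?Q'"
        by (intro reaches_Instr_Seq reaches_Instr)
          (use rg2 assms(3) in \<open>auto simp: rg3_def fun_eq_iff\<close>)
      have B: "reaches P (Guarded (d + 6) (Add (d + 2) (d + 2) (d + 1)) ;; ?c) rg1 m 6 ?Q'"
        by (rule reaches_Seq[where ?T1.0 = 3 and ?T2.0 = 3], rule reaches_Guarded)
          (use A assms(3) in \<open>simp_all add: rg2_def cong: if_cong\<close>)
      define rga where "rga = (\<lambda>p. (rg' p)(d + 5 := rg' p d div 2))"
      define rgb where "rgb = (\<lambda>p. (rga p)(d + 6 := rg' p d div 2 + rg' p d div 2))"
      have C: "reaches P (Instr (Sub (d + 6) d (d + 6)) ;;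
          Guarded (d + 6) (Add (d + 2) (d + 2) (d + 1)) ;; ?c) rgb m 7 ?Q'"
        by (rule reaches_Instr_Seq_eq[OF _ _ _ B])
          (use assms(3) in \<open>simp_all add: rga_def rgb_def rg1_def d3\<close>)
      have D: "reaches P (Instr (Add (d + 6) (d + 5) (d + 5)) ;; Instr (Sub (d + 6) d (d + 6)) ;;
          Guarded (d + 6) (Add (d + 2) (d + 2) (d + 1)) ;; ?c) rga m 8 ?Q'"
        by (rule reaches_Instr_Seq_eq[OF _ _ _ C])
          (use assms(3) in \<open>simp_all add: rga_def rgb_def\<close>)
      show ?thesis
        by (rule reaches_Instr_Seq_eq[OF _ _ _ D]) (use assms(3) in \<open>simp_all add: rga_def\<close>)
    qed
    show "reaches P ?body rg' m' 9 (I k)"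
      unfolding m by (rule reaches_mono[OF 1 order_refl]) (use 2 in simp)
  qed (use that in \<open>auto simp: I_def\<close>)
  define rg0 where "rg0 = (\<lambda>p. (rg p)(d + 2 := 0, d + 3 := n, d + 4 := 1))"
  have "I n rg0 m" by (simp add: I_def rg0_def)
  from loop[OF this] have "reaches P (While (d + 3) ?body) rg0 m (11 * n + 1)
    (\<lambda>rg' m'. reaches P (Instr (Add d (d + 2) 2)) rg' m' 1 ?Q)"
    by (rule reaches_mono) (use assms in \<open>auto simp: I_def zeroed_def intro!: reaches_Instr\<close>)
  then have "reaches P (While (d + 3) ?body ;; Instr (Add d (d + 2) 2)) rg0 m (16 * (B + 1) - 1 - 1 - 1) ?Q"
    by (rule reaches_Seq) (use assms(1) in auto)
  moreover have "(\<lambda>p. ((rg p)(d + 2 := 0, d + 3 := n))(d + 4 := 1)) = rg0"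
    by (simp add: rg0_def)
  ultimately show ?thesis
    using assms by (intro reaches_Instr_Seq) (auto simp: zeroed_def)
qed

lemma funpow_double: "((\<lambda>x::nat. x + x) ^^ n) a = a * 2 ^ n"
  by (induction n) auto

lemma funpow_half: "((\<lambda>x::nat. x div 2) ^^ n) a = a div 2 ^ n"
  by (induction n) (auto simp flip: div_mult2_eq simp: mult.commute)

lemma reaches_pair:
  assumes "reaches P c1 rg m T1 (\<lambda>rg' m'. m' = m \<and>
      (\<forall>p. rg' p d = va p \<and> (\<forall>q<d. rg' p q = rg p q)))"
    and "\<And>rg'. \<forall>p. \<forall>q<d. rg' p q = rg p q \<Longrightarrow> reaches P c2 rg' m T2 (\<lambda>rg'' m'. m' = m \<and>
      (\<forall>p. rg'' p (d + 1) = vb p \<and> (\<forall>q<d + 1. rg'' p q = rg' p q)))"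
    and "\<And>rg'. \<forall>p. rg' p d = va p \<and> rg' p (d + 1) = vb p \<and> (\<forall>q<d. rg' p q = rg p q) \<Longrightarrow>
      reaches P c3 rg' m T3 Q"
    and "T1 + (T2 + T3) \<le> T"
  shows "reaches P (c1 ;; c2 ;; c3) rg m T Q"
proof (rule reaches_Seq[OF reaches_mono[OF assms(1) order_refl] assms(4)])
  fix rg' m'
  assume 1: "m' = m \<and> (\<forall>p. rg' p d = va p \<and> (\<forall>q<d. rg' p q = rg p q))"
  show "reaches P (c2 ;; c3) rg' m' (T2 + T3) Q"
  proof (rule reaches_Seq[OF reaches_mono[OF _ order_refl] order_refl])
    show "reaches P c2 rg' m' T2 (\<lambda>rg'' m'. m' = m \<and>
      (\<forall>p. rg'' p (d + 1) = vb p \<and> (\<forall>q<d + 1. rg'' p q = rg' p q)))"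
      using assms(2) 1 by simp
    fix rg'' m''
    assume "m'' = m \<and> (\<forall>p. rg'' p (d + 1) = vb p \<and> (\<forall>q<d + 1. rg'' p q = rg' p q))"
    with 1 show "reaches P c3 rg'' m'' T3 Q" using assms(3)[of rg''] by simp
  qed
qed

text \<open>The value of \<open>b\<close> can be stated for the original registers: evaluating
  \<open>a\<close> changes only registers from \<open>d\<close> on, which \<open>b\<close> does not
  read.\<close>

lemma reaches_compute_pair:
  assumes IH: "\<And>d rg. regs_below d a \<Longrightarrow> 4 < d \<Longrightarrow> zeroed rg \<Longrightarrow> counters_le B rg \<Longrightarrow>
      reaches P (compute d a) rg m (expr_cost a * (B + 1))
        (\<lambda>rg' m'. m' = m \<and> (\<forall>p. rg' p d = eval a (rg p) m \<and> (\<forall>q<d. rg' p q = rg p q)))"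
    "\<And>d rg. regs_below d b \<Longrightarrow> 4 < d \<Longrightarrow> zeroed rg \<Longrightarrow> counters_le B rg \<Longrightarrow>
      reaches P (compute d b) rg m (expr_cost b * (B + 1))
        (\<lambda>rg' m'. m' = m \<and> (\<forall>p. rg' p d = eval b (rg p) m \<and> (\<forall>q<d. rg' p q = rg p q)))"
    and prems: "regs_below d a" "regs_below d b" "4 < d" "zeroed rg" "counters_le B rg"
    and cont: "\<And>rg'. \<forall>p. rg' p d = eval a (rg p) m \<and> rg' p (d + 1) = eval b (rg p) m \<and>
      (\<forall>q<d. rg' p q = rg p q) \<Longrightarrow> reaches P c rg' m (K * (B + 1)) Q"
  shows "reaches P (compute d a ;; compute (d + 1) b ;; c) rg m
    ((expr_cost a + expr_cost b + K) * (B + 1)) Q"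
proof (rule reaches_pair[OF IH(1) _ cont])
  fix rg' assume *: "\<forall>p. \<forall>q<d. rg' p q = rg p q"
  have ev: "eval b (rg' p) m = eval b (rg p) m" for p
    by (rule eval_cong[of d]) (use * prems in auto)
  have "reaches P (compute (d + 1) b) rg' m (expr_cost b * (B + 1)) (\<lambda>rg'' m'. m' = m \<and>
      (\<forall>p. rg'' p (d + 1) = eval b (rg' p) m \<and> (\<forall>q<d + 1. rg'' p q = rg' p q)))"
  proof (rule IH(2))
    show "regs_below (d + 1) b" using prems regs_below_mono[of d b "d + 1"] by simp
    show "zeroed rg'" "counters_le B rg'"
      using prems * by (auto simp: zeroed_def counters_le_def)
  qed (use prems in auto)
  then show "reaches P (compute (d + 1) b) rg' m (expr_cost b * (B + 1)) (\<lambda>rg'' m'. m' = m \<and>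
      (\<forall>p. rg'' p (d + 1) = eval b (rg p) m \<and> (\<forall>q<d + 1. rg'' p q = rg' p q)))"
    unfolding ev .
qed (use prems in \<open>auto simp: algebra_simps\<close>)

lemma reaches_compute:
  assumes "regs_below d e" "4 < d" "zeroed rg" "counters_le B rg"
  shows "reaches P (compute d e) rg m (expr_cost e * (B + 1))
    (\<lambda>rg' m'. m' = m \<and> (\<forall>p. rg' p d = eval e (rg p) m \<and> (\<forall>q<d. rg' p q = rg p q)))"
  using assms
proof (induction e arbitrary: d rg)
  case (Reg r)
  then show ?case by (auto simp: zeroed_def intro!: reaches_Instr)
next
  case (Lit k)
  then show ?case by (auto intro!: reaches_Instr)
next
  case (Sum a b)
  have "reaches P (compute d (Sum a b)) rg m ((expr_cost a + expr_cost b + 1) * (B + 1))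
    (\<lambda>rg' m'. m' = m \<and> (\<forall>p. rg' p d = eval (Sum a b) (rg p) m \<and> (\<forall>q<d. rg' p q = rg p q)))"
    unfolding compute.simps
    by (rule reaches_compute_pair[OF Sum.IH])
      (use Sum.prems in \<open>auto intro!: reaches_Instr\<close>)
  then show ?case by simp
next
  case (Diff a b)
  have "reaches P (compute d (Diff a b)) rg m ((expr_cost a + expr_cost b + 1) * (B + 1))
    (\<lambda>rg' m'. m' = m \<and> (\<forall>p. rg' p d = eval (Diff a b) (rg p) m \<and> (\<forall>q<d. rg' p q = rg p q)))"
    unfolding compute.simps
    by (rule reaches_compute_pair[OF Diff.IH])
      (use Diff.prems in \<open>auto intro!: reaches_Instr\<close>)
  then show ?case by simp
next
  case (Fetch a)
  show ?case unfolding compute.simps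
    by (rule reaches_Seq[where ?T2.0 = 1, OF reaches_mono[OF Fetch.IH order_refl]])
      (use Fetch.prems in \<open>auto intro!: reaches_Instr\<close>)
next
  case (Shl r a)
  then obtain n where n: "n \<le> B" "\<forall>p. rg p r = n" by (auto simp: counters_le_def)
  show ?case unfolding compute.simps
  proof (rule reaches_Seq[where ?T2.0 = "7 * (B + 1)", OF reaches_mono[OF Shl.IH order_refl]])
    fix rg' m'
    assume *: "m' = m \<and> (\<forall>p. rg' p d = eval a (rg p) m \<and> (\<forall>q<d. rg' p q = rg p q))"
    show "reaches P (Instr (Add (d + 1) r 2) ;; Instr (Const (d + 2) 1) ;;
        While (d + 1) (Instr (Add d d d) ;; Instr (Sub (d + 1) (d + 1) (d + 2)))) rg' m' (7 * (B + 1))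
        (\<lambda>rg' m'. m' = m \<and> (\<forall>p. rg' p d = eval (Shl r a) (rg p) m \<and> (\<forall>q<d. rg' p q = rg p q)))"
      by (rule reaches_mono[OF reaches_shift[where f = "\<lambda>x. x + x" and n = n and B = B]])
        (use * n Shl.prems in \<open>auto simp: zeroed_def funpow_double\<close>)
  qed (use Shl.prems in \<open>auto simp: algebra_simps\<close>)
next
  case (Shr r a)
  then obtain n where n: "n \<le> B" "\<forall>p. rg p r = n" by (auto simp: counters_le_def)
  show ?case unfolding compute.simps
  proof (rule reaches_Seq[where ?T2.0 = "7 * (B + 1)", OF reaches_mono[OF Shr.IH order_refl]])
    fix rg' m'
    assume *: "m' = m \<and> (\<forall>p. rg' p d = eval a (rg p) m \<and> (\<forall>q<d. rg' p q = rg p q))"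
    show "reaches P (Instr (Add (d + 1) r 2) ;; Instr (Const (d + 2) 1) ;;
        While (d + 1) (Instr (Half d d) ;; Instr (Sub (d + 1) (d + 1) (d + 2)))) rg' m' (7 * (B + 1))
        (\<lambda>rg' m'. m' = m \<and> (\<forall>p. rg' p d = eval (Shr r a) (rg p) m \<and> (\<forall>q<d. rg' p q = rg p q)))"
      by (rule reaches_mono[OF reaches_shift[where f = "\<lambda>x. x div 2" and n = n and B = B]])
        (use * n Shr.prems in \<open>auto simp: zeroed_def funpow_half\<close>)
  qed (use Shr.prems in \<open>auto simp: algebra_simps\<close>)
next
  case (Prod a b)
  obtain n where n: "n \<le> B" "\<forall>p. rg p 3 = n" using Prod.prems by (auto simp: counters_le_def)
  have "reaches P (compute d (Prod a b)) rg m ((expr_cost a + expr_cost b + 16) * (B + 1))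
    (\<lambda>rg' m'. m' = m \<and> (\<forall>p. rg' p d = eval (Prod a b) (rg p) m \<and> (\<forall>q<d. rg' p q = rg p q)))"
    unfolding compute.simps
  proof (rule reaches_compute_pair[OF Prod.IH])
    fix rg'
    assume *: "\<forall>p. rg' p d = eval a (rg p) m \<and> rg' p (d + 1) = eval b (rg p) m \<and>
      (\<forall>q<d. rg' p q = rg p q)"
    show "reaches P (Instr (Const (d + 2) 0) ;; Instr (Add (d + 3) 3 2) ;; Instr (Const (d + 4) 1) ;;
     While (d + 3)
       (Instr (Half (d + 5) d) ;; Instr (Add (d + 6) (d + 5) (d + 5)) ;;
        Instr (Sub (d + 6) d (d + 6)) ;; Guarded (d + 6) (Add (d + 2) (d + 2) (d + 1)) ;;
        Instr (Add (d + 1) (d + 1) (d + 1)) ;; Instr (Add d (d + 5) 2) ;;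
        Instr (Sub (d + 3) (d + 3) (d + 4))) ;;
     Instr (Add d (d + 2) 2)) rg' m (16 * (B + 1)) (\<lambda>rg' m'. m' = m \<and>
      (\<forall>p. rg' p d = eval (Prod a b) (rg p) m \<and> (\<forall>q<d. rg' p q = rg p q)))"
      by (rule reaches_mono[OF reaches_prod[of n B] order_refl])
        (use n * Prod.prems in \<open>auto simp: zeroed_def\<close>)
  qed (use Prod.prems in auto)
  then show ?case by simp
qed

section \<open>A loop language and its timed Hoare rules\<close>

text \<open>Program variables are the registers below 50; the others hold intermediate results.\<close>

datatype stm =
    Assign nat expr
  | Put expr expr expr
  | Then stm stm  (infixr \<open>;>\<close> 58)
  | For nat stm
  | Bit_length

fun bit_length :: "nat \<Rightarrow> nat" where
  "bit_length n = (if n = 0 then 0 else Suc (bit_length (n div 2)))"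

declare bit_length.simps [simp del]

text \<open>\<open>Bit_length\<close> sets register 4 to the bit length of the input length plus 3, so that 2 to this
  power, the size of the window, exceeds eight times the input length.\<close>

fun compile :: "stm \<Rightarrow> com" where
  "compile (Assign r e) = compute 50 e ;; Instr (Add r 50 2)"
| "compile (Put g a v) =
     compute 50 g ;; compute 51 a ;; compute 52 v ;; Guarded 50 (Store 51 52)"
| "compile (s ;> t) = compile s ;; compile t"
| "compile (For r s) = While r (compile s ;; Instr (Const 50 1) ;; Instr (Sub r r 50))"
| "compile Bit_length =
     Instr (Const 4 3) ;; Instr (Add 5 1 2) ;; Instr (Const 50 1) ;;
     While 5 (Instr (Half 5 5) ;; Instr (Add 4 4 50))"

fun stm_cost :: "stm \<Rightarrow> nat" where
  "stm_cost (Assign r e) = expr_cost e + 1"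
| "stm_cost (Put g a v) = expr_cost g + expr_cost a + expr_cost v + 3"
| "stm_cost (s ;> t) = stm_cost s + stm_cost t"
| "stm_cost (For r s) = stm_cost s + 5"
| "stm_cost Bit_length = 8"

text \<open>The base depth is 1 and not 0 because expressions contain loops of up to
  \<open>B\<close> passes.\<close>

fun depth :: "stm \<Rightarrow> nat" where
  "depth (s ;> t) = max (depth s) (depth t)"
| "depth (For r s) = Suc (depth s)"
| "depth _ = 1"

text \<open>Blanking the scratch registers keeps them out of assertions, so that evaluating an
  expression cannot invalidate one.\<close>

definition vars :: "(nat \<Rightarrow> registers) \<Rightarrow> nat \<Rightarrow> registers" where
  "vars rg = (\<lambda>p r. if r < 50 then rg p r else 0)"

text \<open>Each nested loop contributes a factor \<open>B + 1\<close>, so the time bound is read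
  off the shape of the statement.\<close>

definition triple :: "nat \<Rightarrow> nat \<Rightarrow> ((nat \<Rightarrow> registers) \<Rightarrow> memory \<Rightarrow> bool) \<Rightarrow> stm \<Rightarrow>
    ((nat \<Rightarrow> registers) \<Rightarrow> memory \<Rightarrow> bool) \<Rightarrow> bool" where
  "triple P B Pre s Post \<longleftrightarrow> (\<forall>rg m. zeroed rg \<longrightarrow> Pre (vars rg) m \<longrightarrow>
     reaches P (compile s) rg m (stm_cost s * (B + 1) ^ depth s)
       (\<lambda>rg' m'. zeroed rg' \<and> Post (vars rg') m'))"

lemma triple_conseq:
  assumes "triple P B Pre s Post" "\<And>rg m. Pre' rg m \<Longrightarrow> Pre rg m" "\<And>rg m. Post rg m \<Longrightarrow> Post' rg m"
  shows "triple P B Pre' s Post'"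
  unfolding triple_def
proof (intro allI impI)
  fix rg m assume "zeroed rg" "Pre' (vars rg) m"
  then have "reaches P (compile s) rg m (stm_cost s * (B + 1) ^ depth s)
       (\<lambda>rg' m'. zeroed rg' \<and> Post (vars rg') m')"
    using assms(1,2) by (simp add: triple_def)
  then show "reaches P (compile s) rg m (stm_cost s * (B + 1) ^ depth s)
       (\<lambda>rg' m'. zeroed rg' \<and> Post' (vars rg') m')"
    by (rule reaches_mono[OF _ order_refl]) (use assms(3) in simp)
qed

lemma triple_Then:
  assumes "triple P B Pre s Q" "triple P B Q t Post"
  shows "triple P B Pre (s ;> t) Post"
  unfolding triple_def
proof (intro allI impI)
  fix rg m assume 0: "zeroed rg" "Pre (vars rg) m"
  show "reaches P (compile (s ;> t)) rg m (stm_cost (s ;> t) * (B + 1) ^ depth (s ;> t))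
       (\<lambda>rg' m'. zeroed rg' \<and> Post (vars rg') m')"
    unfolding compile.simps
  proof (rule reaches_Seq)
    have "reaches P (compile s) rg m (stm_cost s * (B + 1) ^ depth s)
       (\<lambda>rg' m'. zeroed rg' \<and> Q (vars rg') m')"
      using assms(1) 0 by (simp add: triple_def)
    then show "reaches P (compile s) rg m (stm_cost s * (B + 1) ^ depth s)
       (\<lambda>rg' m'. reaches P (compile t) rg' m' (stm_cost t * (B + 1) ^ depth t)
          (\<lambda>rg' m'. zeroed rg' \<and> Post (vars rg') m'))"
      by (rule reaches_mono[OF _ order_refl]) (use assms(2) in \<open>simp add: triple_def\<close>)
    have "(B + 1) ^ depth s \<le> (B + 1) ^ depth (s ;> t)" "(B + 1) ^ depth t \<le> (B + 1) ^ depth (s ;> t)"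
      by (intro power_increasing; simp)+
    then have "stm_cost s * (B + 1) ^ depth s \<le> stm_cost s * (B + 1) ^ depth (s ;> t)"
      "stm_cost t * (B + 1) ^ depth t \<le> stm_cost t * (B + 1) ^ depth (s ;> t)"
      by (auto intro: mult_le_mono2)
    then show "stm_cost s * (B + 1) ^ depth s + stm_cost t * (B + 1) ^ depth t
        \<le> stm_cost (s ;> t) * (B + 1) ^ depth (s ;> t)"
      by (simp only: stm_cost.simps add_mult_distrib add_mono)
  qed
qed

lemma vars_upd: "r < 50 \<Longrightarrow> (\<And>p q. q < 50 \<Longrightarrow> rg' p q = ((rg p)(r := f p)) q) \<Longrightarrow>
    vars rg' = (\<lambda>p. (vars rg p)(r := f p))"
  by (auto simp: vars_def fun_eq_iff)

lemma triple_Assign: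
  assumes "regs_below 50 e" "r < 50" "r \<noteq> 2"
    and Pre: "\<And>rg m. Pre rg m \<Longrightarrow> counters_le B rg \<and> Post (\<lambda>p. (rg p)(r := eval e (rg p) m)) m"
  shows "triple P B Pre (Assign r e) Post"
  unfolding triple_def
proof (intro allI impI)
  fix rg m assume 0: "zeroed rg" "Pre (vars rg) m"
  then have c: "counters_le B rg" using Pre[OF 0(2)] by (auto simp: counters_le_def vars_def)
  have ev: "eval e (vars rg p) m = eval e (rg p) m" for p
    by (rule eval_cong[OF assms(1)]) (auto simp: vars_def)
  show "reaches P (compile (Assign r e)) rg m (stm_cost (Assign r e) * (B + 1) ^ depth (Assign r e))
       (\<lambda>rg' m'. zeroed rg' \<and> Post (vars rg') m')"
    unfolding compile.simps
  proof (rule reaches_Seq[where ?T2.0 = 1,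
      OF reaches_mono[OF reaches_compute[OF assms(1) _ 0(1) c] order_refl]])
    fix rg' m'
    assume *: "m' = m \<and> (\<forall>p. rg' p 50 = eval e (rg p) m \<and> (\<forall>q<50. rg' p q = rg p q))"
    have "vars (\<lambda>p. (rg' p)(r := eval e (rg p) m)) = (\<lambda>p. (vars rg p)(r := eval e (rg p) m))"
      by (rule vars_upd[OF assms(2)]) (use * in simp)
    then have P: "Post (vars (\<lambda>p. (rg' p)(r := eval e (rg p) m))) m"
      using Pre[OF 0(2)] ev by simp
    have z: "rg' p 2 = 0" for p using * 0(1) by (simp add: zeroed_def)
    show "reaches P (Instr (Add r 50 2)) rg' m' 1 (\<lambda>rg' m'. zeroed rg' \<and> Post (vars rg') m')"
      by (rule reaches_Instr) (use * z P assms(3) in \<open>simp_all add: zeroed_def\<close>)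
  qed auto
qed

text \<open>All three expressions are evaluated before any processor stores, so the parallel write
  refers to the old memory throughout.\<close>

lemma triple_Put:
  assumes "regs_below 50 g" "regs_below 50 a" "regs_below 50 v"
    and Pre: "\<And>rg m. Pre rg m \<Longrightarrow> counters_le B rg \<and>
      Post rg (par_write P (\<lambda>p. eval g (rg p) m \<noteq> 0) (\<lambda>p. eval a (rg p) m)
        (\<lambda>p. eval v (rg p) m) m)"
  shows "triple P B Pre (Put g a v) Post"
  unfolding triple_def
proof (intro allI impI)
  fix rg m assume 0: "zeroed rg" "Pre (vars rg) m"
  then have c: "counters_le B rg" using Pre[OF 0(2)] by (auto simp: counters_le_def vars_def)
  have ev: "eval e (vars rg p) m = eval e (rg' p) m"
    if "regs_below 50 e" "\<And>p q. q < 50 \<Longrightarrow> rg' p q = rg p q" for p e rg'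
    by (rule eval_cong[OF that(1)]) (use that(2) in \<open>auto simp: vars_def\<close>)
  let ?Q = "\<lambda>rg' m'. zeroed rg' \<and> Post (vars rg') m'"
  have 3: "reaches P (Guarded 50 (Store 51 52)) rg3 m 3 ?Q"
    if "\<forall>p. rg3 p 50 = eval g (vars rg p) m \<and> rg3 p 51 = eval a (vars rg p) m \<and>
      rg3 p 52 = eval v (vars rg p) m \<and> (\<forall>q<50. rg3 p q = rg p q)" for rg3
  proof (rule reaches_Guarded)
    have "vars (\<lambda>p. if rg3 p 50 = 0 then rg3 p else local_exec (Store 51 52) m (rg3 p)) = vars rg"
      using that by (auto simp: vars_def fun_eq_iff)
    then show "?Q (\<lambda>p. if rg3 p 50 = 0 then rg3 p else local_exec (Store 51 52) m (rg3 p))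
       (mem_exec P (Store 51 52) (\<lambda>p. rg3 p 50 \<noteq> 0) rg3 m)"
      using Pre[OF 0(2)] that 0(1) by (simp add: zeroed_def)
  qed auto
  have 2: "reaches P (compute 52 v ;; Guarded 50 (Store 51 52)) rg2 m (expr_cost v * (B + 1) + 3) ?Q"
    if 2: "\<forall>p. rg2 p 50 = eval g (vars rg p) m \<and> rg2 p 51 = eval a (vars rg p) m \<and>
      (\<forall>q<50. rg2 p q = rg p q)" for rg2
  proof (rule reaches_Seq[OF reaches_mono[OF reaches_compute order_refl] order_refl])
    show "regs_below 52 v" using assms(3) regs_below_mono[of 50 v 52] by simp
    show "zeroed rg2" "counters_le B rg2" using 2 0(1) c by (auto simp: zeroed_def counters_le_def)
    fix rg3 m3
    assume "m3 = m \<and> (\<forall>p. rg3 p 52 = eval v (rg2 p) m \<and> (\<forall>q<52. rg3 p q = rg2 p q))"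
    then show "reaches P (Guarded 50 (Store 51 52)) rg3 m3 3 ?Q"
      using 3[of rg3] 2 ev[OF assms(3), of rg2] by simp
  qed auto
  have 1: "reaches P (compute 51 a ;; compute 52 v ;; Guarded 50 (Store 51 52)) rg1 m
      (expr_cost a * (B + 1) + (expr_cost v * (B + 1) + 3)) ?Q"
    if 1: "\<forall>p. rg1 p 50 = eval g (vars rg p) m \<and> (\<forall>q<50. rg1 p q = rg p q)" for rg1
  proof (rule reaches_Seq[OF reaches_mono[OF reaches_compute order_refl] order_refl])
    show "regs_below 51 a" using assms(2) regs_below_mono[of 50 a 51] by simp
    show "zeroed rg1" "counters_le B rg1" using 1 0(1) c by (auto simp: zeroed_def counters_le_def)
    fix rg2 m2
    assume "m2 = m \<and> (\<forall>p. rg2 p 51 = eval a (rg1 p) m \<and> (\<forall>q<51. rg2 p q = rg1 p q))"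
    then show "reaches P (compute 52 v ;; Guarded 50 (Store 51 52)) rg2 m2 (expr_cost v * (B + 1) + 3) ?Q"
      using 2[of rg2] 1 ev[OF assms(2), of rg1] by simp
  qed auto
  show "reaches P (compile (Put g a v)) rg m (stm_cost (Put g a v) * (B + 1) ^ depth (Put g a v)) ?Q"
    unfolding compile.simps
  proof (rule reaches_Seq[OF reaches_mono[OF reaches_compute order_refl]])
    show "regs_below 50 g" by fact
    show "zeroed rg" "counters_le B rg" by fact+
    fix rg1 m1
    assume "m1 = m \<and> (\<forall>p. rg1 p 50 = eval g (rg p) m \<and> (\<forall>q<50. rg1 p q = rg p q))"
    then show "reaches P (compute 51 a ;; compute 52 v ;; Guarded 50 (Store 51 52)) rg1 m1
      (expr_cost a * (B + 1) + (expr_cost v * (B + 1) + 3)) ?Q"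
      using 1[of rg1] ev[OF assms(1), of rg] by simp
  qed (auto simp: algebra_simps)
qed

lemma triple_For:
  assumes r: "r < 50" "r \<noteq> 2"
    and count: "\<And>k rg m p. I k rg m \<Longrightarrow> rg p r = k"
    and body: "\<And>k. Suc k \<le> n \<Longrightarrow> triple P B (I (Suc k)) s (\<lambda>rg m. I k (\<lambda>p. (rg p)(r := rg p r - 1)) m)"
    and "n \<le> B"
  shows "triple P B (I n) (For r s) (I 0)"
  unfolding triple_def
proof (intro allI impI)
  fix rg m assume 0: "zeroed rg" "I n (vars rg) m"
  let ?T = "stm_cost s * (B + 1) ^ depth s"
  define J where "J = (\<lambda>k rg m. zeroed rg \<and> I k (vars rg) m)"
  have "reaches P (compile (For r s)) rg m (stm_cost (For r s) * (B + 1) ^ depth (For r s)) (J 0)"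
    unfolding compile.simps
  proof (rule reaches_While[where n = n and T = "?T + 2" and I = J])
    fix k rg m p assume "J k rg m"
    then have "vars rg p r = k" using count[of k "vars rg" m p] by (simp add: J_def)
    then show "rg p r = k" using r by (simp add: vars_def)
  next
    fix k rg m assume J: "J (Suc k) rg m" and k: "Suc k \<le> n"
    show "reaches P (compile s ;; Instr (Const 50 1) ;; Instr (Sub r r 50)) rg m (?T + 2) (J k)"
    proof (rule reaches_Seq[OF reaches_mono[OF _ order_refl] order_refl])
      show "reaches P (compile s) rg m ?T
        (\<lambda>rg m. zeroed rg \<and> I k (\<lambda>p. (vars rg p)(r := vars rg p r - 1)) m)"
        using body[OF k] J by (simp add: triple_def J_def)
      fix rg m assume *: "zeroed rg \<and> I k (\<lambda>p. (vars rg p)(r := vars rg p r - 1)) m"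
      have "vars (\<lambda>p. ((rg p)(50 := 1))(r := rg p r - 1)) = (\<lambda>p. (vars rg p)(r := rg p r - 1))"
        by (rule vars_upd[OF r(1)]) simp
      with * r have "J k (\<lambda>p. ((rg p)(50 := 1))(r := rg p r - 1)) m"
        by (simp add: J_def vars_def zeroed_def)
      then show "reaches P (Instr (Const 50 1) ;; Instr (Sub r r 50)) rg m 2 (J k)"
        using r by (intro reaches_Instr_Seq reaches_Instr) simp_all
    qed
  next
    show "J n rg m" using 0 by (simp add: J_def)
    \<comment> \<open>A pass costs \<open>?T\<close> for the body, 2 for decrementing the counter
      and 2 for the test and the jump; the 5 in \<open>stm_cost\<close> also absorbs the last
      test.\<close>
    have slack: "B * (x + 4) + 1 \<le> (B + 1) * (x + 5)" for x by (simp add: algebra_simps)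
    have "n * (?T + 4) \<le> B * (?T + 4)" using \<open>n \<le> B\<close> by (rule mult_le_mono1)
    moreover have "?T + 2 + 2 = ?T + 4" by simp
    ultimately have "n * (?T + 2 + 2) + 1 \<le> B * (?T + 4) + 1" by (simp only: add_right_mono)
    also have "\<dots> \<le> (B + 1) * (?T + 5)" by (rule slack)
    also have "\<dots> \<le> (B + 1) * ((stm_cost s + 5) * (B + 1) ^ depth s)"
      by (intro mult_le_mono2) (simp add: add_mult_distrib)
    also have "\<dots> = stm_cost (For r s) * (B + 1) ^ depth (For r s)" by (simp add: algebra_simps)
    finally show "n * (?T + 2 + 2) + 1 \<le> stm_cost (For r s) * (B + 1) ^ depth (For r s)" .
  qed
  then show "reaches P (compile (For r s)) rg m (stm_cost (For r s) * (B + 1) ^ depth (For r s))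
      (\<lambda>rg' m'. zeroed rg' \<and> I 0 (vars rg') m')"
    unfolding J_def .
qed

lemma triple_Bit_length:
  assumes Pre: "\<And>rg m. Pre rg m \<Longrightarrow> \<exists>L. (\<forall>p. rg p 1 = L) \<and> bit_length L \<le> B \<and>
      Post (\<lambda>p. (rg p)(4 := bit_length L + 3, 5 := 0)) m"
  shows "triple P B Pre Bit_length Post"
  unfolding triple_def
proof (intro allI impI)
  fix rg m assume 0: "zeroed rg" "Pre (vars rg) m"
  then obtain L where L: "\<forall>p. vars rg p 1 = L" "bit_length L \<le> B"
      "Post (\<lambda>p. (vars rg p)(4 := bit_length L + 3, 5 := 0)) m"
    using Pre by blast
  let ?Q = "\<lambda>rg' m'. zeroed rg' \<and> Post (vars rg') m'"
  define rg0 where "rg0 = (\<lambda>p. (rg p)(4 := 3, 5 := L, 50 := 1))"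
  have half: "bit_length x = (if x = 0 then 0 else Suc (bit_length (x div 2)))" for x
    by (rule bit_length.simps)
  \<comment> \<open>The loop register is halved, not decremented, so \<open>reaches_While\<close>
    does not apply; the induction is on its value instead.\<close>
  have loop: "reaches P (While 5 (Instr (Half 5 5) ;; Instr (Add 4 4 50)))
      (\<lambda>p. (rg p)(4 := c, 5 := x, 50 := 1)) m (4 * bit_length x + 1)
      (\<lambda>rg' m'. rg' = (\<lambda>p. (rg p)(4 := c + bit_length x, 5 := 0, 50 := 1)) \<and> m' = m)" for x c
  proof (induction x arbitrary: c rule: less_induct)
    case (less x)
    show ?case
    proof (cases "x = 0")
      case True
      have "run P (While 5 (Instr (Half 5 5) ;; Instr (Add 4 4 50)))
          (\<lambda>p. (rg p)(4 := c, 5 := x, 50 := 1)) m 1 (\<lambda>p. (rg p)(4 := c, 5 := x, 50 := 1)) m"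
        by (rule run.While_stop) (use True in simp)
      then show ?thesis
        unfolding reaches_def using True
        by (intro exI[of _ 1] exI[of _ "\<lambda>p. (rg p)(4 := c, 5 := x, 50 := 1)"] exI[of _ m])
          (simp add: half[of 0])
    next
      case False
      let ?rg = "\<lambda>c x p. (rg p)(4 := c, 5 := x, 50 := 1)"
      have 1: "reaches P (Instr (Half 5 5) ;; Instr (Add 4 4 50)) (?rg c x) m 2
          (\<lambda>rg' m'. rg' = ?rg (c + 1) (x div 2) \<and> m' = m)"
        by (intro reaches_Instr_Seq reaches_Instr) (simp_all add: fun_eq_iff)
      then obtain t where t: "run P (Instr (Half 5 5) ;; Instr (Add 4 4 50)) (?rg c x) m t
          (?rg (c + 1) (x div 2)) m" "t \<le> 2"
        unfolding reaches_def by blast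
      have "reaches P (While 5 (Instr (Half 5 5) ;; Instr (Add 4 4 50))) (?rg (c + 1) (x div 2)) m
          (4 * bit_length (x div 2) + 1)
          (\<lambda>rg' m'. rg' = ?rg (c + 1 + bit_length (x div 2)) 0 \<and> m' = m)"
        by (rule less.IH) (use False in simp)
      then obtain t' where
        t': "run P (While 5 (Instr (Half 5 5) ;; Instr (Add 4 4 50))) (?rg (c + 1) (x div 2)) m t'
          (?rg (c + 1 + bit_length (x div 2)) 0) m" "t' \<le> 4 * bit_length (x div 2) + 1"
        unfolding reaches_def by blast
      have "run P (While 5 (Instr (Half 5 5) ;; Instr (Add 4 4 50))) (?rg c x) m (1 + (t + (1 + t')))
          (?rg (c + 1 + bit_length (x div 2)) 0) m"
        by (rule run.While_step[OF _ t(1) t'(1)]) (use False in simp)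
      moreover have "c + 1 + bit_length (x div 2) = c + bit_length x" using half[of x] False by simp
      ultimately have "run P (While 5 (Instr (Half 5 5) ;; Instr (Add 4 4 50))) (?rg c x) m
          (1 + (t + (1 + t'))) (?rg (c + bit_length x) 0) m"
        by (simp only:)
      moreover have "1 + (t + (1 + t')) \<le> 4 * bit_length x + 1"
        using half[of x] False t(2) t'(2) by simp
      ultimately show ?thesis unfolding reaches_def by blast
    qed
  qed
  have end_state: "vars (\<lambda>p. (rg p)(4 := 3 + bit_length L, 5 := 0, 50 := 1)) =
      (\<lambda>p. (vars rg p)(4 := bit_length L + 3, 5 := 0))"
    by (auto simp: vars_def fun_eq_iff)
  have "reaches P (While 5 (Instr (Half 5 5) ;; Instr (Add 4 4 50))) rg0 m (8 * (B + 1) - 3) ?Q"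
    unfolding rg0_def
    by (rule reaches_mono[OF loop])
      (use L 0 end_state in \<open>auto simp: zeroed_def\<close>)
  moreover have "rg p 1 = L" for p using L(1) by (simp add: vars_def)
  moreover have "rg p 2 = 0" for p using 0(1) by (simp add: zeroed_def)
  ultimately show "reaches P (compile Bit_length) rg m (stm_cost Bit_length * (B + 1) ^ depth Bit_length) ?Q"
    unfolding compile.simps
    by (intro reaches_Instr_Seq) (simp_all add: rg0_def)
qed

section \<open>Bootstrap percolation\<close>

lemma neighbors_eq: "neighbors (a, b) = {(a + 1, b), (a - 1, b), (a, b + 1), (a, b - 1)}"
  by (auto simp: neighbors_def)

text \<open>A cell has only four neighbors, so a sum in \<open>{2, 3, 4}\<close> means that at least
  two are active.\<close>

lemma ftca_234:
  "ftca {2, 3, 4} c u \<longleftrightarrow>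
    c u \<or> (\<exists>v w. v \<noteq> w \<and> v \<in> neighbors u \<and> w \<in> neighbors u \<and> c v \<and> c w)"
proof -
  obtain a b where u: "u = (a, b)" by force
  have fin: "finite (neighbors u)" by (simp add: u neighbors_eq)
  have four: "card (neighbors u) \<le> 4"
    unfolding u neighbors_eq by (rule order_trans[OF card_insert_le_m1]) (auto simp: card_insert_if)
  let ?S = "{v \<in> neighbors u. c v}"
  have S: "finite ?S" "card ?S \<le> 4"
    using fin card_mono[OF fin, of ?S] four by auto
  have "(\<Sum>v\<in>neighbors u. of_bool (c v)) = card (neighbors u \<inter> {v. c v})"
    using fin by (simp add: sum_of_bool_eq)
  also have "neighbors u \<inter> {v. c v} = ?S" by auto
  finally have "(\<Sum>v\<in>neighbors u. of_bool (c v)) \<in> {2, 3, 4 :: nat} \<longleftrightarrow> \<not> card ?S \<le> Suc 0"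
    using S(2) by auto
  also have "\<dots> \<longleftrightarrow> (\<exists>v\<in>?S. \<exists>w\<in>?S. v \<noteq> w)"
    using card_le_Suc0_iff_eq[OF S(1)] by blast
  finally show ?thesis unfolding ftca_def by blast
qed

text \<open>The closure forgets when a cell becomes active, so it may be generated in any order, in
  particular by joining rectangles.\<close>

inductive_set spanned :: "cell set \<Rightarrow> cell set" for A where
  init: "a \<in> A \<Longrightarrow> a \<in> spanned A"
| step: "v \<in> spanned A \<Longrightarrow> w \<in> spanned A \<Longrightarrow> v \<noteq> w \<Longrightarrow> v \<in> neighbors u \<Longrightarrow> w \<in> neighbors u \<Longrightarrow>
    u \<in> spanned A"

lemma spanned_least:
  assumes "A \<subseteq> spanned B"
  shows "spanned A \<subseteq> spanned B"
proof
  fix u assume "u \<in> spanned A"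
  then show "u \<in> spanned B" by induction (use assms in \<open>auto intro: spanned.step\<close>)
qed

lemma spanned_mono: "A \<subseteq> B \<Longrightarrow> spanned A \<subseteq> spanned B"
  by (rule spanned_least) (auto intro: spanned.init)

abbreviation active :: "nat \<Rightarrow> configuration \<Rightarrow> configuration" where
  "active t c \<equiv> (ftca {2, 3, 4} ^^ t) c"

lemma active_Suc:
  "active (Suc t) c u \<longleftrightarrow> active t c u \<or>
    (\<exists>v w. v \<noteq> w \<and> v \<in> neighbors u \<and> w \<in> neighbors u \<and> active t c v \<and> active t c w)"
  by (simp only: funpow.simps o_apply ftca_234)

lemma active_mono:
  assumes "active s c u" "s \<le> t"
  shows "active t c u"
  using assms(2) by (induction t rule: dec_induct) (simp_all only: assms(1) active_Suc simp_thms)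

text \<open>Influence travels at most one cell per step in each coordinate. This is what allows the
  infinite periodic configuration to be cut down to a window.\<close>

lemma active_spanned:
  "active t c u \<Longrightarrow>
    u \<in> spanned {v. c v \<and> \<bar>fst v - fst u\<bar> \<le> int t \<and> \<bar>snd v - snd u\<bar> \<le> int t}"
    (is "_ \<Longrightarrow> u \<in> spanned (?ball t u)")
proof (induction t arbitrary: u)
  case 0
  then show ?case by (auto intro: spanned.init)
next
  case (Suc t)
  have sub: "spanned (?ball t v) \<subseteq> spanned (?ball (Suc t) u)" if "v = u \<or> v \<in> neighbors u" for v
    by (rule spanned_mono) (use that in \<open>auto simp: neighbors_def\<close>)
  have "active t c u \<or>
      (\<exists>v w. v \<noteq> w \<and> v \<in> neighbors u \<and> w \<in> neighbors u \<and> active t c v \<and> active t c w)"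
    using Suc.prems by (simp only: active_Suc)
  then show ?case
  proof (elim disjE exE conjE)
    assume "active t c u"
    with Suc.IH sub show ?thesis by blast
  next
    fix v w assume *: "v \<noteq> w" "v \<in> neighbors u" "w \<in> neighbors u" "active t c v" "active t c w"
    show ?thesis by (rule spanned.step[of v _ w]) (use * Suc.IH sub in blast)+
  qed
qed

lemma spanned_active: "u \<in> spanned {v. c v} \<Longrightarrow> \<exists>t. active t c u"
proof (induction rule: spanned.induct)
  case (init a)
  then show ?case by (intro exI[of _ 0]) simp
next
  case (step v w u)
  then obtain s t where "active s c v" "active t c w" by blast
  then have "active (max s t) c v" "active (max s t) c w" by (auto intro: active_mono)
  with step have "active (Suc (max s t)) c u" unfolding active_Suc by blast
  then show ?case by blast
qed

lemma ftca_shift: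
  assumes "\<And>a b. c (a + k, b + l) = c (a, b)"
  shows "ftca I c (a + k, b + l) = ftca I c (a, b)"
proof -
  have "c (a + k + 1, b + l) = c (a + 1, b)" "c (a + k - 1, b + l) = c (a - 1, b)"
    "c (a + k, b + l + 1) = c (a, b + 1)" "c (a + k, b + l - 1) = c (a, b - 1)"
    using assms[of "a + 1" b] assms[of "a - 1" b] assms[of a "b + 1"] assms[of a "b - 1"]
    by (simp_all add: algebra_simps)
  then show ?thesis using assms by (simp add: ftca_def neighbors_eq del: sum_of_bool_eq)
qed

lemma active_shift:
  assumes "\<And>a b. c (a + k, b + l) = c (a, b)"
  shows "active t c (a + k, b + l) = active t c (a, b)"
proof (induction t arbitrary: a b)
  case 0
  then show ?case using assms by simp
next
  case (Suc t)
  then show ?case unfolding funpow.simps o_apply by (rule ftca_shift)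
qed

lemma periodic_shift: "periodic n x (a + int n * k, b + int n * l) = periodic n x (a, b)"
  by (simp add: periodic_def)

lemma active_periodic_mod:
  "active t (periodic n x) (a, b) = active t (periodic n x) (a mod int n, b mod int n)"
  using active_shift[of "periodic n x" "int n * (a div int n)" "int n * (b div int n)" t
      "a mod int n" "b mod int n", OF periodic_shift]
  by simp

text \<open>Every step before the dynamics stops activates a new cell of the fundamental domain.\<close>

lemma active_periodic_bound:
  assumes "active t (periodic n x) u" "0 < n"
  shows "active (n * n) (periodic n x) u"
proof -
  define c where "c = periodic n x"
  define S where "S t = {u \<in> {0..<int n} \<times> {0..<int n}. active t c u}" for t
  have fin: "finite (S t)" for t by (simp add: S_def)
  have "card ({0..<int n} \<times> {0..<int n}) = n * n" by (simp add: card_cartesian_product)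
  then have bound: "card (S t) \<le> n * n" for t
    using card_mono[of "{0..<int n} \<times> {0..<int n}" "S t"] by (auto simp: S_def)
  \<comment> \<open>As long as no step is idle on the domain, \<open>t\<close> steps activate at
    least \<open>t\<close> of its cells; \<open>t = n * n + 1\<close> exceeds its size and forces an
    idle step.\<close>
  have "(\<exists>s<t. S s = S (Suc s)) \<or> t \<le> card (S t)" for t
  proof (induction t)
    case (Suc t)
    have "S t \<subseteq> S (Suc t)" using active_mono[of t c _ "Suc t"] by (auto simp: S_def)
    then have "S t = S (Suc t) \<or> card (S t) < card (S (Suc t))"
      using fin psubset_card_mono by blast
    with Suc show ?case by (auto intro: less_SucI)
  qed simp
  from this[of "Suc (n * n)"] bound[of "Suc (n * n)"]
  obtain s where "s < Suc (n * n)" and S: "S s = S (Suc s)"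
    by (meson Suc_n_not_le_n le_trans)
  then have s: "s \<le> n * n" by simp
  \<comment> \<open>By periodicity a step that is idle on the domain is idle everywhere, so the
    dynamics has stopped.\<close>
  have "active s c v = active (Suc s) c v" for v
  proof -
    obtain a b where v: "v = (a, b)" by force
    let ?v = "(a mod int n, b mod int n)"
    have "?v \<in> {0..<int n} \<times> {0..<int n}" using assms(2) by simp
    then have "active s c ?v \<longleftrightarrow> ?v \<in> S s" "active (Suc s) c ?v \<longleftrightarrow> ?v \<in> S (Suc s)"
      unfolding S_def by blast+
    then have "active s c ?v = active (Suc s) c ?v" using S by blast
    then show ?thesis unfolding v c_def
      using active_periodic_mod[of s n x a b] active_periodic_mod[of "Suc s" n x a b] by simp
  qed
  then have fix_s: "ftca {2, 3, 4} (active s c) = active s c" by (auto simp: fun_eq_iff)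
  have "active (s + d) c = active s c" for d
    by (induction d) (simp_all add: fix_s)
  moreover have "active (s + t) c u" using assms(1) active_mono[of t c u] by (simp add: c_def)
  ultimately have "active s c u" by simp
  then show ?thesis using active_mono s unfolding c_def by blast
qed

text \<open>Translating the cell by \<open>n * n\<close>, a multiple of the period, puts all cells
  that can influence it within \<open>n * n\<close> steps into the window. Conversely, the window
  contains only cells that are active in the periodic configuration, so nothing false gets
  activated.\<close>

lemma not_stable_iff_spanned:
  assumes "0 < n" "i < n" "j < n" "n + 2 * (n * n) \<le> M"
  shows "\<not> stable {2, 3, 4} (periodic n x) (int i, int j) \<longleftrightarrow>
    (int (i + n * n), int (j + n * n)) \<in>
      spanned {v \<in> {0..<int M} \<times> {0..<int M}. periodic n x v}"
    (is "?L \<longleftrightarrow> ?u \<in> spanned ?A")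
proof
  have shift: "active t (periodic n x) ?u = active t (periodic n x) (int i, int j)" for t
    using active_shift[of "periodic n x" "int n * int n" "int n * int n" t "int i" "int j",
        OF periodic_shift] by simp
  {
    assume ?L
    then obtain t where "active t (periodic n x) ?u" unfolding stable_def shift by blast
    then have "active (n * n) (periodic n x) ?u" using assms(1) by (rule active_periodic_bound)
    then have "?u \<in> spanned {v. periodic n x v \<and> \<bar>fst v - fst ?u\<bar> \<le> int (n * n) \<and>
        \<bar>snd v - snd ?u\<bar> \<le> int (n * n)}"
      by (rule active_spanned)
    also have "\<dots> \<subseteq> spanned ?A"
    proof (rule spanned_mono, rule subsetI)
      fix v assume v: "v \<in> {v. periodic n x v \<and> \<bar>fst v - fst ?u\<bar> \<le> int (n * n) \<and>
        \<bar>snd v - snd ?u\<bar> \<le> int (n * n)}"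
      have "int n + 2 * int (n * n) \<le> int M" using assms(4) by linarith
      with v assms(2,3) show "v \<in> ?A" by (auto simp: mem_Times_iff)
    qed
    finally show "?u \<in> spanned ?A" .
  next
    assume "?u \<in> spanned ?A"
    then have "?u \<in> spanned {v. periodic n x v}" using spanned_mono[of ?A "{v. periodic n x v}"] by auto
    then obtain t where "active t (periodic n x) ?u" using spanned_active by blast
    then show ?L unfolding stable_def shift by blast
  }
qed

section \<open>Rectangles\<close>

text \<open>Curried, so that reflection and transposition of the plane become substitutions; the
  four directions of growth then reduce to growth to the right.\<close>

definition closed2 :: "(int \<Rightarrow> int \<Rightarrow> bool) \<Rightarrow> bool" where
  "closed2 T \<longleftrightarrow> (\<forall>a b. (T (a - 1) b \<and> T (a + 1) b) \<or> (T a (b - 1) \<and> T a (b + 1)) \<or>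
     ((T (a - 1) b \<or> T (a + 1) b) \<and> (T a (b - 1) \<or> T a (b + 1))) \<longrightarrow> T a b)"

lemma closed2D:
  assumes "closed2 T"
  shows "T (a - 1) b \<Longrightarrow> T (a + 1) b \<Longrightarrow> T a b"
    and "T a (b - 1) \<Longrightarrow> T a (b + 1) \<Longrightarrow> T a b"
    and "T (a - 1) b \<Longrightarrow> T a (b - 1) \<Longrightarrow> T a b"
    and "T (a - 1) b \<Longrightarrow> T a (b + 1) \<Longrightarrow> T a b"
    and "T (a + 1) b \<Longrightarrow> T a (b - 1) \<Longrightarrow> T a b"
    and "T (a + 1) b \<Longrightarrow> T a (b + 1) \<Longrightarrow> T a b"
  using assms unfolding closed2_def by blast+

definition filled :: "(int \<Rightarrow> int \<Rightarrow> bool) \<Rightarrow> int \<Rightarrow> int \<Rightarrow> int \<Rightarrow> int \<Rightarrow> bool" where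
  "filled T a1 a2 b1 b2 \<longleftrightarrow> (\<forall>a b. a1 \<le> a \<and> a \<le> a2 \<and> b1 \<le> b \<and> b \<le> b2 \<longrightarrow> T a b)"

text \<open>The distance of two nonempty integer intervals; summed over both axes it is the
  Manhattan distance of two rectangles.\<close>

definition gap :: "int \<Rightarrow> int \<Rightarrow> int \<Rightarrow> int \<Rightarrow> int" where
  "gap a1 a2 c1 c2 = max 0 (c1 - a2) + max 0 (a1 - c2)"

lemma gap_mono: "a1' \<le> a1 \<Longrightarrow> a2 \<le> a2' \<Longrightarrow> gap a1' a2' c1 c2 \<le> gap a1 a2 c1 c2"
  unfolding gap_def by (intro add_mono max.mono) auto

text \<open>One active cell beside a filled rectangle is enough: it spreads up and down, each
  further cell having the previous one of the column and its left neighbor in the rectangle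
  active.\<close>

lemma column_filled:
  assumes "closed2 T" "filled T a1 a2 b1 b2" "a1 \<le> a2" "b1 \<le> b" "b \<le> b2" "T (a2 + 1) b"
  shows "filled T (a2 + 1) (a2 + 1) b1 b2"
proof -
  have left: "T (a2 + 1 - 1) d" if "b1 \<le> d" "d \<le> b2" for d
    using assms(2,3) that by (simp add: filled_def)
  have up: "d \<le> b2 \<longrightarrow> T (a2 + 1) d" if "b \<le> d" for d
    using that
  proof (induction d rule: int_ge_induct)
    case (step d)
    then show ?case using closed2D(3)[OF assms(1), of "a2 + 1" "d + 1"] left[of "d + 1"] assms(4)
      by auto
  qed (use assms in simp)
  have down: "b1 \<le> d \<longrightarrow> T (a2 + 1) d" if "d \<le> b" for d
    using that
  proof (induction d rule: int_le_induct)
    case (step d)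
    then show ?case using closed2D(4)[OF assms(1), of "a2 + 1" "d - 1"] left[of "d - 1"] assms(5)
      by auto
  qed (use assms in simp)
  show ?thesis unfolding filled_def
  proof (intro allI impI)
    fix a d assume *: "a2 + 1 \<le> a \<and> a \<le> a2 + 1 \<and> b1 \<le> d \<and> d \<le> b2"
    then have "a = a2 + 1" by simp
    with * up[of d] down[of d] show "T a d" by (cases "b \<le> d") auto
  qed
qed

text \<open>By \<open>column_filled\<close> a single active cell in column \<open>a2 + 1\<close>
  suffices. It comes from \<open>S\<close>, which reaches beyond \<open>a2\<close>; the cases are
  whether \<open>S\<close> shares a row with \<open>R\<close>, lies above it or lies below
  it.\<close>

lemma extend_right:
  assumes T: "closed2 T" and R: "filled T a1 a2 b1 b2" "a1 \<le> a2" "b1 \<le> b2"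
    and S: "filled T c1 c2 d1 d2" "c1 \<le> c2" "d1 \<le> d2"
    and near: "gap a1 a2 c1 c2 + gap b1 b2 d1 d2 \<le> 2" and "a2 < c2"
  shows "filled T a1 (a2 + 1) b1 b2"
proof -
  have R': "T a b" if "a1 \<le> a" "a \<le> a2" "b1 \<le> b" "b \<le> b2" for a b
    using R that by (simp add: filled_def)
  have S': "T a b" if "c1 \<le> a" "a \<le> c2" "d1 \<le> b" "b \<le> d2" for a b
    using S that by (simp add: filled_def)
  note closed = closed2D[OF T]
  have "\<exists>b. b1 \<le> b \<and> b \<le> b2 \<and> T (a2 + 1) b"
  proof -
    consider "d1 \<le> b2" "b1 \<le> d2" | "d1 > b2" | "d2 < b1" by linarith
    then show ?thesis
    proof cases
      case 1
      \<comment> \<open>In a shared row, either \<open>S\<close> contains the wanted cell or exactly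
        one cell separates it from \<open>R\<close>, and that cell has both horizontal neighbors
        active.\<close>
      define b where "b = max b1 d1"
      have b: "b1 \<le> b" "b \<le> b2" "d1 \<le> b" "b \<le> d2" using 1 R(3) S(3) by (auto simp: b_def)
      have "c1 \<le> a2 + 2" using near \<open>a2 < c2\<close> R(2) by (auto simp: gap_def max_def split: if_splits)
      have "T (a2 + 1) b"
      proof (cases "c1 \<le> a2 + 1")
        case True
        then show ?thesis using S'[of "a2 + 1" b] b \<open>a2 < c2\<close> by simp
      next
        case False
        then have "c1 = a2 + 2" using \<open>c1 \<le> a2 + 2\<close> by simp
        then have "T (a2 + 1 + 1) b" using S'[of "a2 + 2" b] b S(2) by (simp add: add.commute)
        moreover have "T (a2 + 1 - 1) b" using R'[of a2 b] b R(2) by simp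
        ultimately show ?thesis using closed(1) by blast
      qed
      then show ?thesis using b by blast
    next
      case 2
      then have c: "c1 \<le> a2 + 1" "d1 = b2 + 1 \<or> d1 = b2 + 2 \<and> c1 \<le> a2"
        using near \<open>a2 < c2\<close> R(2) by (auto simp: gap_def max_def split: if_splits)
      have B: "T a2 b2" using R' R by simp
      \<comment> \<open>The cell diagonal to the corner \<open>(a2, b2)\<close> becomes active
        first, directly or by bridging the row \<open>b2 + 1\<close>; together with the corner it
        then activates \<open>(a2 + 1, b2)\<close>.\<close>
      have "T (a2 + 1) (b2 + 1)"
      proof (cases "d1 = b2 + 1")
        case True
        then show ?thesis using S' c(1) S(3) \<open>a2 < c2\<close> by simp
      next
        case False
        then have d: "d1 = b2 + 2" "c1 \<le> a2" using c(2) by auto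
        then have "T a2 (b2 + 1 + 1)" "T (a2 + 1) (b2 + 1 + 1)" using S' S(3) \<open>a2 < c2\<close> by simp_all
        moreover from this B have "T a2 (b2 + 1)" using closed(2)[of a2 "b2 + 1"] by simp
        ultimately show ?thesis using closed(4)[of "a2 + 1" "b2 + 1"] by simp
      qed
      with B have "T (a2 + 1) b2" using closed(4)[of "a2 + 1" b2] by simp
      then show ?thesis using R(3) by blast
    next
      case 3
      then have c: "c1 \<le> a2 + 1" "d2 = b1 - 1 \<or> d2 = b1 - 2 \<and> c1 \<le> a2"
        using near \<open>a2 < c2\<close> R(2) by (auto simp: gap_def max_def split: if_splits)
      have B: "T a2 b1" using R' R by simp
      have "T (a2 + 1) (b1 - 1)"
      proof (cases "d2 = b1 - 1")
        case True
        then show ?thesis using S' c(1) S(3) \<open>a2 < c2\<close> by simp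
      next
        case False
        then have d: "d2 = b1 - 2" "c1 \<le> a2" using c(2) by auto
        then have "T a2 (b1 - 1 - 1)" "T (a2 + 1) (b1 - 1 - 1)" using S' S(3) \<open>a2 < c2\<close> by simp_all
        moreover from this B have "T a2 (b1 - 1)" using closed(2)[of a2 "b1 - 1"] by simp
        ultimately show ?thesis using closed(3)[of "a2 + 1" "b1 - 1"] by simp
      qed
      with B have "T (a2 + 1) b1" using closed(3)[of "a2 + 1" b1] by simp
      then show ?thesis using R(3) by blast
    qed
  qed
  then have "filled T (a2 + 1) (a2 + 1) b1 b2" using column_filled[OF T R(1,2)] by blast
  then have col: "T (a2 + 1) b" if "b1 \<le> b" "b \<le> b2" for b
    using that unfolding filled_def by blast
  show ?thesis unfolding filled_def
  proof (intro allI impI)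
    fix a b assume *: "a1 \<le> a \<and> a \<le> a2 + 1 \<and> b1 \<le> b \<and> b \<le> b2"
    show "T a b"
    proof (cases "a = a2 + 1")
      case True
      then show ?thesis using col * by simp
    next
      case False
      then show ?thesis using R'[of a b] * by simp
    qed
  qed
qed

lemma closed2_reflect: "closed2 T \<Longrightarrow> closed2 (\<lambda>a b. T (- a) b)"
  unfolding closed2_def
proof (intro allI impI)
  fix a b :: int
  assume T: "\<forall>a b. T (a - 1) b \<and> T (a + 1) b \<or> T a (b - 1) \<and> T a (b + 1) \<or>
      (T (a - 1) b \<or> T (a + 1) b) \<and> (T a (b - 1) \<or> T a (b + 1)) \<longrightarrow> T a b"
  have e: "- (a - 1) = - a + 1" "- (a + 1) = - a - 1" by linarith+
  assume "T (- (a - 1)) b \<and> T (- (a + 1)) b \<or> T (- a) (b - 1) \<and> T (- a) (b + 1) \<or>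
      (T (- (a - 1)) b \<or> T (- (a + 1)) b) \<and> (T (- a) (b - 1) \<or> T (- a) (b + 1))"
  then show "T (- a) b" using T[rule_format, of "- a" b] unfolding e by blast
qed

lemma closed2_swap: "closed2 T \<Longrightarrow> closed2 (\<lambda>a b. T b a)"
  unfolding closed2_def by blast

lemma filled_reflect: "filled (\<lambda>a b. T (- a) b) a1 a2 b1 b2 \<longleftrightarrow> filled T (- a2) (- a1) b1 b2"
  unfolding filled_def
proof (intro iffI allI impI)
  fix a b assume *: "\<forall>a b. a1 \<le> a \<and> a \<le> a2 \<and> b1 \<le> b \<and> b \<le> b2 \<longrightarrow> T (- a) b"
    "- a2 \<le> a \<and> a \<le> - a1 \<and> b1 \<le> b \<and> b \<le> b2"
  from *(1)[rule_format, of "- a" b] *(2) show "T a b" by simp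
next
  fix a b assume *: "\<forall>a b. - a2 \<le> a \<and> a \<le> - a1 \<and> b1 \<le> b \<and> b \<le> b2 \<longrightarrow> T a b"
    "a1 \<le> a \<and> a \<le> a2 \<and> b1 \<le> b \<and> b \<le> b2"
  from *(1)[rule_format, of "- a" b] *(2) show "T (- a) b" by simp
qed

lemma filled_swap: "filled (\<lambda>a b. T b a) a1 a2 b1 b2 \<longleftrightarrow> filled T b1 b2 a1 a2"
  unfolding filled_def by blast

lemma extend_left:
  assumes T: "closed2 T" and R: "filled T a1 a2 b1 b2" "a1 \<le> a2" "b1 \<le> b2"
    and S: "filled T c1 c2 d1 d2" "c1 \<le> c2" "d1 \<le> d2"
    and near: "gap a1 a2 c1 c2 + gap b1 b2 d1 d2 \<le> 2" and "c1 < a1"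
  shows "filled T (a1 - 1) a2 b1 b2"
proof -
  have "filled (\<lambda>a b. T (- a) b) (- a2) (- a1 + 1) b1 b2"
    by (rule extend_right[where ?c1.0 = "- c2" and ?c2.0 = "- c1" and ?d1.0 = d1 and ?d2.0 = d2,
        OF closed2_reflect[OF T]])
      (use R S near \<open>c1 < a1\<close> in \<open>auto simp: filled_reflect gap_def\<close>)
  then show ?thesis by (simp add: filled_reflect)
qed

text \<open>The measure is the total overhang of the second rectangle over the first. Growing the
  first by one row or column towards the second reduces it and, by \<open>gap_mono\<close>, keeps
  the two near.\<close>

lemma join_filled:
  assumes T: "closed2 T" and S: "filled T c1 c2 d1 d2" "c1 \<le> c2" "d1 \<le> d2"
  shows "filled T a1 a2 b1 b2 \<Longrightarrow> a1 \<le> a2 \<Longrightarrow> b1 \<le> b2 \<Longrightarrow>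
    gap a1 a2 c1 c2 + gap b1 b2 d1 d2 \<le> 2 \<Longrightarrow>
    filled T (min a1 c1) (max a2 c2) (min b1 d1) (max b2 d2)"
proof (induction "nat (c2 - a2) + nat (a1 - c1) + nat (d2 - b2) + nat (b1 - d1)"
    arbitrary: a1 a2 b1 b2 rule: less_induct)
  case less
  note R = less.prems
  have swap: "filled (\<lambda>a b. T b a) b1 b2 a1 a2" "filled (\<lambda>a b. T b a) d1 d2 c1 c2"
      "gap b1 b2 d1 d2 + gap a1 a2 c1 c2 \<le> 2"
    using R S by (simp_all add: filled_swap[of T])
  consider "a2 < c2" | "c1 < a1" | "b2 < d2" | "d1 < b1" |
    "c2 \<le> a2" "a1 \<le> c1" "d2 \<le> b2" "b1 \<le> d1" by linarith
  then show ?case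
  proof cases
    case 1
    have "filled T (min a1 c1) (max (a2 + 1) c2) (min b1 d1) (max b2 d2)"
    proof (rule less.hyps)
      show "filled T a1 (a2 + 1) b1 b2" by (rule extend_right[OF T R(1-3) S R(4) 1])
      show "gap a1 (a2 + 1) c1 c2 + gap b1 b2 d1 d2 \<le> 2" using R(4) gap_mono[of a1 a1 a2 "a2 + 1" c1 c2] by linarith
    qed (use 1 R(2,3) in simp_all)
    moreover have "max (a2 + 1) c2 = max a2 c2" using 1 by simp
    ultimately show ?thesis by simp
  next
    case 2
    have "filled T (min (a1 - 1) c1) (max a2 c2) (min b1 d1) (max b2 d2)"
    proof (rule less.hyps)
      show "filled T (a1 - 1) a2 b1 b2" by (rule extend_left[OF T R(1-3) S R(4) 2])
      show "gap (a1 - 1) a2 c1 c2 + gap b1 b2 d1 d2 \<le> 2" using R(4) gap_mono[of "a1 - 1" a1 a2 a2 c1 c2] by linarith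
    qed (use 2 R(2,3) in simp_all)
    moreover have "min (a1 - 1) c1 = min a1 c1" using 2 by simp
    ultimately show ?thesis by simp
  next
    case 3
    have "filled T (min a1 c1) (max a2 c2) (min b1 d1) (max (b2 + 1) d2)"
    proof (rule less.hyps)
      show "filled T a1 a2 b1 (b2 + 1)"
        using extend_right[OF closed2_swap[OF T] swap(1) R(3,2) swap(2) S(3,2) swap(3) 3]
        by (simp add: filled_swap[of T])
      show "gap a1 a2 c1 c2 + gap b1 (b2 + 1) d1 d2 \<le> 2" using R(4) gap_mono[of b1 b1 b2 "b2 + 1" d1 d2] by linarith
    qed (use 3 R(2,3) in simp_all)
    moreover have "max (b2 + 1) d2 = max b2 d2" using 3 by simp
    ultimately show ?thesis by simp
  next
    case 4
    have "filled T (min a1 c1) (max a2 c2) (min (b1 - 1) d1) (max b2 d2)"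
    proof (rule less.hyps)
      show "filled T a1 a2 (b1 - 1) b2"
        using extend_left[OF closed2_swap[OF T] swap(1) R(3,2) swap(2) S(3,2) swap(3) 4]
        by (simp add: filled_swap[of T])
      show "gap a1 a2 c1 c2 + gap (b1 - 1) b2 d1 d2 \<le> 2" using R(4) gap_mono[of "b1 - 1" b1 b2 b2 d1 d2] by linarith
    qed (use 4 R(2,3) in simp_all)
    moreover have "min (b1 - 1) d1 = min b1 d1" using 4 by simp
    ultimately show ?thesis by simp
  next
    case 5
    then have "min a1 c1 = a1" "max a2 c2 = a2" "min b1 d1 = b1" "max b2 d2 = b2" by simp_all
    then show ?thesis using R(1) by (simp only:)
  qed
qed

lemma closed2_spanned: "closed2 (\<lambda>a b. (a, b) \<in> spanned A)"
  unfolding closed2_def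
proof (intro allI impI)
  fix a b
  have "(a - 1, b) \<in> spanned A \<Longrightarrow> (a + 1, b) \<in> spanned A \<Longrightarrow> (a, b) \<in> spanned A"
    "(a, b - 1) \<in> spanned A \<Longrightarrow> (a, b + 1) \<in> spanned A \<Longrightarrow> (a, b) \<in> spanned A"
    "(a - 1, b) \<in> spanned A \<Longrightarrow> (a, b - 1) \<in> spanned A \<Longrightarrow> (a, b) \<in> spanned A"
    "(a - 1, b) \<in> spanned A \<Longrightarrow> (a, b + 1) \<in> spanned A \<Longrightarrow> (a, b) \<in> spanned A"
    "(a + 1, b) \<in> spanned A \<Longrightarrow> (a, b - 1) \<in> spanned A \<Longrightarrow> (a, b) \<in> spanned A"
    "(a + 1, b) \<in> spanned A \<Longrightarrow> (a, b + 1) \<in> spanned A \<Longrightarrow> (a, b) \<in> spanned A"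
    by (erule (1) spanned.step; simp add: neighbors_eq)+
  moreover assume "(a - 1, b) \<in> spanned A \<and> (a + 1, b) \<in> spanned A \<or>
      (a, b - 1) \<in> spanned A \<and> (a, b + 1) \<in> spanned A \<or>
      ((a - 1, b) \<in> spanned A \<or> (a + 1, b) \<in> spanned A) \<and>
      ((a, b - 1) \<in> spanned A \<or> (a, b + 1) \<in> spanned A)"
  ultimately show "(a, b) \<in> spanned A" by blast
qed

section \<open>Rectangles with natural corners and their derivations\<close>

type_synonym rect = "nat \<times> nat \<times> nat \<times> nat"

fun rect_cells :: "rect \<Rightarrow> cell set" where
  "rect_cells (x1, y1, x2, y2) =
     {(a, b). int x1 \<le> a \<and> a \<le> int x2 \<and> int y1 \<le> b \<and> b \<le> int y2}"

fun proper :: "rect \<Rightarrow> bool" where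
  "proper (x1, y1, x2, y2) \<longleftrightarrow> x1 \<le> x2 \<and> y1 \<le> y2"

fun join :: "rect \<Rightarrow> rect \<Rightarrow> rect" where
  "join (x1, y1, x2, y2) (x1', y1', x2', y2') =
     (min x1 x1', min y1 y1', max x2 x2', max y2 y2')"

text \<open>For proper rectangles this says that their Manhattan distance is at most 2, by truncated
  subtraction.\<close>

fun near :: "rect \<Rightarrow> rect \<Rightarrow> bool" where
  "near (x1, y1, x2, y2) (x1', y1', x2', y2') \<longleftrightarrow>
     (x1' - x2) + (x1 - x2') + (y1' - y2) + (y1 - y2') \<le> 2"

lemma join_spanned:
  assumes "near R S" "proper R" "proper S" "rect_cells R \<subseteq> spanned A" "rect_cells S \<subseteq> spanned A"
  shows "rect_cells (join R S) \<subseteq> spanned A"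
proof -
  obtain x1 y1 x2 y2 where R: "R = (x1, y1, x2, y2)" by (cases R)
  obtain u1 v1 u2 v2 where S: "S = (u1, v1, u2, v2)" by (cases S)
  let ?T = "\<lambda>a b. (a, b) \<in> spanned A"
  have "gap (int x1) (int x2) (int u1) (int u2) = int ((u1 - x2) + (x1 - u2))"
    "gap (int y1) (int y2) (int v1) (int v2) = int ((v1 - y2) + (y1 - v2))"
    by (simp_all add: gap_def of_nat_diff_if max_def)
  moreover have "int ((u1 - x2) + (x1 - u2)) + int ((v1 - y2) + (y1 - v2)) \<le> 2"
    using assms(1) unfolding R S near.simps by linarith
  ultimately have gap: "gap (int x1) (int x2) (int u1) (int u2) + gap (int y1) (int y2) (int v1) (int v2) \<le> 2"
    by simp
  have "filled ?T (min (int x1) (int u1)) (max (int x2) (int u2)) (min (int y1) (int v1)) (max (int y2) (int v2))"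
    by (rule join_filled[OF closed2_spanned])
      (use assms gap in \<open>auto simp: R S filled_def\<close>)
  then show ?thesis unfolding R S filled_def by (auto simp: of_nat_min of_nat_max)
qed

text \<open>\<open>L\<close> is the set of leaves of the derivation. Disjointness makes leaf counts
  additive and bounds them by the size of \<open>A\<close>.\<close>

inductive derivable :: "cell set \<Rightarrow> cell set \<Rightarrow> rect \<Rightarrow> bool" for A where
  point: "(int x, int y) \<in> A \<Longrightarrow> derivable A {(int x, int y)} (x, y, x, y)"
| join: "derivable A L R \<Longrightarrow> derivable A K S \<Longrightarrow> L \<inter> K = {} \<Longrightarrow> near R S \<Longrightarrow>
    derivable A (L \<union> K) (join R S)"

lemma derivable_leaves:
  assumes "derivable A L R"
  shows "finite L" "L \<noteq> {}" "L \<subseteq> A"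
  using assms by (induction) auto

lemma rect_cells_join: "rect_cells R \<union> rect_cells S \<subseteq> rect_cells (join R S)"
  by (cases R; cases S) auto

lemma near_sym: "near R S \<longleftrightarrow> near S R"
  by (cases R; cases S) auto

text \<open>Rectangles are closed under the rule, so a cell outside a union of rectangles can only
  be activated by two different ones.\<close>

lemma two_neighbors_in_rect:
  assumes "v \<in> rect_cells R" "w \<in> rect_cells R" "v \<noteq> w" "v \<in> neighbors u" "w \<in> neighbors u"
  shows "u \<in> rect_cells R"
proof -
  obtain x1 y1 x2 y2 where R: "R = (x1, y1, x2, y2)" by (cases R)
  obtain a b where u: "u = (a, b)" by force
  show ?thesis using assms unfolding R u neighbors_eq by auto
qed

text \<open>Two neighbors of one cell are at distance at most 2, and the rectangles containing them
  are no further apart; the threshold of \<open>near\<close> comes from here.\<close>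

lemma two_neighbors_near:
  assumes "v \<in> rect_cells R" "w \<in> rect_cells S" "v \<in> neighbors u" "w \<in> neighbors u"
  shows "near R S"
proof -
  obtain x1 y1 x2 y2 where R: "R = (x1, y1, x2, y2)" by (cases R)
  obtain u1 v1 u2 v2 where S: "S = (u1, v1, u2, v2)" by (cases S)
  obtain a b where u: "u = (a, b)" by force
  obtain v1' v2' w1' w2' where vw: "v = (v1', v2')" "w = (w1', w2')" by force
  have "\<bar>v1' - w1'\<bar> + \<bar>v2' - w2'\<bar> \<le> 2"
    using assms(3,4) unfolding u vw neighbors_eq by auto
  moreover have "int x1 \<le> v1'" "v1' \<le> int x2" "int y1 \<le> v2'" "v2' \<le> int y2"
    "int u1 \<le> w1'" "w1' \<le> int u2" "int v1 \<le> w2'" "w2' \<le> int v2"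
    using assms(1,2) unfolding R S vw by auto
  moreover from this have "int ((u1 - x2) + (x1 - u2)) \<le> \<bar>v1' - w1'\<bar>"
    "int ((v1 - y2) + (y1 - v2)) \<le> \<bar>v2' - w2'\<bar>"
    by linarith+
  ultimately have "(u1 - x2) + (x1 - u2) + ((v1 - y2) + (y1 - v2)) \<le> 2" by linarith
  then show ?thesis unfolding R S near.simps by linarith
qed

text \<open>As long as two rectangles of a family of derivable rectangles with disjoint leaf sets are near,
  they can be joined; so a family of least size that covers \<open>A\<close> covers all of \<open>spanned A\<close>.\<close>

lemma spanned_derivable:
  assumes "finite A" "\<And>a b. (a, b) \<in> A \<Longrightarrow> 0 \<le> a \<and> 0 \<le> b" "u \<in> spanned A"
  shows "\<exists>L R. derivable A L R \<and> u \<in> rect_cells R"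
proof -
  define good where "good F \<longleftrightarrow> finite F \<and> (\<forall>(L, R)\<in>F. derivable A L R) \<and>
    (\<forall>p\<in>F. \<forall>q\<in>F. p \<noteq> q \<longrightarrow> fst p \<inter> fst q = {}) \<and> A \<subseteq> (\<Union>p\<in>F. rect_cells (snd p))"
    for F :: "(cell set \<times> rect) set"
  let ?pt = "\<lambda>a :: cell. ({a}, (nat (fst a), nat (snd a), nat (fst a), nat (snd a)))"
  have "good (?pt ` A)"
    unfolding good_def
  proof (intro conjI ballI impI subsetI)
    fix p assume "p \<in> ?pt ` A"
    then obtain a b where ab: "(a, b) \<in> A" "p = ?pt (a, b)" by force
    then have "derivable A {(int (nat a), int (nat b))} (nat a, nat b, nat a, nat b)"
      by (intro derivable.point) (use assms(2)[of a b] in simp)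
    then show "case p of (L, R) \<Rightarrow> derivable A L R" using ab assms(2)[of a b] by simp
  next
    fix a assume "a \<in> A"
    then have "a \<in> rect_cells (snd (?pt a))" using assms(2)[of "fst a" "snd a"] by (cases a) simp
    then show "a \<in> (\<Union>p\<in>?pt ` A. rect_cells (snd p))" using \<open>a \<in> A\<close> by blast
  qed (use assms(1) in auto)
  then obtain F where F: "good F" and least: "\<And>F'. good F' \<Longrightarrow> card F \<le> card F'"
    using ex_has_least_nat[of good _ card] by blast
  have far: "\<not> near (snd p) (snd q)" if pq: "p \<in> F" "q \<in> F" "p \<noteq> q" for p q
  proof
    assume near: "near (snd p) (snd q)"
    let ?r = "(fst p \<union> fst q, join (snd p) (snd q))"
    let ?F = "insert ?r (F - {p, q})"
    have d: "derivable A (fst p) (snd p)" "derivable A (fst q) (snd q)"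
      using F pq unfolding good_def by auto
    have disj: "fst p' \<inter> fst q' = {}" if "p' \<in> F" "q' \<in> F" "p' \<noteq> q'" for p' q'
      using F that unfolding good_def by blast
    have r: "derivable A (fst ?r) (snd ?r)"
      using derivable.join[OF d disj[OF pq] near] by simp
    have "good ?F"
      unfolding good_def
    proof (intro conjI ballI impI)
      show "finite ?F" using F by (simp add: good_def)
      fix p' assume p': "p' \<in> ?F"
      show "case p' of (L, R) \<Rightarrow> derivable A L R"
        using p' r F unfolding good_def by auto
      fix q' assume "q' \<in> ?F" "p' \<noteq> q'"
      then consider "p' = ?r" "q' \<in> F - {p, q}" | "q' = ?r" "p' \<in> F - {p, q}" | "p' \<in> F" "q' \<in> F"
        using p' by auto
      then show "fst p' \<inter> fst q' = {}"
      proof cases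
        case 1
        then show ?thesis using disj[of p q'] disj[of q q'] pq by auto
      next
        case 2
        then show ?thesis using disj[of p p'] disj[of q p'] pq by auto
      qed (use disj \<open>p' \<noteq> q'\<close> in blast)
    next
      have "A \<subseteq> (\<Union>p\<in>F. rect_cells (snd p))" using F by (simp add: good_def)
      also have "\<dots> \<subseteq> (\<Union>p\<in>?F. rect_cells (snd p))"
      proof
        fix a assume "a \<in> (\<Union>p\<in>F. rect_cells (snd p))"
        then obtain p' where p': "p' \<in> F" "a \<in> rect_cells (snd p')" by blast
        have "rect_cells (snd p) \<union> rect_cells (snd q) \<subseteq> rect_cells (snd ?r)"
          using rect_cells_join[of "snd p" "snd q"] by simp
        then show "a \<in> (\<Union>p\<in>?F. rect_cells (snd p))"
          using p' by (cases "p' = p \<or> p' = q") blast+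
      qed
      finally show "A \<subseteq> (\<Union>p\<in>?F. rect_cells (snd p))" .
    qed
    \<comment> \<open>Replacing \<open>p\<close> and \<open>q\<close> by one pair makes the family
      smaller, against the choice of \<open>F\<close>. The truncated \<open>card F - 2\<close> only
      yields \<open>card F < 2\<close>, which two distinct members refute.\<close>
    then have "card F \<le> card ?F" by (rule least)
    also have "\<dots> \<le> Suc (card (F - {p, q}))" by (rule card_insert_le_m1) auto
    also have "card (F - {p, q}) = card F - 2"
      using card_Diff_subset[of "{p, q}" F] pq by simp
    finally have "card F < 2" by linarith
    moreover have "card {p, q} \<le> card F"
      using F pq by (intro card_mono) (auto simp: good_def)
    ultimately show False using pq(3) by simp
  qed
  \<comment> \<open>No two members are near any more, so the two active neighbors of a newly
    activated cell lie in the same rectangle.\<close>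
  have "u \<in> (\<Union>p\<in>F. rect_cells (snd p))"
    using assms(3)
  proof induction
    case (init a)
    then show ?case using F by (auto simp: good_def)
  next
    case (step v w u)
    then obtain p q where pq: "p \<in> F" "v \<in> rect_cells (snd p)" "q \<in> F" "w \<in> rect_cells (snd q)"
      by blast
    show ?case
    proof (cases "p = q")
      case True
      then have "u \<in> rect_cells (snd p)"
        using two_neighbors_in_rect[of v "snd p" w u] pq step.hyps by blast
      then show ?thesis using pq(1) by blast
    next
      case False
      have "near (snd p) (snd q)"
        by (rule two_neighbors_near[of v _ w _ u]) (use pq step.hyps in blast)+
      then show ?thesis using far[OF pq(1,3) False] by blast
    qed
  qed
  then obtain p where "p \<in> F" "u \<in> rect_cells (snd p)" by blast
  moreover from this F have "derivable A (fst p) (snd p)" unfolding good_def by auto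
  ultimately show ?thesis by blast
qed

section \<open>The table of conditional fillings\<close>

text \<open>A pair \<open>(R, S)\<close> in the table says that \<open>S\<close> gets filled as soon as \<open>R\<close> is; the empty
  rectangle \<open>bottom M\<close> in place of \<open>R\<close> says that \<open>S\<close> gets filled anyway.\<close>

definition box :: "nat \<Rightarrow> rect set" where
  "box M = {..<M} \<times> {..<M} \<times> {..<M} \<times> {..<M}"

text \<open>The corners are crossed as far as the box allows, so that the rectangle has no cells for
  \<open>1 < M\<close> and is neutral for \<open>join\<close> on \<open>box M\<close>. Unconditional
  entries thus need no rules of their own.\<close>

definition bottom :: "nat \<Rightarrow> rect" where
  "bottom M = (M - 1, M - 1, 0, 0)"

definition points :: "nat \<Rightarrow> cell set \<Rightarrow> (rect \<times> rect) set" where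
  "points M A = {(bottom M, (x, y, x, y)) | x y. (int x, int y) \<in> A}"

definition compose_round :: "(rect \<times> rect) set \<Rightarrow> (rect \<times> rect) set" where
  "compose_round G = G \<union> G O G"

text \<open>\<open>R\<close> ranges over the whole box, filled or not: the new entry is conditional
  on \<open>R\<close>, and only \<open>S\<close> has to be known already.\<close>

definition join_round :: "nat \<Rightarrow> (rect \<times> rect) set \<Rightarrow> (rect \<times> rect) set" where
  "join_round M G = G \<union>
     {(R, join R S) | R S. R \<in> box M \<and> S \<in> box M \<and> near R S \<and> (bottom M, S) \<in> G}"

definition table_round :: "nat \<Rightarrow> (rect \<times> rect) set \<Rightarrow> (rect \<times> rect) set" where
  "table_round M G = join_round M (compose_round G)"

lemma bottom_in_box: "0 < M \<Longrightarrow> bottom M \<in> box M"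
  by (simp add: bottom_def box_def)

lemma join_in_box: "R \<in> box M \<Longrightarrow> S \<in> box M \<Longrightarrow> join R S \<in> box M"
  by (cases R; cases S) (auto simp: box_def)

lemma table_round_mono:
  shows "G \<subseteq> table_round M G" and "G \<subseteq> H \<Longrightarrow> table_round M G \<subseteq> table_round M H"
  unfolding table_round_def join_round_def compose_round_def by blast+

lemma table_round_trans: "(R, T) \<in> G \<Longrightarrow> (T, S) \<in> G \<Longrightarrow> (R, S) \<in> table_round M G"
  unfolding table_round_def join_round_def compose_round_def by blast

lemma table_round_join:
  "R \<in> box M \<Longrightarrow> S \<in> box M \<Longrightarrow> near R S \<Longrightarrow> (bottom M, S) \<in> G \<Longrightarrow>
    (R, join R S) \<in> table_round M G"
  unfolding table_round_def join_round_def compose_round_def by blast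

lemma table_rounds_mono:
  assumes "k \<le> l"
  shows "(table_round M ^^ k) G \<subseteq> (table_round M ^^ l) G"
  using assms
proof (induction l rule: dec_induct)
  case (step l)
  then show ?case using table_round_mono(1)[of "(table_round M ^^ l) G" M] by auto
qed simp

text \<open>Improper \<open>R\<close> other than \<open>bottom M\<close> also get entries, and
  \<open>near\<close> carries no meaning for them, so they are exempt. They do no harm, since
  entries that start from \<open>bottom M\<close> or a proper rectangle lead to proper ones.\<close>

definition sound :: "nat \<Rightarrow> cell set \<Rightarrow> (rect \<times> rect) set \<Rightarrow> bool" where
  "sound M A G \<longleftrightarrow> (\<forall>(R, S)\<in>G. R \<in> box M \<and> S \<in> box M \<and> (R = bottom M \<or> proper R \<longrightarrow>
     proper S \<and> rect_cells S \<subseteq> spanned (A \<union> rect_cells R)))"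

lemma sound_round:
  assumes "sound M A G" "1 < M"
  shows "sound M A (table_round M G)"
proof -
  have comp: "sound M A (compose_round G)"
    unfolding sound_def
  proof (clarify, intro conjI impI)
    fix R S
    assume "(R, S) \<in> compose_round G"
    then consider "(R, S) \<in> G" | T where "(R, T) \<in> G" "(T, S) \<in> G"
      unfolding compose_round_def by blast
    note cases = this
    have "R \<in> box M \<and> S \<in> box M"
      using cases
    proof cases
      case 1
      then show ?thesis using assms(1) unfolding sound_def by blast
    next
      case 2
      then show ?thesis using assms(1) unfolding sound_def by blast
    qed
    then show "R \<in> box M" "S \<in> box M" by blast+
    assume R: "R = bottom M \<or> proper R"
    have "proper S \<and> rect_cells S \<subseteq> spanned (A \<union> rect_cells R)"
      using cases
    proof cases
      case 1
      then show ?thesis using assms(1) R unfolding sound_def by blast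
    next
      case 2
      then have T: "proper T" "rect_cells T \<subseteq> spanned (A \<union> rect_cells R)"
        using assms(1) R unfolding sound_def by blast+
      then have S: "proper S" "rect_cells S \<subseteq> spanned (A \<union> rect_cells T)"
        using assms(1) 2 unfolding sound_def by blast+
      have "A \<union> rect_cells T \<subseteq> spanned (A \<union> rect_cells R)" using T(2) by (auto intro: spanned.init)
      then show ?thesis using S spanned_least by blast
    qed
    then show "proper S" "rect_cells S \<subseteq> spanned (A \<union> rect_cells R)" by blast+
  qed
  show ?thesis
    unfolding sound_def
  proof (clarify, intro conjI impI)
    let ?G = "compose_round G"
    fix R Q
    assume "(R, Q) \<in> table_round M G"
    then consider "(R, Q) \<in> ?G" |
      S where "R \<in> box M" "S \<in> box M" "near R S" "(bottom M, S) \<in> ?G" "Q = join R S"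
      unfolding table_round_def join_round_def by blast
    note cases = this
    have "R \<in> box M \<and> Q \<in> box M"
      using cases
    proof cases
      case 1
      then show ?thesis using comp unfolding sound_def by blast
    next
      case 2
      then show ?thesis using join_in_box by blast
    qed
    then show "R \<in> box M" "Q \<in> box M" by blast+
    assume R: "R = bottom M \<or> proper R"
    have "proper Q \<and> rect_cells Q \<subseteq> spanned (A \<union> rect_cells R)"
      using cases
    proof cases
      case 1
      then show ?thesis using comp R unfolding sound_def by blast
    next
      case 2
      have bot: "rect_cells (bottom M) = {}" using assms(2) by (auto simp: bottom_def)
      have "proper S \<and> rect_cells S \<subseteq> spanned (A \<union> rect_cells (bottom M))"
        using comp 2(4) unfolding sound_def by blast
      then have S: "proper S" "rect_cells S \<subseteq> spanned A" unfolding bot by simp_all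
      have S': "rect_cells S \<subseteq> spanned (A \<union> rect_cells R)"
        using S(2) spanned_mono[of A "A \<union> rect_cells R"] by blast
      show ?thesis
      proof (cases "R = bottom M")
        case True
        \<comment> \<open>Neutrality of \<open>bottom M\<close>: should it count as near
          \<open>S\<close>, the join is \<open>S\<close> itself.\<close>
        then have "Q = S" using 2(2,5) by (cases S) (auto simp: bottom_def box_def)
        then show ?thesis using S S' by simp
      next
        case False
        then have "proper R" using R by simp
        moreover have "rect_cells R \<subseteq> spanned (A \<union> rect_cells R)" by (auto intro: spanned.init)
        ultimately have "rect_cells Q \<subseteq> spanned (A \<union> rect_cells R)"
          using join_spanned[OF 2(3) _ S(1)] S' 2(5) by blast
        moreover have "proper Q" using \<open>proper R\<close> S(1) 2(5) by (cases R; cases S) auto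
        ultimately show ?thesis by blast
      qed
    qed
    then show "proper Q" "rect_cells Q \<subseteq> spanned (A \<union> rect_cells R)" by blast+
  qed
qed

lemma sound_rounds:
  assumes "A \<subseteq> {0..<int M} \<times> {0..<int M}" "1 < M"
  shows "sound M A ((table_round M ^^ k) (points M A))"
proof (induction k)
  case 0
  have "(x, y, x, y) \<in> box M" if "(int x, int y) \<in> A" for x y
    using assms(1) that by (auto simp: box_def)
  moreover have "rect_cells (x, y, x, y) \<subseteq> spanned B" if "(int x, int y) \<in> A" "A \<subseteq> B" for x y B
    using that by (auto intro!: spanned.init)
  ultimately show ?case using bottom_in_box[of M] assms(2)
    by (auto simp: sound_def points_def simp del: rect_cells.simps)
next
  case (Suc k)
  then show ?case using sound_round assms(2) by simp
qed

lemma derivable_in_box: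
  assumes "derivable A L R" "A \<subseteq> {0..<int M} \<times> {0..<int M}"
  shows "R \<in> box M"
  using assms
proof induction
  case (point x y)
  then show ?case by (auto simp: box_def)
qed (use join_in_box in blast)

text \<open>Repeated squaring: a round composes two paths, so the length that is covered doubles. A
  path that is too long is cut after exactly \<open>2 ^ j\<close> steps.\<close>

lemma path_in_round:
  assumes "E \<subseteq> G" "(R, S) \<in> E ^^ l" "0 < l" "l \<le> 2 ^ j"
  shows "(R, S) \<in> (table_round M ^^ j) G"
  using assms(2-4)
proof (induction j arbitrary: l R S)
  case 0
  then have "l = 1" by simp
  then show ?case using 0 assms(1) by auto
next
  case (Suc j)
  show ?case
  proof (cases "l \<le> 2 ^ j")
    case True
    then have "(R, S) \<in> (table_round M ^^ j) G" using Suc by blast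
    then show ?thesis using table_round_mono(1) by fastforce
  next
    case False
    define l' where "l' = l - 2 ^ j"
    have l: "l = 2 ^ j + l'" "0 < l'" "l' \<le> 2 ^ j" using False Suc.prems(3) by (auto simp: l'_def)
    from Suc.prems(1) l(1) obtain T where "(R, T) \<in> E ^^ (2 ^ j)" "(T, S) \<in> E ^^ l'"
      by (auto simp: relpow_add)
    then have "(R, T) \<in> (table_round M ^^ j) G" "(T, S) \<in> (table_round M ^^ j) G"
      using Suc.IH[of R T "2 ^ j"] Suc.IH[of T S l'] l by auto
    then have "(R, S) \<in> table_round M ((table_round M ^^ j) G)" by (rule table_round_trans)
    then show ?thesis by simp
  qed
qed

text \<open>The heavy path argument: following the child with more leaves, a derivation with at most
  \<open>2 ^ Suc k\<close> leaves is a path that starts at a derivation with at most \<open>2 ^ k\<close> leaves and whose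
  steps join rectangles with at most \<open>2 ^ k\<close> leaves.\<close>

lemma heavy_path:
  assumes "derivable A L R" "card L \<le> 2 ^ Suc k"
    and E: "\<And>R S K. derivable A K S \<Longrightarrow> card K \<le> 2 ^ k \<Longrightarrow> near R S \<Longrightarrow> R \<in> box M \<Longrightarrow>
      (R, join R S) \<in> E"
    and A: "A \<subseteq> {0..<int M} \<times> {0..<int M}"
  shows "\<exists>L0 R0 l. derivable A L0 R0 \<and> card L0 \<le> 2 ^ k \<and> l < card L \<and> (R0, R) \<in> E ^^ l"
  using assms(1,2)
proof induction
  case (point x y)
  then show ?case
    by (intro exI[of _ "{(int x, int y)}"] exI[of _ "(x, y, x, y)"] exI[of _ 0])
      (auto intro: derivable.point)
next
  case (join L R K S)
  have fin: "finite L" "finite K" and ne: "card L > 0" "card K > 0"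
    using derivable_leaves[OF join.hyps(1)] derivable_leaves[OF join.hyps(2)]
    by (auto simp: card_gt_0_iff)
  have sum: "card (L \<union> K) = card L + card K" using fin join.hyps(3) by (simp add: card_Un_disjoint)
  \<comment> \<open>Stated for an arbitrary heavy child, because \<open>derivable.join\<close> does
    not say which side has more leaves.\<close>
  have joinE: "\<exists>L0 R0 l. derivable A L0 R0 \<and> card L0 \<le> 2 ^ k \<and> l < card (L \<union> K) \<and>
      (R0, join R' S') \<in> E ^^ l"
    if IH: "card L' \<le> 2 ^ Suc k \<Longrightarrow> \<exists>L0 R0 l. derivable A L0 R0 \<and> card L0 \<le> 2 ^ k \<and> l < card L' \<and> (R0, R') \<in> E ^^ l"
      and "card L' + card K' = card (L \<union> K)" "card K' \<le> card L'" "0 < card K'"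
      "derivable A L' R'" "derivable A K' S'" "near R' S'"
    for L' R' K' S'
  proof -
    \<comment> \<open>The lighter child has at most half of the at most \<open>2 ^ Suc k\<close>
      leaves. Its join is one edge, and its at least one leaf pays for that edge in the bound on
      \<open>l\<close>.\<close>
    have "card K' \<le> 2 ^ k" "card L' \<le> 2 ^ Suc k" using that(2,3) join.prems by auto
    then obtain L0 R0 l where 0: "derivable A L0 R0" "card L0 \<le> 2 ^ k" "l < card L'" "(R0, R') \<in> E ^^ l"
      using IH by blast
    have "(R', join R' S') \<in> E"
      by (rule E[OF that(6) \<open>card K' \<le> 2 ^ k\<close> that(7) derivable_in_box[OF that(5) A]])
    with 0(4) have "(R0, join R' S') \<in> E ^^ Suc l" by auto
    moreover have "Suc l < card (L \<union> K)" using 0(3) that(2,4) by linarith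
    ultimately show ?thesis using 0(1,2) by blast
  qed
  have comm: "join S R = join R S" by (cases R; cases S) (simp add: min.commute max.commute)
  show ?case
  proof (cases "card K \<le> card L")
    case True
    show ?thesis by (rule joinE[of L R K S]) (use join True sum ne in auto)
  next
    case False
    have "near S R" using join.hyps(4) near_sym by blast
    have "\<exists>L0 R0 l. derivable A L0 R0 \<and> card L0 \<le> 2 ^ k \<and> l < card (L \<union> K) \<and>
      (R0, join S R) \<in> E ^^ l"
      by (rule joinE[of K S L R]) (use join False sum ne \<open>near S R\<close> in auto)
    then show ?thesis unfolding comm .
  qed
qed

text \<open>Doubling the leaf bound costs \<open>j + 2\<close> rounds: one turns joins with known
  rectangles into edges, \<open>j\<close> compose these edges along the heavy path, and one prepends
  the entry \<open>(bottom M, R0)\<close> for the start of the path.\<close>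

lemma derivable_in_rounds:
  assumes A: "A \<subseteq> {0..<int M} \<times> {0..<int M}" and "k \<le> j"
    and "derivable A L R" "card L \<le> 2 ^ k"
  shows "(bottom M, R) \<in> (table_round M ^^ (k * (j + 2))) (points M A)"
  using assms(2-4)
proof (induction k arbitrary: L R)
  case 0
  then have "card L \<le> 1" by simp
  from 0(2) have "(bottom M, R) \<in> points M A"
  proof cases
    case (point x y)
    then show ?thesis by (auto simp: points_def)
  next
    case (join L' R' K S)
    have "card L = card L' + card K"
      using derivable_leaves(1)[OF join(3)] derivable_leaves(1)[OF join(4)] join
      by (simp add: card_Un_disjoint)
    moreover have "card L' > 0" "card K > 0"
      using derivable_leaves[OF join(3)] derivable_leaves[OF join(4)] by (auto simp: card_gt_0_iff)
    ultimately show ?thesis using \<open>card L \<le> 1\<close> by linarith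
  qed
  then show ?case by simp
next
  case (Suc k)
  let ?G = "\<lambda>i. (table_round M ^^ i) (points M A)"
  let ?n = "k * (j + 2)"
  define E where "E = {(R, join R S) | R S. \<exists>K. derivable A K S \<and> card K \<le> 2 ^ k \<and> near R S \<and> R \<in> box M}"
  have "E \<subseteq> ?G (Suc ?n)"
  proof
    fix e assume "e \<in> E"
    then obtain R S K where e: "e = (R, join R S)" "derivable A K S" "card K \<le> 2 ^ k" "near R S" "R \<in> box M"
      unfolding E_def by blast
    have "(bottom M, S) \<in> ?G ?n" using Suc.IH[OF _ e(2,3)] Suc.prems(1) by simp
    moreover have "S \<in> box M" using derivable_in_box[OF e(2) A] .
    ultimately show "e \<in> ?G (Suc ?n)"
      using e table_round_join by simp
  qed
  moreover obtain L0 R0 l where l: "derivable A L0 R0" "card L0 \<le> 2 ^ k" "l < card L" "(R0, R) \<in> E ^^ l"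
    using heavy_path[OF Suc.prems(2,3) _ A, of E] unfolding E_def by blast
  moreover have "card L \<le> 2 ^ j"
    using Suc.prems(1,3) power_increasing[of "Suc k" j "2 :: nat"] by simp
  ultimately have "(R0, R) \<in> (table_round M ^^ j) (?G (Suc ?n))" if "0 < l"
    using that by (intro path_in_round[of E _ _ _ l]) auto
  then have path: "(R0, R) \<in> ?G (j + Suc ?n)" if "0 < l"
    using that by (simp only: funpow_add o_apply)
  have start: "(bottom M, R0) \<in> ?G (j + Suc ?n)"
    using Suc.IH[OF _ l(1,2)] Suc.prems(1) table_rounds_mono[of ?n "j + Suc ?n"] by auto
  have "(bottom M, R) \<in> ?G (Suc (j + Suc ?n))"
  proof (cases "l = 0")
    case True
    then have "R = R0" using l(4) by simp
    then show ?thesis using start table_round_mono(1) by auto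
  next
    case False
    then show ?thesis using table_round_trans[OF start path] by simp
  qed
  moreover have "Suc (j + Suc ?n) = Suc k * (j + 2)" by simp
  ultimately show ?case by (simp only:)
qed

text \<open>\<open>A\<close> has at most \<open>M * M = 2 ^ (2 * m)\<close> cells, so
  \<open>2 * m\<close> doublings of \<open>2 * m + 2\<close> rounds each are enough. The number is
  rounded up to \<open>4 * m\<close> times \<open>4 * m\<close>, two nested loops with one common
  bound.\<close>

lemma spanned_iff_rounds:
  assumes A: "A \<subseteq> {0..<int M} \<times> {0..<int M}" and M: "M = 2 ^ m" "0 < m"
  shows "u \<in> spanned A \<longleftrightarrow>
    (\<exists>R. (bottom M, R) \<in> (table_round M ^^ (4 * m * (4 * m))) (points M A) \<and> u \<in> rect_cells R)"
proof
  assume "u \<in> spanned A"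
  moreover have fin: "finite A" using A finite_subset by blast
  ultimately obtain L R where LR: "derivable A L R" "u \<in> rect_cells R"
    using spanned_derivable[of A u] A by force
  have "card L \<le> card ({0..<int M} \<times> {0..<int M})"
    using derivable_leaves(3)[OF LR(1)] A by (intro card_mono) auto
  also have "\<dots> = 2 ^ (2 * m)" by (simp add: card_cartesian_product M power_add mult_2 nat_power_eq)
  finally have "(bottom M, R) \<in> (table_round M ^^ (2 * m * (2 * m + 2))) (points M A)"
    using derivable_in_rounds[OF A order_refl LR(1)] by blast
  moreover have "2 * m * (2 * m + 2) \<le> 4 * m * (4 * m)"
    using M(2) by (intro mult_le_mono) auto
  ultimately show "\<exists>R. (bottom M, R) \<in> (table_round M ^^ (4 * m * (4 * m))) (points M A) \<and> u \<in> rect_cells R"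
    using table_rounds_mono LR(2) by blast
next
  assume "\<exists>R. (bottom M, R) \<in> (table_round M ^^ (4 * m * (4 * m))) (points M A) \<and> u \<in> rect_cells R"
  then obtain R where R: "(bottom M, R) \<in> (table_round M ^^ (4 * m * (4 * m))) (points M A)" "u \<in> rect_cells R"
    by blast
  have "1 < M" using M one_less_power[of "2 :: nat" m] by simp
  then have "rect_cells R \<subseteq> spanned (A \<union> rect_cells (bottom M))"
    using sound_rounds[OF A] R(1) unfolding sound_def by blast
  moreover have "rect_cells (bottom M) = {}" using \<open>1 < M\<close> by (auto simp: bottom_def)
  ultimately show "u \<in> spanned A" using R(2) by auto
qed

section \<open>Parsing the input\<close>

text \<open>The successor gives the position after the separator and leaves 0 for a failed search,
  which fits a memory cell that is 0 until some processor writes to it.\<close>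

definition first_zero :: "bool list \<Rightarrow> nat \<Rightarrow> nat" where
  "first_zero w s = (if \<exists>p<length w. s \<le> p \<and> \<not> w ! p
     then Suc (LEAST p. p < length w \<and> s \<le> p \<and> \<not> w ! p) else 0)"

lemma first_zero_append:
  assumes "drop s w = replicate k True @ False # v" "s \<le> length w"
  shows "first_zero w s = s + k + 1"
proof -
  have len: "length w = s + k + 1 + length v" using arg_cong[OF assms(1), of length] assms(2) by simp
  have nth: "w ! (s + l) = (replicate k True @ False # v) ! l" for l
    using assms by (metis nth_drop)
  have "(LEAST p. p < length w \<and> s \<le> p \<and> \<not> w ! p) = s + k"
  proof (rule Least_equality)
    show "s + k < length w \<and> s \<le> s + k \<and> \<not> w ! (s + k)" using len nth[of k] by (simp add: nth_append)
    fix p assume p: "p < length w \<and> s \<le> p \<and> \<not> w ! p"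
    show "s + k \<le> p"
    proof (rule ccontr)
      assume "\<not> s + k \<le> p"
      then have "p - s < k" "s + (p - s) = p" using p by linarith+
      then have "w ! p" using nth[of "p - s"] by (simp add: nth_append)
      then show False using p by simp
    qed
  qed
  moreover have "\<exists>p<length w. s \<le> p \<and> \<not> w ! p"
    using len nth[of k] by (intro exI[of _ "s + k"]) (simp add: nth_append)
  ultimately show ?thesis by (simp add: first_zero_def)
qed

lemma drop_first_zero:
  assumes "0 < first_zero w s"
  shows "s < first_zero w s" "first_zero w s \<le> length w"
    and "drop s w = replicate (first_zero w s - s - 1) True @ False # drop (first_zero w s) w"
proof -
  define q where "q = (LEAST p. p < length w \<and> s \<le> p \<and> \<not> w ! p)"
  have ex: "\<exists>p. p < length w \<and> s \<le> p \<and> \<not> w ! p" and f: "first_zero w s = Suc q"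
    using assms by (auto simp: first_zero_def q_def split: if_splits)
  have q: "q < length w \<and> s \<le> q \<and> \<not> w ! q" unfolding q_def by (rule LeastI_ex[OF ex])
  have least: "w ! p" if "s \<le> p" "p < q" for p
    using not_less_Least[of p "\<lambda>p. p < length w \<and> s \<le> p \<and> \<not> w ! p"] that q by (simp add: q_def)
  show "s < first_zero w s" "first_zero w s \<le> length w" using f q by simp_all
  show "drop s w = replicate (first_zero w s - s - 1) True @ False # drop (first_zero w s) w"
  proof (rule nth_equalityI)
    show "length (drop s w) = length (replicate (first_zero w s - s - 1) True @ False # drop (first_zero w s) w)"
      using f q Suc_diff_Suc[of s "length w"] by simp
    fix l assume "l < length (drop s w)"
    then have l: "s + l < length w" by simp
    consider "s + l < q" | "s + l = q" | "q < s + l" by linarith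
    then show "drop s w ! l = (replicate (first_zero w s - s - 1) True @ False # drop (first_zero w s) w) ! l"
    proof cases
      case 1
      then have "l < q - s" by linarith
      with 1 show ?thesis using f q l least[of "s + l"] by (simp add: nth_append)
    next
      case 2
      then show ?thesis using f q l by (auto simp: nth_append)
    next
      case 3
      obtain k where k: "q = s + k" using q le_Suc_ex by blast
      define d where "d = l - k - 1"
      have l': "l = k + Suc d" using 3 by (simp add: d_def k)
      have "first_zero w s - s - 1 = k" using f by (simp add: k)
      then show ?thesis using f l by (simp add: l' nth_append k add.assoc)
    qed
  qed
qed

lemma rows_length_nth:
  shows "length (concat (map (\<lambda>i. map (f i) [0..<n]) [0..<m])) = m * n"
    and "a < m \<Longrightarrow> b < n \<Longrightarrow> concat (map (\<lambda>i. map (f i) [0..<n]) [0..<m]) ! (a * n + b) = f a b"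
proof -
  show len: "length (concat (map (\<lambda>i. map (f i) [0..<n]) [0..<m])) = m * n" for m
    by (induction m) auto
  show "a < m \<Longrightarrow> b < n \<Longrightarrow> concat (map (\<lambda>i. map (f i) [0..<n]) [0..<m]) ! (a * n + b) = f a b"
  proof (induction m)
    case (Suc m)
    let ?c = "concat (map (\<lambda>i. map (f i) [0..<n]) [0..<m])"
    have split: "concat (map (\<lambda>i. map (f i) [0..<n]) [0..<Suc m]) = ?c @ map (f m) [0..<n]" by simp
    show ?case
    proof (cases "a < m")
      case True
      then have "Suc a * n \<le> m * n" by (intro mult_le_mono1) simp
      then have "a * n + b < m * n" using Suc.prems(2) by simp
      then have "a * n + b < length ?c" unfolding len .
      then show ?thesis unfolding split nth_append using Suc True by simp
    next
      case False
      then have "a = m" using Suc.prems by simp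
      then show ?thesis unfolding split nth_append len using Suc.prems(2) by simp
    qed
  qed simp
qed

definition word_n :: "bool list \<Rightarrow> nat" where
  "word_n w = first_zero w 0 - 1"

definition word_i :: "bool list \<Rightarrow> nat" where
  "word_i w = first_zero w (first_zero w 0) - first_zero w 0 - 1"

definition word_start :: "bool list \<Rightarrow> nat" where
  "word_start w = first_zero w (first_zero w (first_zero w 0))"

definition word_j :: "bool list \<Rightarrow> nat" where
  "word_j w = word_start w - first_zero w (first_zero w 0) - 1"

definition word_x :: "bool list \<Rightarrow> nat \<times> nat \<Rightarrow> bool" where
  "word_x w = (\<lambda>(a, b). w ! (word_start w + (a * word_n w + b)))"

text \<open>A failed search returns 0 and makes the next one start from the beginning of the word;
  the strict inequalities between the positions exclude this.\<close>

definition valid_word :: "bool list \<Rightarrow> bool" where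
  "valid_word w \<longleftrightarrow> word_i w < word_n w \<and> word_j w < word_n w \<and>
     first_zero w 0 < first_zero w (first_zero w 0) \<and>
     first_zero w (first_zero w 0) < word_start w \<and>
     length w = word_start w + word_n w * word_n w \<and>
     \<not> w ! (word_start w + (word_i w * word_n w + word_j w))"

lemma index_bound: "a < n \<Longrightarrow> b < n \<Longrightarrow> a * n + b < n * (n :: nat)"
  using mult_le_mono1[of "Suc a" n n] by simp

lemma valid_word_encode:
  assumes "valid_word w"
  shows "w = encode (word_n w) (word_x w) (word_i w, word_j w)"
proof -
  let ?f1 = "first_zero w 0" and ?f2 = "first_zero w (first_zero w 0)" and ?n = "word_n w"
  have pos: "0 < ?f1" "0 < ?f2" "0 < word_start w"
    using assms by (auto simp: valid_word_def word_n_def)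
  have 1: "w = replicate ?n True @ False # drop ?f1 w"
    using drop_first_zero(3)[OF pos(1)] by (simp add: word_n_def)
  have 2: "drop ?f1 w = replicate (word_i w) True @ False # drop ?f2 w"
    using drop_first_zero(3)[OF pos(2)] by (simp add: word_i_def)
  have 3: "drop ?f2 w = replicate (word_j w) True @ False # drop (word_start w) w"
    using drop_first_zero(3)[of w ?f2] pos(3) by (simp add: word_j_def word_start_def)
  let ?rows = "concat (map (\<lambda>a. map (\<lambda>b. word_x w (a, b)) [0..<?n]) [0..<?n])"
  have 4: "drop (word_start w) w = ?rows"
  proof (rule nth_equalityI)
    show len: "length (drop (word_start w) w) = length ?rows"
      unfolding rows_length_nth(1) using assms by (simp add: valid_word_def)
    fix l assume "l < length (drop (word_start w) w)"
    then have l: "l < ?n * ?n" unfolding len rows_length_nth(1) .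
    then have n: "0 < ?n" by (cases "?n") auto
    have "l div ?n < ?n" using l by (simp add: less_mult_imp_div_less)
    then have "?rows ! (l div ?n * ?n + l mod ?n) = word_x w (l div ?n, l mod ?n)"
      using n by (intro rows_length_nth(2)) auto
    moreover have "word_start w \<le> length w" using assms by (simp add: valid_word_def)
    ultimately show "drop (word_start w) w ! l = ?rows ! l" by (simp add: word_x_def)
  qed
  have "w = replicate ?n True @ False # replicate (word_i w) True @ False #
      replicate (word_j w) True @ False # ?rows"
    using 1 unfolding 2 3 4 .
  then show ?thesis by (simp add: encode_def)
qed

lemma encode_parse:
  assumes "w = encode n x (i, j)"
  shows "word_n w = n" "word_i w = i" "word_j w = j" "length w = word_start w + n * n"
    and "first_zero w 0 < first_zero w (first_zero w 0)"
    and "first_zero w (first_zero w 0) < word_start w"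
    and "\<And>a b. a < n \<Longrightarrow> b < n \<Longrightarrow> word_x w (a, b) = x (a, b)"
proof -
  let ?rows = "concat (map (\<lambda>a. map (\<lambda>b. x (a, b)) [0..<n]) [0..<n])"
  have w: "w = replicate n True @ False # replicate i True @ False # replicate j True @ False # ?rows"
    using assms by (simp add: encode_def)
  have d0: "drop 0 w = replicate n True @ False # replicate i True @ False # replicate j True @ False # ?rows"
    using w by simp
  have f1: "first_zero w 0 = n + 1"
    using first_zero_append[OF d0] by simp
  have d1: "drop (n + 1) w = replicate i True @ False # replicate j True @ False # ?rows"
    unfolding w by simp
  have f2: "first_zero w (n + 1) = n + 1 + i + 1"
    by (rule first_zero_append[OF d1]) (unfold w, simp)
  have "drop (n + 1 + i + 1) w = drop (i + 1) (drop (n + 1) w)"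
    by (simp add: add.commute add.left_commute)
  also have "\<dots> = replicate j True @ False # ?rows" unfolding d1 by simp
  finally have d2: "drop (n + 1 + i + 1) w = replicate j True @ False # ?rows" .
  have f3: "first_zero w (n + 1 + i + 1) = n + 1 + i + 1 + j + 1"
    by (rule first_zero_append[OF d2]) (unfold w, simp)
  have start: "word_start w = n + 1 + i + 1 + j + 1"
    unfolding word_start_def f1 f2 f3 ..
  have "drop (n + 1 + i + 1 + j + 1) w = drop (j + 1) (drop (n + 1 + i + 1) w)"
    by (simp add: add.commute add.left_commute)
  also have "\<dots> = ?rows" unfolding d2 by simp
  finally have d3: "drop (word_start w) w = ?rows" unfolding start .
  show n: "word_n w = n" by (simp add: word_n_def f1)
  show "word_i w = i" unfolding word_i_def f1 f2 by simp
  show "word_j w = j" unfolding word_j_def f1 f2 start by simp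
  have "length w = n + 1 + i + 1 + j + 1 + length ?rows" by (subst w) simp
  then show len: "length w = word_start w + n * n" unfolding rows_length_nth(1) start by simp
  show "first_zero w 0 < first_zero w (first_zero w 0)"
    "first_zero w (first_zero w 0) < word_start w"
    unfolding f1 f2 start by simp_all
  fix a b assume "a < n" "b < n"
  moreover have "w ! (word_start w + k) = drop (word_start w) w ! k" for k
    using len by (intro nth_drop[symmetric]) simp
  ultimately show "word_x w (a, b) = x (a, b)"
    unfolding word_x_def n d3 using rows_length_nth(2)[of a n b n "\<lambda>a b. x (a, b)"] by (simp add: n d3)
qed

text \<open>Parsing inverts \<open>encode\<close>, so the parsed data are the only candidate for the
  quantifiers in \<open>STABILITY\<close>; the parsed function agrees with \<open>x\<close> on the
  square, which is all that \<open>periodic\<close> sees.\<close>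

lemma in_STABILITY_iff:
  "w \<in> STABILITY \<I> \<longleftrightarrow> valid_word w \<and>
    stable \<I> (periodic (word_n w) (word_x w)) (int (word_i w), int (word_j w))"
proof
  assume "w \<in> STABILITY \<I>"
  then obtain n x i j where w: "w = encode n x (i, j)" and ij: "i < n" "j < n" "\<not> x (i, j)"
    and stable: "stable \<I> (periodic n x) (int i, int j)"
    unfolding STABILITY_def by blast
  note parse = encode_parse[OF w]
  have "\<not> w ! (word_start w + (i * n + j))"
    using parse(7)[OF ij(1,2)] ij(3) by (simp add: word_x_def parse(1))
  then have "valid_word w" using parse(1-6) ij by (simp add: valid_word_def)
  moreover have "periodic n (word_x w) = periodic n x"
  proof
    fix u show "periodic n (word_x w) u = periodic n x u"
      using parse(7) ij(1) by (cases u) (simp add: periodic_def nat_less_iff)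
  qed
  ultimately show "valid_word w \<and>
    stable \<I> (periodic (word_n w) (word_x w)) (int (word_i w), int (word_j w))"
    using stable parse(1-3) by simp
next
  assume *: "valid_word w \<and>
    stable \<I> (periodic (word_n w) (word_x w)) (int (word_i w), int (word_j w))"
  then have "w = encode (word_n w) (word_x w) (word_i w, word_j w)" using valid_word_encode by blast
  moreover have "word_i w < word_n w" "word_j w < word_n w" "\<not> word_x w (word_i w, word_j w)"
    using * by (auto simp: valid_word_def word_x_def)
  ultimately show "w \<in> STABILITY \<I>" unfolding STABILITY_def using * by blast
qed

section \<open>The parallel program\<close>

text \<open>An environment gives the value of a register as a function of the processor index; a
  constant function says that all processors agree.\<close>

definition holds :: "(nat \<times> (nat \<Rightarrow> nat)) list \<Rightarrow> (nat \<Rightarrow> registers) \<Rightarrow> bool" where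
  "holds env rg \<longleftrightarrow> (\<forall>p. \<forall>(r, f)\<in>set env. rg p r = f p)"

definition state :: "(nat \<times> (nat \<Rightarrow> nat)) list \<Rightarrow> memory \<Rightarrow> (nat \<Rightarrow> registers) \<Rightarrow> memory \<Rightarrow> bool" where
  "state env \<mu> rg m \<longleftrightarrow> holds env rg \<and> m = \<mu>"

definition counter_env :: "nat \<Rightarrow> (nat \<times> (nat \<Rightarrow> nat)) list \<Rightarrow> bool" where
  "counter_env B env \<longleftrightarrow> (\<exists>a b. a \<le> B \<and> b \<le> B \<and> (3, \<lambda>_. a) \<in> set env \<and> (4, \<lambda>_. b) \<in> set env)"

lemma counters_le_holds: "counter_env B env \<Longrightarrow> holds env rg \<Longrightarrow> counters_le B rg"
proof -
  assume "counter_env B env" and rg: "holds env rg"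
  then obtain a b where ab: "a \<le> B" "b \<le> B" "(3, \<lambda>_. a) \<in> set env" "(4, \<lambda>_. b) \<in> set env"
    unfolding counter_env_def by blast
  have "\<forall>(r, f)\<in>set env. rg p r = f p" for p using rg by (simp add: holds_def)
  from bspec[OF this ab(3)] bspec[OF this ab(4)] have "rg p 3 = a \<and> rg p 4 = b" for p by simp
  with ab(1,2) show "counters_le B rg" unfolding counters_le_def by blast
qed

lemma state_subset: "set env' \<subseteq> set env \<Longrightarrow> state env \<mu> rg m \<Longrightarrow> state env' \<mu> rg m"
  unfolding state_def holds_def by blast

lemma holds_upd:
  assumes "holds env rg" "r \<notin> fst ` set env"
  shows "holds env (\<lambda>p. (rg p)(r := f p))"
  unfolding holds_def
proof (intro allI ballI, clarify)
  fix p q g assume q: "(q, g) \<in> set env"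
  then have "q \<noteq> r" using assms(2) by force
  then show "((rg p)(r := f p)) q = g p" using assms(1) q unfolding holds_def by auto
qed

text \<open>Freshness of \<open>r\<close> enforces single assignment, so the environment only grows
  and earlier entries stay true.\<close>

lemma triple_Assign_state:
  assumes "regs_below 50 e" "r < 50" "r \<noteq> 2" "r \<notin> fst ` set env" "counter_env B env"
    and ev: "\<And>rg p. \<forall>(r, f)\<in>set env. rg r = f p \<Longrightarrow> eval e rg \<mu> = v p"
  shows "triple P B (state env \<mu>) (Assign r e) (state ((r, v) # env) \<mu>)"
proof (rule triple_Assign[OF assms(1-3)])
  fix rg m assume s: "state env \<mu> rg m"
  have "counters_le B rg" using s assms(5) counters_le_holds by (auto simp: state_def)
  moreover have "eval e (rg p) m = v p" for p
    using s ev[of "rg p" p] by (auto simp: state_def holds_def)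
  moreover have "holds env (\<lambda>p. (rg p)(r := v p))"
    using s holds_upd[OF _ assms(4)] by (auto simp: state_def)
  ultimately show "counters_le B rg \<and> state ((r, v) # env) \<mu> (\<lambda>p. (rg p)(r := eval e (rg p) m)) m"
    using s by (auto simp: state_def holds_def)
qed

fun assigns :: "(nat \<times> expr) list \<Rightarrow> stm \<Rightarrow> stm" where
  "assigns [] s = s"
| "assigns ((r, e) # xs) s = Assign r e ;> assigns xs s"

fun regs_of :: "expr \<Rightarrow> nat set" where
  "regs_of (Reg r) = {r}"
| "regs_of (Lit k) = {}"
| "regs_of (Sum a b) = regs_of a \<union> regs_of b"
| "regs_of (Diff a b) = regs_of a \<union> regs_of b"
| "regs_of (Fetch a) = regs_of a"
| "regs_of (Shl r a) = insert r (regs_of a)"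
| "regs_of (Shr r a) = insert r (regs_of a)"
| "regs_of (Prod a b) = insert 3 (regs_of a \<union> regs_of b)"

lemma eval_regs_cong: "(\<And>r. r \<in> regs_of e \<Longrightarrow> rg r = rg' r) \<Longrightarrow> eval e rg m = eval e rg' m"
  by (induction e) auto

text \<open>A concrete register file for an environment, on which simplification can evaluate
  expressions.\<close>

definition lookup :: "(nat \<times> (nat \<Rightarrow> nat)) list \<Rightarrow> nat \<Rightarrow> registers" where
  "lookup env p r = (case map_of env r of Some f \<Rightarrow> f p | None \<Rightarrow> 0)"

lemma eval_lookup:
  assumes "\<forall>(r, f)\<in>set env. rg r = f p" "regs_of e \<subseteq> fst ` set env"
  shows "eval e rg m = eval e (lookup env p) m"
proof (rule eval_regs_cong)
  fix r assume "r \<in> regs_of e"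
  then obtain f where "map_of env r = Some f"
    using assms(2) by (metis in_mono map_of_eq_None_iff not_Some_eq)
  then show "rg r = lookup env p r" using assms(1) map_of_SomeD by (fastforce simp: lookup_def)
qed

text \<open>A check that simplification can unfold: it reduces a whole block of assignments with its
  claimed values to equations between expressions.\<close>

fun assigns_ok :: "memory \<Rightarrow> (nat \<times> (nat \<Rightarrow> nat)) list \<Rightarrow> (nat \<times> expr) list \<Rightarrow>
    (nat \<Rightarrow> nat) list \<Rightarrow> bool" where
  "assigns_ok \<mu> env ((r, e) # xs) (v # vs) \<longleftrightarrow>
     regs_below 50 e \<and> r < 50 \<and> r \<noteq> 2 \<and> r \<notin> fst ` set env \<and> regs_of e \<subseteq> fst ` set env \<and>
     (\<forall>p. eval e (lookup env p) \<mu> = v p) \<and> assigns_ok \<mu> ((r, v) # env) xs vs"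
| "assigns_ok \<mu> env [] [] \<longleftrightarrow> True"
| "assigns_ok \<mu> env _ _ \<longleftrightarrow> False"

lemma triple_assigns:
  assumes "assigns_ok \<mu> env xs vs" "counter_env B env"
    and "triple P B (state (rev (zip (map fst xs) vs) @ env) \<mu>) s Post"
  shows "triple P B (state env \<mu>) (assigns xs s) Post"
  using assms
proof (induction \<mu> env xs vs rule: assigns_ok.induct)
  case (1 \<mu> env r e xs v vs)
  have "counter_env B ((r, v) # env)" using "1.prems"(2) unfolding counter_env_def by auto
  then have "triple P B (state ((r, v) # env) \<mu>) (assigns xs s) Post"
    using "1.IH" "1.prems" by simp
  moreover have "triple P B (state env \<mu>) (Assign r e) (state ((r, v) # env) \<mu>)"
  proof (rule triple_Assign_state)
    fix rg p assume "\<forall>(r, f)\<in>set env. rg r = f p"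
    then show "eval e rg \<mu> = v p" using "1.prems"(1) eval_lookup[of env rg p e \<mu>] by simp
  qed (use "1.prems" in auto)
  ultimately show ?case by (auto intro: triple_Then)
qed auto

lemma triple_Put_state:
  assumes "regs_below 50 g" "regs_below 50 a" "regs_below 50 v" "counter_env B env"
    and ev: "\<And>rg p. \<forall>(r, f)\<in>set env. rg r = f p \<Longrightarrow>
      (eval g rg \<mu> \<noteq> 0) = act p \<and> eval a rg \<mu> = ad p \<and> eval v rg \<mu> = vl p"
    and "\<mu>' = par_write P act ad vl \<mu>"
  shows "triple P B (state env \<mu>) (Put g a v) (state env \<mu>')"
proof (rule triple_Put[OF assms(1-3)])
  fix rg m assume s: "state env \<mu> rg m"
  have "counters_le B rg" using s assms(4) counters_le_holds by (auto simp: state_def)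
  moreover have "(eval g (rg p) m \<noteq> 0) = act p \<and> eval a (rg p) m = ad p \<and> eval v (rg p) m = vl p" for p
    using s ev[of "rg p" p] by (auto simp: state_def holds_def)
  ultimately show "counters_le B rg \<and> state env \<mu>' rg (par_write P (\<lambda>p. eval g (rg p) m \<noteq> 0)
      (\<lambda>p. eval a (rg p) m) (\<lambda>p. eval v (rg p) m) m)"
    using s by (simp add: state_def assms(6))
qed

text \<open>\<open>\<mu> k\<close> is the memory with \<open>k\<close> passes left. The loop
  register leaves the environment at the end, so an inner loop can set it afresh in every outer
  pass.\<close>

lemma triple_For_state:
  assumes "r < 50" "r \<noteq> 2" "r \<notin> fst ` set env" "n \<le> B"
    and body: "\<And>k. k < n \<Longrightarrow>
      triple P B (state ((r, \<lambda>_. Suc k) # env) (\<mu> (Suc k))) s (state ((r, \<lambda>_. Suc k) # env) (\<mu> k))"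
  shows "triple P B (state ((r, \<lambda>_. n) # env) (\<mu> n)) (For r s) (state env (\<mu> 0))"
proof -
  have "triple P B (state ((r, \<lambda>_. n) # env) (\<mu> n)) (For r s) (state ((r, \<lambda>_. 0) # env) (\<mu> 0))"
  proof (rule triple_For[OF assms(1,2), where I = "\<lambda>k. state ((r, \<lambda>_. k) # env) (\<mu> k)"])
    fix k rg m p assume "state ((r, \<lambda>_. k) # env) (\<mu> k) rg m"
    then show "rg p r = k" by (simp add: state_def holds_def)
  next
    fix k assume "Suc k \<le> n"
    then have "triple P B (state ((r, \<lambda>_. Suc k) # env) (\<mu> (Suc k))) s
        (state ((r, \<lambda>_. Suc k) # env) (\<mu> k))" using body by simp
    then show "triple P B (state ((r, \<lambda>_. Suc k) # env) (\<mu> (Suc k))) s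
       (\<lambda>rg. state ((r, \<lambda>_. k) # env) (\<mu> k) (\<lambda>p. (rg p)(r := rg p r - 1)))"
    proof (rule triple_conseq)
      fix rg m assume s: "state ((r, \<lambda>_. Suc k) # env) (\<mu> k) rg m"
      then have "holds env rg" "\<And>p. rg p r = Suc k" by (simp_all add: state_def holds_def)
      then have "holds env (\<lambda>p. (rg p)(r := rg p r - 1))" by (intro holds_upd assms(3))
      with s show "state ((r, \<lambda>_. k) # env) (\<mu> k) (\<lambda>p. (rg p)(r := rg p r - 1)) m"
        by (simp add: state_def holds_def)
    qed
  qed fact
  then show ?thesis
  proof (rule triple_conseq)
    fix rg m assume "state ((r, \<lambda>_. 0) # env) (\<mu> 0) rg m"
    then show "state env (\<mu> 0) rg m" by (rule state_subset[rotated]) auto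
  qed
qed

section \<open>Comparisons and connectives by truncated subtraction\<close>

definition e_le :: "expr \<Rightarrow> expr \<Rightarrow> expr" where
  "e_le a b = Diff (Lit 1) (Diff a b)"

definition e_lt :: "expr \<Rightarrow> expr \<Rightarrow> expr" where
  "e_lt a b = e_le (Sum a (Lit 1)) b"

definition e_is_zero :: "expr \<Rightarrow> expr" where
  "e_is_zero a = Diff (Lit 1) a"

text \<open>Meant for the truth values 0 and 1, where truncation leaves 1 exactly if both are
  1.\<close>

definition e_conj :: "expr \<Rightarrow> expr \<Rightarrow> expr" where
  "e_conj a b = Diff (Sum a b) (Lit 1)"

definition e_min :: "expr \<Rightarrow> expr \<Rightarrow> expr" where
  "e_min a b = Diff a (Diff a b)"

definition e_max :: "expr \<Rightarrow> expr \<Rightarrow> expr" where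
  "e_max a b = Sum a (Diff b a)"

definition e_low :: "nat \<Rightarrow> expr \<Rightarrow> expr" where
  "e_low r a = Diff a (Shl r (Shr r a))"

definition e_code :: "expr \<Rightarrow> expr \<Rightarrow> expr \<Rightarrow> expr \<Rightarrow> expr" where
  "e_code a b c d = Sum (Shl 4 (Sum (Shl 4 (Sum (Shl 4 a) b)) c)) d"

lemma eval_derived [simp]:
  "eval (e_le a b) rg m = of_bool (eval a rg m \<le> eval b rg m)"
  "eval (e_lt a b) rg m = of_bool (eval a rg m < eval b rg m)"
  "eval (e_is_zero a) rg m = of_bool (eval a rg m = 0)"
  "eval (e_conj a b) rg m = eval a rg m + eval b rg m - Suc 0"
  "eval (e_min a b) rg m = min (eval a rg m) (eval b rg m)"
  "eval (e_max a b) rg m = max (eval a rg m) (eval b rg m)"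
  "eval (e_low r a) rg m = eval a rg m mod 2 ^ rg r"
  "eval (e_code a b c d) rg m =
     ((eval a rg m * 2 ^ rg 4 + eval b rg m) * 2 ^ rg 4 + eval c rg m) * 2 ^ rg 4 + eval d rg m"
  by (auto simp: e_le_def e_lt_def e_is_zero_def e_conj_def e_min_def e_max_def e_low_def e_code_def
      minus_div_mult_eq_mod min_def max_def)

lemma regs_below_derived [simp]:
  "regs_below d (e_le a b) \<longleftrightarrow> regs_below d a \<and> regs_below d b"
  "regs_below d (e_lt a b) \<longleftrightarrow> regs_below d a \<and> regs_below d b"
  "regs_below d (e_is_zero a) \<longleftrightarrow> regs_below d a"
  "regs_below d (e_conj a b) \<longleftrightarrow> regs_below d a \<and> regs_below d b"
  "regs_below d (e_min a b) \<longleftrightarrow> regs_below d a \<and> regs_below d b"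
  "regs_below d (e_max a b) \<longleftrightarrow> regs_below d a \<and> regs_below d b"
  "regs_below d (e_low r a) \<longleftrightarrow> regs_below d a \<and> (r = 3 \<or> r = 4)"
  "regs_below d (e_code a b c e) \<longleftrightarrow>
     regs_below d a \<and> regs_below d b \<and> regs_below d c \<and> regs_below d e"
  by (auto simp: e_le_def e_lt_def e_is_zero_def e_conj_def e_min_def e_max_def e_low_def e_code_def)

lemma regs_of_derived [simp]:
  "regs_of (e_le a b) = regs_of a \<union> regs_of b"
  "regs_of (e_lt a b) = regs_of a \<union> regs_of b"
  "regs_of (e_is_zero a) = regs_of a"
  "regs_of (e_conj a b) = regs_of a \<union> regs_of b"
  "regs_of (e_min a b) = regs_of a \<union> regs_of b"
  "regs_of (e_max a b) = regs_of a \<union> regs_of b"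
  "regs_of (e_low r a) = insert r (regs_of a)"
  "regs_of (e_code a b c d) = insert 4 (regs_of a \<union> regs_of b \<union> regs_of c \<union> regs_of d)"
  by (auto simp: e_le_def e_lt_def e_is_zero_def e_conj_def e_min_def e_max_def e_low_def e_code_def)

lemma of_bool_conj_nat [simp]: "of_bool a + of_bool b - Suc 0 = of_bool (a \<and> b)"
  by simp

section \<open>Rectangles as four-digit numbers\<close>

fun rect_code :: "nat \<Rightarrow> rect \<Rightarrow> nat" where
  "rect_code m (x1, y1, x2, y2) = ((x1 * 2 ^ m + y1) * 2 ^ m + x2) * 2 ^ m + y2"

text \<open>Total: every number decodes to a rectangle of the box, so each processor has rectangles
  to work on.\<close>

definition rect_of :: "nat \<Rightarrow> nat \<Rightarrow> rect" where
  "rect_of m v = (v div 2 ^ m div 2 ^ m div 2 ^ m mod 2 ^ m, v div 2 ^ m div 2 ^ m mod 2 ^ m,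
     v div 2 ^ m mod 2 ^ m, v mod 2 ^ m)"

lemma digit_bound: "a < b \<Longrightarrow> c < d \<Longrightarrow> a * d + c < b * (d :: nat)"
  using mult_le_mono1[of "Suc a" b d] by simp

lemma rect_of_in_box: "rect_of m v \<in> box (2 ^ m)"
  by (simp add: rect_of_def box_def)

lemma rect_of_code: "R \<in> box (2 ^ m) \<Longrightarrow> rect_of m (rect_code m R) = R"
  by (cases R) (simp add: rect_of_def box_def)

lemma rect_code_less:
  assumes "R \<in> box (2 ^ m)"
  shows "rect_code m R < 2 ^ (4 * m)"
proof -
  obtain x1 y1 x2 y2 where R: "R = (x1, y1, x2, y2)" by (cases R)
  have "rect_code m R < 2 ^ m * 2 ^ m * 2 ^ m * 2 ^ m"
    unfolding R rect_code.simps using assms unfolding R box_def by (intro digit_bound) auto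
  also have "\<dots> = 2 ^ (4 * m)" by (simp flip: power_add)
  finally show ?thesis .
qed

lemma rect_code_of:
  assumes "v < 2 ^ (4 * m)"
  shows "rect_code m (rect_of m v) = v"
proof -
  have "2 ^ (4 * m) = 2 ^ m * (2 ^ m * (2 ^ m * 2 ^ m :: nat))" by (simp flip: power_add)
  then have "v div 2 ^ m div 2 ^ m div 2 ^ m < 2 ^ m"
    using assms by (simp add: less_mult_imp_div_less mult.commute mult.left_commute)
  then show ?thesis by (simp add: rect_of_def div_mult_mod_eq)
qed

lemma less_bit_length: "n < 2 ^ bit_length n"
proof (induction n rule: less_induct)
  case (less n)
  show ?case
  proof (cases "n = 0")
    case False
    then have "n div 2 < 2 ^ bit_length (n div 2)" using less.IH by simp
    then show ?thesis using False by (subst bit_length.simps) simp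
  qed simp
qed

text \<open>With \<open>less_bit_length\<close>, the power is within a factor two of
  \<open>n\<close>: large enough for the window, small enough for polynomially many
  processors.\<close>

lemma bit_length_le: "0 < n \<Longrightarrow> 2 ^ bit_length n \<le> 2 * n"
proof (induction n rule: less_induct)
  case (less n)
  show ?case
  proof (cases "n = 1")
    case True
    then show ?thesis by (simp add: bit_length.simps)
  next
    case False
    then have "2 ^ bit_length (n div 2) \<le> 2 * (n div 2)" using less by simp
    then show ?thesis using less.prems by (subst bit_length.simps) simp
  qed
qed

lemma par_write_const:
  "par_write P act ad (\<lambda>_. v) \<mu> x = (if \<exists>p<P. act p \<and> ad p = x then v else \<mu> x)"
  by (simp add: par_write_def)

section \<open>The text of the program\<close>

definition mark :: "nat \<Rightarrow> nat \<Rightarrow> stm" where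
  "mark r d = Put (e_conj (e_conj (e_lt (Reg 0) (Reg 1)) (e_is_zero (Fetch (Reg 0)))) (e_le (Reg r) (Reg 0)))
     (Sum (Reg 1) (Lit d)) (Sum (Reg 0) (Lit 1))"

text \<open>Registers 6 to 8 hold the positions after the three separators of the input, 9 to 11 the size
  \<open>n\<close> and the coordinates of the cell, 36 its square, 13 and 14 the coordinates of the translate of
  the cell in the window, and 12 whether the input is well-formed and its cell inactive.\<close>

definition parameters :: "(nat \<times> expr) list" where
  "parameters =
    [(9, Diff (Reg 6) (Lit 1)),
     (10, Diff (Diff (Reg 7) (Reg 6)) (Lit 1)),
     (11, Diff (Diff (Reg 8) (Reg 7)) (Lit 1)),
     (36, Prod (Reg 9) (Reg 9)),
     (13, Sum (Reg 10) (Reg 36)),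
     (14, Sum (Reg 11) (Reg 36))]"

text \<open>Each condition becomes a quantity that vanishes exactly when it holds, so one test of
  the sum decides all: \<open>a < b\<close> turns into \<open>a + 1 - b\<close>, an equation into
  two opposite differences.\<close>

definition e_valid :: expr where
  "e_valid = e_is_zero (Sum (Diff (Sum (Reg 10) (Lit 1)) (Reg 9))
     (Sum (Diff (Sum (Reg 11) (Lit 1)) (Reg 9))
     (Sum (Diff (Sum (Reg 6) (Lit 1)) (Reg 7))
     (Sum (Diff (Sum (Reg 7) (Lit 1)) (Reg 8))
     (Sum (Diff (Reg 1) (Sum (Reg 8) (Reg 36)))
     (Sum (Diff (Sum (Reg 8) (Reg 36)) (Reg 1))
     (Fetch (Sum (Reg 8) (Sum (Prod (Reg 10) (Reg 9)) (Reg 11))))))))))"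

text \<open>The processor index consists of the codes of three rectangles.\<close>

definition part_indices :: "(nat \<times> expr) list" where
  "part_indices =
    [(15, e_low 3 (Shr 3 (Shr 3 (Reg 0)))),
     (16, e_low 3 (Shr 3 (Reg 0))),
     (17, e_low 3 (Reg 0))]"

definition corner_indices :: "(nat \<times> expr) list" where
  "corner_indices =
    [(18, e_low 4 (Shr 4 (Shr 4 (Shr 4 (Reg 15))))),
     (19, e_low 4 (Shr 4 (Shr 4 (Reg 15)))),
     (20, e_low 4 (Shr 4 (Reg 15))),
     (21, e_low 4 (Reg 15)),
     (22, e_low 4 (Shr 4 (Shr 4 (Shr 4 (Reg 16))))),
     (23, e_low 4 (Shr 4 (Shr 4 (Reg 16)))),
     (24, e_low 4 (Shr 4 (Reg 16))),
     (25, e_low 4 (Reg 16))]"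

text \<open>What depends on the processor index alone is computed before the loops, so that a round
  consists of fetches and two writes. Registers 39 and 40 read the second rectangle as two numbers,
  each a quotient times \<open>n\<close> plus a remainder.\<close>

definition address_indices :: "(nat \<times> expr) list" where
  "address_indices =
    [(37, e_code (Diff (Shl 4 (Lit 1)) (Lit 1)) (Diff (Shl 4 (Lit 1)) (Lit 1)) (Lit 0) (Lit 0)),
     (38, Sum (Reg 1) (Lit 4)),
     (26, Sum (Reg 38) (Sum (Shl 3 (Reg 15)) (Reg 16))),
     (27, Sum (Reg 38) (Sum (Shl 3 (Reg 16)) (Reg 17))),
     (28, Sum (Reg 38) (Sum (Shl 3 (Reg 15)) (Reg 17))),
     (29, Sum (Reg 38) (Sum (Shl 3 (Reg 37)) (Reg 16))),
     (32, Sum (Reg 38) (Sum (Shl 3 (Reg 37)) (Reg 15))),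
     (30, Sum (Reg 38) (Sum (Shl 3 (Reg 15))
        (e_code (e_min (Reg 18) (Reg 22)) (e_min (Reg 19) (Reg 23))
          (e_max (Reg 20) (Reg 24)) (e_max (Reg 21) (Reg 25))))),
     (31, e_le (Sum (Sum (Sum (Diff (Reg 22) (Reg 20)) (Diff (Reg 18) (Reg 24)))
        (Diff (Reg 23) (Reg 21))) (Diff (Reg 19) (Reg 25))) (Lit 2)),
     (39, Sum (Prod (Reg 22) (Reg 9)) (Reg 23)),
     (40, Sum (Prod (Reg 24) (Reg 9)) (Reg 25)),
     (41, Shl 4 (Lit 1))]"

text \<open>The machine cannot divide by \<open>n\<close>. Instead a processor takes the corners of
  its second rectangle as guessed quotients and remainders of the coordinates of a window cell; some
  processor guesses right for each cell.\<close>

definition start_points :: stm where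
  "start_points = Put
     (e_conj (e_conj (e_conj (e_lt (Reg 23) (Reg 9)) (e_lt (Reg 25) (Reg 9)))
        (e_conj (e_lt (Reg 39) (Reg 41)) (e_lt (Reg 40) (Reg 41))))
        (e_lt (Lit 0) (Fetch (Sum (Reg 8) (Sum (Prod (Reg 23) (Reg 9)) (Reg 25))))))
     (Sum (Reg 38) (Sum (Shl 3 (Reg 37)) (e_code (Reg 39) (Reg 40) (Reg 39) (Reg 40))))
     (Lit 1)"

definition round_body :: stm where
  "round_body =
     Put (e_conj (Fetch (Reg 26)) (Fetch (Reg 27))) (Reg 28) (Lit 1) ;>
     Put (e_conj (Reg 31) (Fetch (Reg 29))) (Reg 30) (Lit 1)"

definition find_target :: stm where
  "find_target = Put
     (e_conj (e_conj (e_conj (e_le (Reg 18) (Reg 13)) (e_le (Reg 13) (Reg 20)))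
        (e_conj (e_le (Reg 19) (Reg 14)) (e_le (Reg 14) (Reg 21)))) (Fetch (Reg 32)))
     (Sum (Reg 1) (Lit 3)) (Lit 1)"

text \<open>An ill-formed input goes through the same rounds on meaningless data, and register 12
  alone makes the answer 0. The number of steps therefore depends only on the length of the
  input.\<close>

definition stability_stm :: stm where
  "stability_stm =
     (Bit_length ;> Assign 3 (Sum (Sum (Reg 4) (Reg 4)) (Sum (Reg 4) (Reg 4)))) ;>
     mark 2 0 ;> Assign 6 (Fetch (Sum (Reg 1) (Lit 0))) ;>
     mark 6 1 ;> Assign 7 (Fetch (Sum (Reg 1) (Lit 1))) ;>
     mark 7 2 ;> Assign 8 (Fetch (Sum (Reg 1) (Lit 2))) ;>
     assigns parameters (Assign 12 e_valid ;> assigns part_indices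
       (assigns corner_indices (assigns address_indices (start_points ;>
        (Assign 33 (Reg 3) ;> For 33 (Assign 34 (Reg 3) ;> For 34 round_body)) ;>
        find_target ;>
        Assign 35 (e_conj (Reg 12) (e_is_zero (Fetch (Sum (Reg 1) (Lit 3))))) ;>
        Put (Lit 1) (Lit 0) (Reg 35)))))"

section \<open>Memory layout and the effect of parallel writes\<close>

locale word_input =
  fixes w :: "bool list" and P b :: nat
  assumes b: "b = bit_length (length w) + 3" and P: "2 ^ (12 * b) \<le> P"
begin

definition "f1 = first_zero w 0"
definition "f2 = first_zero w f1"
definition "f3 = first_zero w f2"

definition initial_memory :: memory where
  "initial_memory = mem (initial w)"

definition parsed :: memory where
  "parsed = initial_memory(length w := f1, length w + 1 := f2, length w + 2 := f3)"

definition part_a :: "nat \<Rightarrow> nat" where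
  "part_a p = p div 2 ^ (4 * b) div 2 ^ (4 * b) mod 2 ^ (4 * b)"

definition part_b :: "nat \<Rightarrow> nat" where
  "part_b p = p div 2 ^ (4 * b) mod 2 ^ (4 * b)"

definition part_c :: "nat \<Rightarrow> nat" where
  "part_c p = p mod 2 ^ (4 * b)"

definition address :: "nat \<Rightarrow> nat \<Rightarrow> nat" where
  "address x y = length w + 4 + (x * 2 ^ (4 * b) + y)"

text \<open>The memory holds the input, the three positions after the separators, the flag for the
  target, and from \<open>length w + 4\<close> on the table as a matrix of zeros and ones.\<close>

definition table :: "(rect \<times> rect) set \<Rightarrow> memory" where
  "table G = (\<lambda>x. if x < length w + 4 then parsed x
     else of_bool (\<exists>(R, S)\<in>G. x = address (rect_code b R) (rect_code b S)))"

lemma length_less: "length w < 2 ^ b" "8 * length w < 2 ^ b"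
proof -
  have "length w < 2 ^ bit_length (length w)" by (rule less_bit_length)
  then show "8 * length w < 2 ^ b" by (simp add: b power_add)
  then show "length w < 2 ^ b" by simp
qed

lemma pow_b_le: "2 ^ b \<le> (2 ^ (4 * b) :: nat)" by (intro power_increasing) auto

lemma parts_less: "part_a p < 2 ^ (4 * b)" "part_b p < 2 ^ (4 * b)" "part_c p < 2 ^ (4 * b)"
  by (simp_all add: part_a_def part_b_def part_c_def)

text \<open>The bound \<open>2 ^ (12 * b)\<close> of the locale is made for this: three rectangle
  codes of \<open>4 * b\<close> bits each.\<close>

lemma ex_processor:
  assumes "x < 2 ^ (4 * b)" "y < 2 ^ (4 * b)" "z < 2 ^ (4 * b)"
  shows "\<exists>p<P. part_a p = x \<and> part_b p = y \<and> part_c p = z"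
proof (intro exI conjI)
  let ?p = "(x * 2 ^ (4 * b) + y) * 2 ^ (4 * b) + z"
  have "?p < 2 ^ (4 * b) * 2 ^ (4 * b) * 2 ^ (4 * b)" using assms by (intro digit_bound)
  also have "\<dots> = 2 ^ (12 * b)" by (simp flip: power_add)
  finally show "?p < P" using P by simp
  show "part_a ?p = x" "part_b ?p = y" "part_c ?p = z"
    using assms by (simp_all add: part_a_def part_b_def part_c_def)
qed

lemma P_ge: "length w < P" "0 < P"
proof -
  have "2 ^ b \<le> (2 ^ (12 * b) :: nat)" by (intro power_increasing) auto
  then show "length w < P" using length_less(1) P by linarith
  then show "0 < P" by simp
qed

lemma first_zero_le: "first_zero w s \<le> length w"
  using drop_first_zero(2)[of w s] by (cases "first_zero w s") auto

lemma initial_memory_eq: "initial_memory x = (if x < length w then of_bool (w ! x) else 0)"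
  by (simp add: initial_memory_def initial_def)

text \<open>All positions from \<open>s\<close> on that hold \<open>False\<close> write to the same
  cell, and the priority rule lets the first one win; the search is a single parallel write.\<close>

lemma par_write_mark:
  assumes "\<And>p. p < length w \<Longrightarrow> \<mu> p = of_bool (w ! p)" "\<mu> a = 0"
  shows "par_write P (\<lambda>p. p < length w \<and> \<mu> p = 0 \<and> s \<le> p) (\<lambda>_. a) (\<lambda>p. p + 1) \<mu> =
    \<mu>(a := first_zero w s)"
proof
  fix x
  have eq: "(p < P \<and> (p < length w \<and> \<mu> p = 0 \<and> s \<le> p) \<and> a = a) \<longleftrightarrow>
      p < length w \<and> s \<le> p \<and> \<not> w ! p" for p
    using assms(1)[of p] P_ge(1) by auto
  show "par_write P (\<lambda>p. p < length w \<and> \<mu> p = 0 \<and> s \<le> p) (\<lambda>_. a) (\<lambda>p. p + 1) \<mu> x =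
    (\<mu>(a := first_zero w s)) x"
  proof (cases "x = a")
    case True
    then show ?thesis unfolding par_write_def True eq using assms(2) by (auto simp: first_zero_def)
  next
    case False
    then show ?thesis unfolding par_write_def by auto
  qed
qed

lemma address_inject:
  assumes "y < 2 ^ (4 * b)" "y' < 2 ^ (4 * b)"
  shows "address x y = address x' y' \<longleftrightarrow> x = x' \<and> y = y'"
proof
  assume "address x y = address x' y'"
  then have eq: "x * 2 ^ (4 * b) + y = x' * 2 ^ (4 * b) + y'" by (simp add: address_def)
  from arg_cong[OF eq, of "\<lambda>v. v div 2 ^ (4 * b)"] arg_cong[OF eq, of "\<lambda>v. v mod 2 ^ (4 * b)"]
  show "x = x' \<and> y = y'" using assms by simp
qed simp

lemma address_ge: "\<not> address x y < length w + 4" by (simp add: address_def)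

lemma table_read:
  assumes "G \<subseteq> box (2 ^ b) \<times> box (2 ^ b)" "x < 2 ^ (4 * b)" "y < 2 ^ (4 * b)"
  shows "table G (address x y) = of_bool ((rect_of b x, rect_of b y) \<in> G)"
proof -
  have "(\<exists>(R, S)\<in>G. address x y = address (rect_code b R) (rect_code b S)) \<longleftrightarrow>
      (rect_of b x, rect_of b y) \<in> G"
  proof
    assume "\<exists>(R, S)\<in>G. address x y = address (rect_code b R) (rect_code b S)"
    then obtain R S where RS: "(R, S) \<in> G" "address x y = address (rect_code b R) (rect_code b S)"
      by blast
    then have in_box: "R \<in> box (2 ^ b)" "S \<in> box (2 ^ b)" using assms(1) by blast+
    then have "x = rect_code b R" "y = rect_code b S"
      using RS(2) address_inject[OF assms(3) rect_code_less] by blast+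
    then show "(rect_of b x, rect_of b y) \<in> G" using RS(1) in_box by (simp add: rect_of_code)
  next
    assume "(rect_of b x, rect_of b y) \<in> G"
    then show "\<exists>(R, S)\<in>G. address x y = address (rect_code b R) (rect_code b S)"
      using rect_code_of[OF assms(2)] rect_code_of[OF assms(3)]
      by (intro bexI[of _ "(rect_of b x, rect_of b y)"]) simp_all
  qed
  then show ?thesis by (simp add: table_def address_ge)
qed

text \<open>\<open>g\<close> is bounded for acting processors only, since a start point computed
  from a large quotient may lie outside the window.\<close>

lemma table_write:
  assumes "\<And>p. f p < 2 ^ (4 * b)" "\<And>p. act p \<Longrightarrow> g p < 2 ^ (4 * b)"
  shows "par_write P act (\<lambda>p. address (f p) (g p)) (\<lambda>_. 1) (table G) =
    table (G \<union> {(rect_of b (f p), rect_of b (g p)) | p. p < P \<and> act p})"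
proof
  fix x
  let ?H = "{(rect_of b (f p), rect_of b (g p)) | p. p < P \<and> act p}"
  have "(\<exists>(R, S)\<in>?H. x = address (rect_code b R) (rect_code b S)) \<longleftrightarrow>
      (\<exists>p<P. act p \<and> x = address (rect_code b (rect_of b (f p))) (rect_code b (rect_of b (g p))))"
    by blast
  also have "\<dots> \<longleftrightarrow> (\<exists>p<P. act p \<and> address (f p) (g p) = x)"
    using assms by (auto simp: rect_code_of)
  finally have H: "(\<exists>(R, S)\<in>?H. x = address (rect_code b R) (rect_code b S)) \<longleftrightarrow>
      (\<exists>p<P. act p \<and> address (f p) (g p) = x)" .
  have U: "(\<exists>(R, S)\<in>G \<union> ?H. x = address (rect_code b R) (rect_code b S)) \<longleftrightarrow>
      (\<exists>(R, S)\<in>G. x = address (rect_code b R) (rect_code b S)) \<or> (\<exists>p<P. act p \<and> address (f p) (g p) = x)"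
    unfolding bex_Un H ..
  show "par_write P act (\<lambda>p. address (f p) (g p)) (\<lambda>_. 1) (table G) x = table (G \<union> ?H) x"
  proof (cases "\<exists>p<P. act p \<and> address (f p) (g p) = x")
    case True
    then have "\<not> x < length w + 4" using address_ge by blast
    then show ?thesis unfolding par_write_const table_def U using True by simp
  next
    case False
    then show ?thesis unfolding par_write_const table_def U by auto
  qed
qed

abbreviation rect_a :: "nat \<Rightarrow> rect" where "rect_a p \<equiv> rect_of b (part_a p)"
abbreviation rect_b :: "nat \<Rightarrow> rect" where "rect_b p \<equiv> rect_of b (part_b p)"
abbreviation rect_c :: "nat \<Rightarrow> rect" where "rect_c p \<equiv> rect_of b (part_c p)"
abbreviation bot :: rect where "bot \<equiv> bottom (2 ^ b)"

lemma ex_processor_rects: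
  assumes "R \<in> box (2 ^ b)" "S \<in> box (2 ^ b)" "T \<in> box (2 ^ b)"
  shows "\<exists>p<P. rect_a p = R \<and> rect_b p = S \<and> rect_c p = T"
  using ex_processor[OF assms[THEN rect_code_less]] assms by (metis rect_of_code)

lemma bot_in_box: "bot \<in> box (2 ^ b)"
  by (rule bottom_in_box) simp

lemma table_compose:
  assumes "G \<subseteq> box (2 ^ b) \<times> box (2 ^ b)"
  shows "par_write P (\<lambda>p. (rect_a p, rect_b p) \<in> G \<and> (rect_b p, rect_c p) \<in> G)
      (\<lambda>p. address (part_a p) (part_c p)) (\<lambda>_. 1) (table G) = table (compose_round G)"
proof -
  have "{(rect_a p, rect_c p) | p. p < P \<and> (rect_a p, rect_b p) \<in> G \<and> (rect_b p, rect_c p) \<in> G} = G O G"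
  proof (intro equalityI subsetI)
    fix e assume "e \<in> G O G"
    then obtain R S T where e: "e = (R, T)" "(R, S) \<in> G" "(S, T) \<in> G" by blast
    then obtain p where "p < P" "rect_a p = R" "rect_b p = S" "rect_c p = T"
      using ex_processor_rects[of R S T] assms by blast
    with e show "e \<in> {(rect_a p, rect_c p) | p. p < P \<and> (rect_a p, rect_b p) \<in> G \<and> (rect_b p, rect_c p) \<in> G}"
      by blast
  qed blast
  then show ?thesis unfolding compose_round_def table_write[OF parts_less(1) parts_less(3)] by simp
qed

lemma compose_in_box:
  "G \<subseteq> B \<times> B \<Longrightarrow> compose_round G \<subseteq> B \<times> B"
  unfolding compose_round_def by blast

text \<open>Processors that differ only in their third rectangle write the same entry, all with the
  value 1.\<close>

lemma table_join:
  "par_write P (\<lambda>p. near (rect_a p) (rect_b p) \<and> (bot, rect_b p) \<in> G)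
      (\<lambda>p. address (part_a p) (rect_code b (join (rect_a p) (rect_b p)))) (\<lambda>_. 1) (table G) =
    table (join_round (2 ^ b) G)"
proof -
  have in_box: "join (rect_a p) (rect_b p) \<in> box (2 ^ b)" for p
    using rect_of_in_box join_in_box by blast
  have "{(rect_a p, join (rect_a p) (rect_b p)) | p. p < P \<and> near (rect_a p) (rect_b p) \<and> (bot, rect_b p) \<in> G} =
      {(R, join R S) | R S. R \<in> box (2 ^ b) \<and> S \<in> box (2 ^ b) \<and> near R S \<and> (bot, S) \<in> G}"
    (is "?A = ?B")
  proof (intro equalityI subsetI)
    fix e assume "e \<in> ?A"
    then show "e \<in> ?B" using rect_of_in_box by blast
  next
    fix e assume "e \<in> ?B"
    then obtain R S where e: "e = (R, join R S)" "R \<in> box (2 ^ b)" "S \<in> box (2 ^ b)" "near R S" "(bot, S) \<in> G"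
      by blast
    then obtain p where "p < P" "rect_a p = R" "rect_b p = S" using ex_processor_rects[of R S R] by blast
    with e show "e \<in> ?A" by blast
  qed
  then show ?thesis
    unfolding join_round_def by (subst table_write) (simp_all add: parts_less rect_code_less in_box rect_of_code)
qed

lemma join_in_box_round:
  "G \<subseteq> box M \<times> box M \<Longrightarrow> join_round M G \<subseteq> box M \<times> box M"
  unfolding join_round_def using join_in_box by blast

section \<open>Symbolic execution of the program\<close>

definition base_env :: "(nat \<times> (nat \<Rightarrow> nat)) list" where
  "base_env = [(0, \<lambda>p. p), (1, \<lambda>_. length w), (2, \<lambda>_. 0), (3, \<lambda>_. 4 * b), (4, \<lambda>_. b)]"

lemma counter_base: "set base_env \<subseteq> set env \<Longrightarrow> counter_env (4 * b) env"
  unfolding counter_env_def base_env_def by (intro exI[of _ "4 * b"] exI[of _ b]) auto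

lemma triple_setup:
  "triple P (4 * b) (state [(0, \<lambda>p. p), (1, \<lambda>_. length w), (2, \<lambda>_. 0), (3, \<lambda>_. 0), (4, \<lambda>_. 0)] \<mu>)
     (Bit_length ;> Assign 3 (Sum (Sum (Reg 4) (Reg 4)) (Sum (Reg 4) (Reg 4)))) (state base_env \<mu>)"
proof (rule triple_Then)
  let ?env = "[(0, \<lambda>p. p), (1, \<lambda>_. length w), (2, \<lambda>_. 0), (3, \<lambda>_. 0), (4, \<lambda>_. b)]"
  show "triple P (4 * b) (state [(0, \<lambda>p. p), (1, \<lambda>_. length w), (2, \<lambda>_. 0), (3, \<lambda>_. 0), (4, \<lambda>_. 0)] \<mu>)
     Bit_length (state ?env \<mu>)"
  proof (rule triple_Bit_length, intro exI[of _ "length w"] conjI)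
    fix rg m assume s: "state [(0, \<lambda>p. p), (1, \<lambda>_. length w), (2, \<lambda>_. 0), (3, \<lambda>_. 0), (4, \<lambda>_. 0)] \<mu> rg m"
    then show "\<forall>p. rg p 1 = length w" by (simp add: state_def holds_def)
    show "bit_length (length w) \<le> 4 * b" using b by simp
    show "state ?env \<mu> (\<lambda>p. (rg p)(4 := bit_length (length w) + 3, 5 := 0)) m"
      using s by (simp add: state_def holds_def b)
  qed
  show "triple P (4 * b) (state ?env \<mu>) (Assign 3 (Sum (Sum (Reg 4) (Reg 4)) (Sum (Reg 4) (Reg 4))))
     (state base_env \<mu>)"
  proof (rule triple_Assign)
    fix rg m assume s: "state ?env \<mu> rg m"
    have "counter_env (4 * b) ?env"
      unfolding counter_env_def by (intro exI[of _ 0] exI[of _ b]) auto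
    then have "counters_le (4 * b) rg" using s counters_le_holds by (simp add: state_def)
    moreover have "state base_env \<mu>
      (\<lambda>p. (rg p)(3 := eval (Sum (Sum (Reg 4) (Reg 4)) (Sum (Reg 4) (Reg 4))) (rg p) m)) m"
      using s by (simp add: state_def holds_def base_env_def)
    ultimately show "counters_le (4 * b) rg \<and> state base_env \<mu>
      (\<lambda>p. (rg p)(3 := eval (Sum (Sum (Reg 4) (Reg 4)) (Sum (Reg 4) (Reg 4))) (rg p) m)) m" ..
  qed simp_all
qed

lemma triple_mark:
  assumes "set base_env \<subseteq> set env" "(r, \<lambda>_. s) \<in> set env" "r < 50"
    and "\<And>p. p < length w \<Longrightarrow> \<mu> p = of_bool (w ! p)" "\<mu> (length w + d) = 0"
  shows "triple P (4 * b) (state env \<mu>) (mark r d) (state env (\<mu>(length w + d := first_zero w s)))"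
  unfolding mark_def
proof (rule triple_Put_state[OF _ _ _ counter_base[OF assms(1)] _ par_write_mark[OF assms(4,5), symmetric]])
  fix rg p
  assume rg: "\<forall>(r, f)\<in>set env. rg r = f p"
  have "rg 0 = p" "rg 1 = length w" "rg r = s"
    using rg assms(1,2) unfolding base_env_def by auto
  then show "(eval (e_conj (e_conj (e_lt (Reg 0) (Reg 1)) (e_is_zero (Fetch (Reg 0)))) (e_le (Reg r) (Reg 0))) rg \<mu> \<noteq> 0) =
      (p < length w \<and> \<mu> p = 0 \<and> s \<le> p) \<and>
      eval (Sum (Reg 1) (Lit d)) rg \<mu> = length w + d \<and> eval (Sum (Reg 0) (Lit 1)) rg \<mu> = p + 1"
    by auto
qed (use assms(3) in simp_all)

definition marked_env :: "(nat \<times> (nat \<Rightarrow> nat)) list" where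
  "marked_env = (8, \<lambda>_. f3) # (7, \<lambda>_. f2) # (6, \<lambda>_. f1) # base_env"

lemma triple_marks:
  assumes "triple P (4 * b) (state marked_env parsed) s Post"
  shows "triple P (4 * b) (state base_env initial_memory)
    (mark 2 0 ;> Assign 6 (Fetch (Sum (Reg 1) (Lit 0))) ;>
     mark 6 1 ;> Assign 7 (Fetch (Sum (Reg 1) (Lit 1))) ;>
     mark 7 2 ;> Assign 8 (Fetch (Sum (Reg 1) (Lit 2))) ;> s) Post"
proof -
  define m1 where "m1 = initial_memory(length w + 0 := f1)"
  define m2 where "m2 = m1(length w + 1 := f2)"
  have m3: "parsed = m2(length w + 2 := f3)" by (simp add: parsed_def m1_def m2_def)
  have low: "initial_memory p = of_bool (w ! p)" "m1 p = of_bool (w ! p)" "m2 p = of_bool (w ! p)"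
    if "p < length w" for p
    using that by (simp_all add: initial_memory_eq m1_def m2_def)
  let ?e1 = "(6, \<lambda>_. f1) # base_env"
  let ?e2 = "(7, \<lambda>_. f2) # ?e1"
  have sub: "set base_env \<subseteq> set base_env" "set base_env \<subseteq> set ?e1" "set base_env \<subseteq> set ?e2" by auto
  have 1: "triple P (4 * b) (state base_env initial_memory) (mark 2 0) (state base_env m1)"
    unfolding m1_def f1_def by (rule triple_mark) (simp_all add: low initial_memory_eq base_env_def)
  have 2: "triple P (4 * b) (state base_env m1) (Assign 6 (Fetch (Sum (Reg 1) (Lit 0)))) (state ?e1 m1)"
    by (rule triple_Assign_state[OF _ _ _ _ counter_base[OF sub(1)]])
      (simp_all add: base_env_def m1_def)
  have 3: "triple P (4 * b) (state ?e1 m1) (mark 6 1) (state ?e1 m2)"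
    unfolding m2_def f2_def by (rule triple_mark[OF sub(2)]) (simp_all add: low initial_memory_eq m1_def)
  have 4: "triple P (4 * b) (state ?e1 m2) (Assign 7 (Fetch (Sum (Reg 1) (Lit 1)))) (state ?e2 m2)"
    by (rule triple_Assign_state[OF _ _ _ _ counter_base[OF sub(2)]])
      (simp_all add: base_env_def m2_def)
  have 5: "triple P (4 * b) (state ?e2 m2) (mark 7 2) (state ?e2 parsed)"
    unfolding m3 f3_def by (rule triple_mark[OF sub(3)]) (simp_all add: low initial_memory_eq m1_def m2_def)
  have 6: "triple P (4 * b) (state ?e2 parsed) (Assign 8 (Fetch (Sum (Reg 1) (Lit 2)))) (state marked_env parsed)"
    unfolding marked_env_def
    by (rule triple_Assign_state[OF _ _ _ _ counter_base[OF sub(3)]])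
      (simp_all add: base_env_def m3)
  show ?thesis by (intro triple_Then[OF 1] triple_Then[OF 2] triple_Then[OF 3] triple_Then[OF 4]
      triple_Then[OF 5] triple_Then[OF 6] assms)
qed

end

context word_input
begin

abbreviation "n \<equiv> word_n w"
abbreviation "ci \<equiv> word_i w"
abbreviation "cj \<equiv> word_j w"

lemma word_eqs: "n = f1 - 1" "ci = f2 - f1 - 1" "cj = f3 - f2 - 1" "word_start w = f3"
  by (simp_all add: word_n_def word_i_def word_j_def word_start_def f1_def f2_def f3_def)

lemma f_le: "f1 \<le> length w" "f2 \<le> length w" "f3 \<le> length w"
  unfolding f1_def f2_def f3_def by (rule first_zero_le)+

text \<open>\<open>Prod\<close> keeps only the low \<open>4 * b\<close> bits of its first factor;
  these bounds show that nothing is cut off.\<close>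

lemma coordinates_less: "n < 2 ^ (4 * b)" "ci < 2 ^ (4 * b)"
  using word_eqs f_le length_less(1) pow_b_le by linarith+

definition param_env :: "(nat \<times> (nat \<Rightarrow> nat)) list" where
  "param_env = [(14, \<lambda>_. cj + n * n), (13, \<lambda>_. ci + n * n), (36, \<lambda>_. n * n), (11, \<lambda>_. cj),
     (10, \<lambda>_. ci), (9, \<lambda>_. n)] @ marked_env"

lemma triple_parameters:
  assumes "triple P (4 * b) (state param_env parsed) s Post"
  shows "triple P (4 * b) (state marked_env parsed) (assigns parameters s) Post"
proof (rule triple_assigns)
  show "assigns_ok parsed marked_env parameters
    [\<lambda>_. n, \<lambda>_. ci, \<lambda>_. cj, \<lambda>_. n * n, \<lambda>_. ci + n * n, \<lambda>_. cj + n * n]"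
    using coordinates_less by (simp add: parameters_def marked_env_def base_env_def word_eqs lookup_def)
  show "counter_env (4 * b) marked_env"
    by (rule counter_base) (auto simp: marked_env_def)
  show "triple P (4 * b) (state (rev (zip (map fst parameters)
      [\<lambda>_. n, \<lambda>_. ci, \<lambda>_. cj, \<lambda>_. n * n, \<lambda>_. ci + n * n, \<lambda>_. cj + n * n]) @ marked_env) parsed) s Post"
    using assms by (simp add: parameters_def param_env_def)
qed

definition valid_env :: "(nat \<times> (nat \<Rightarrow> nat)) list" where
  "valid_env = (12, \<lambda>_. of_bool (valid_word w)) # param_env"

lemma parsed_low: "x < length w \<Longrightarrow> parsed x = of_bool (w ! x)"
  by (simp add: parsed_def initial_memory_eq)

lemma parsed_high: "length w + 3 \<le> x \<Longrightarrow> parsed x = 0"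
  by (simp add: parsed_def initial_memory_eq)

text \<open>The program reads memory, not the word. The two agree at this index because the other
  conjuncts place it inside the input.\<close>

lemma valid_word_iff:
  "valid_word w \<longleftrightarrow> ci < n \<and> cj < n \<and> f1 < f2 \<and> f2 < f3 \<and> length w = f3 + n * n \<and>
    parsed (f3 + (ci * n + cj)) = 0"
proof -
  have "parsed (f3 + (ci * n + cj)) = of_bool (w ! (f3 + (ci * n + cj)))"
    if "ci < n" "cj < n" "length w = f3 + n * n"
    using index_bound[OF that(1,2)] that(3) by (intro parsed_low) simp
  then show ?thesis unfolding valid_word_def word_eqs(4) f1_def[symmetric] f2_def[symmetric]
    by auto
qed

lemma triple_valid:
  "triple P (4 * b) (state param_env parsed) (Assign 12 e_valid) (state valid_env parsed)"
  unfolding valid_env_def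
proof (rule triple_Assign_state)
  show "counter_env (4 * b) param_env"
    by (rule counter_base) (auto simp: param_env_def marked_env_def)
  fix rg p
  assume "\<forall>(r, f)\<in>set param_env. rg r = f p"
  then have rg: "rg (Suc 0) = length w" "rg 3 = 4 * b" "rg 6 = f1" "rg 7 = f2" "rg 8 = f3" "rg 9 = n" "rg 10 = ci"
    "rg 11 = cj" "rg 36 = n * n"
    by (simp_all add: param_env_def marked_env_def base_env_def)
  have "eval e_valid rg parsed = of_bool (ci < n \<and> cj < n \<and> f1 < f2 \<and> f2 < f3 \<and>
      length w \<le> f3 + n * n \<and> f3 + n * n \<le> length w \<and> parsed (f3 + (ci * n + cj)) = 0)"
    using coordinates_less by (simp add: e_valid_def rg Suc_le_eq)
  also have "\<dots> = of_bool (valid_word w)"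
    unfolding valid_word_iff by (rule arg_cong[of _ _ of_bool]) auto
  finally show "eval e_valid rg parsed = of_bool (valid_word w)" .
qed (simp_all add: e_valid_def e_is_zero_def param_env_def marked_env_def base_env_def)

definition coord_x :: "nat \<Rightarrow> nat" where
  "coord_x p = fst (rect_b p) * n + fst (snd (rect_b p))"

definition coord_y :: "nat \<Rightarrow> nat" where
  "coord_y p = fst (snd (snd (rect_b p))) * n + snd (snd (snd (rect_b p)))"

lemma coordinate_mod: "v mod 2 ^ b mod 2 ^ (4 * b) = v mod (2 ^ b :: nat)"
  by (rule mod_less) (meson mod_less_divisor order_less_le_trans pow_b_le zero_less_numeral zero_less_power)

definition corner_env :: "(nat \<times> (nat \<Rightarrow> nat)) list" where
  "corner_env = [(25, \<lambda>p. snd (snd (snd (rect_b p)))), (24, \<lambda>p. fst (snd (snd (rect_b p)))),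
     (23, \<lambda>p. fst (snd (rect_b p))), (22, \<lambda>p. fst (rect_b p)),
     (21, \<lambda>p. snd (snd (snd (rect_a p)))), (20, \<lambda>p. fst (snd (snd (rect_a p)))),
     (19, \<lambda>p. fst (snd (rect_a p))), (18, \<lambda>p. fst (rect_a p)),
     (17, part_c), (16, part_b), (15, part_a)] @ valid_env"

lemmas env_defs = valid_env_def param_env_def marked_env_def base_env_def lookup_def

lemma triple_corners:
  assumes "triple P (4 * b) (state corner_env parsed) s Post"
  shows "triple P (4 * b) (state valid_env parsed) (assigns part_indices (assigns corner_indices s)) Post"
proof (rule triple_assigns)
  show "assigns_ok parsed valid_env part_indices [part_a, part_b, part_c]"
    by (simp add: part_indices_def part_a_def part_b_def part_c_def env_defs)
  show "counter_env (4 * b) valid_env"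
    by (rule counter_base) (auto simp: valid_env_def param_env_def marked_env_def)
  show "triple P (4 * b) (state (rev (zip (map fst part_indices) [part_a, part_b, part_c]) @ valid_env) parsed)
    (assigns corner_indices s) Post"
  proof (rule triple_assigns)
    show "assigns_ok parsed (rev (zip (map fst part_indices) [part_a, part_b, part_c]) @ valid_env)
      corner_indices [\<lambda>p. fst (rect_a p), \<lambda>p. fst (snd (rect_a p)),
     \<lambda>p. fst (snd (snd (rect_a p))), \<lambda>p. snd (snd (snd (rect_a p))),
     \<lambda>p. fst (rect_b p), \<lambda>p. fst (snd (rect_b p)),
     \<lambda>p. fst (snd (snd (rect_b p))), \<lambda>p. snd (snd (snd (rect_b p)))]"
      by (simp add: part_indices_def corner_indices_def rect_of_def env_defs)
    show "counter_env (4 * b) (rev (zip (map fst part_indices) [part_a, part_b, part_c]) @ valid_env)"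
      by (rule counter_base) (auto simp: valid_env_def param_env_def marked_env_def)
    show "triple P (4 * b) (state (rev (zip (map fst corner_indices)
      [\<lambda>p. fst (rect_a p), \<lambda>p. fst (snd (rect_a p)),
       \<lambda>p. fst (snd (snd (rect_a p))), \<lambda>p. snd (snd (snd (rect_a p))),
       \<lambda>p. fst (rect_b p), \<lambda>p. fst (snd (rect_b p)),
       \<lambda>p. fst (snd (snd (rect_b p))), \<lambda>p. snd (snd (snd (rect_b p)))]) @
      rev (zip (map fst part_indices) [part_a, part_b, part_c]) @ valid_env) parsed) s Post"
      using assms by (simp add: part_indices_def corner_indices_def corner_env_def)
  qed
qed

lemma join_eq: "join R S = (min (fst R) (fst S), min (fst (snd R)) (fst (snd S)),
    max (fst (snd (snd R))) (fst (snd (snd S))), max (snd (snd (snd R))) (snd (snd (snd S))))"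
  by (cases R; cases S) simp

lemma near_eq: "near R S \<longleftrightarrow> (fst S - fst (snd (snd R))) + (fst R - fst (snd (snd S))) +
    (fst (snd S) - snd (snd (snd R))) + (fst (snd R) - snd (snd (snd S))) \<le> 2"
  by (cases R; cases S) simp

definition index_env :: "(nat \<times> (nat \<Rightarrow> nat)) list" where
  "index_env =
    [(41, \<lambda>_. 2 ^ b), (40, coord_y), (39, coord_x),
     (31, \<lambda>p. of_bool (near (rect_a p) (rect_b p))),
     (30, \<lambda>p. address (part_a p) (rect_code b (join (rect_a p) (rect_b p)))),
     (32, \<lambda>p. address (rect_code b bot) (part_a p)),
     (29, \<lambda>p. address (rect_code b bot) (part_b p)),
     (28, \<lambda>p. address (part_a p) (part_c p)),
     (27, \<lambda>p. address (part_b p) (part_c p)),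
     (26, \<lambda>p. address (part_a p) (part_b p)),
     (38, \<lambda>_. length w + 4), (37, \<lambda>_. rect_code b bot)] @ corner_env"

lemma corner_mod: "fst (rect_b p) mod 2 ^ (4 * b) = fst (rect_b p)"
  "fst (snd (snd (rect_b p))) mod 2 ^ (4 * b) = fst (snd (snd (rect_b p)))"
  by (simp_all add: rect_of_def coordinate_mod)

lemma triple_addresses:
  assumes "triple P (4 * b) (state index_env parsed) s Post"
  shows "triple P (4 * b) (state corner_env parsed) (assigns address_indices s) Post"
proof (rule triple_assigns)
  let ?vs = "[\<lambda>_. rect_code b bot, \<lambda>_. length w + 4,
     \<lambda>p. address (part_a p) (part_b p), \<lambda>p. address (part_b p) (part_c p),
     \<lambda>p. address (part_a p) (part_c p), \<lambda>p. address (rect_code b bot) (part_b p),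
     \<lambda>p. address (rect_code b bot) (part_a p),
     \<lambda>p. address (part_a p) (rect_code b (join (rect_a p) (rect_b p))),
     \<lambda>p. of_bool (near (rect_a p) (rect_b p)), coord_x, coord_y, \<lambda>_. 2 ^ b]"
  show "assigns_ok parsed corner_env address_indices ?vs"
    by (simp add: address_indices_def corner_env_def env_defs address_def bottom_def coord_x_def coord_y_def
        corner_mod join_eq near_eq)
  show "counter_env (4 * b) corner_env"
    by (rule counter_base) (auto simp: corner_env_def valid_env_def param_env_def marked_env_def)
  show "triple P (4 * b) (state (rev (zip (map fst address_indices) ?vs) @ corner_env) parsed) s Post"
    using assms by (simp add: address_indices_def index_env_def)
qed

end

lemma triple_Put_lookup:
  assumes "regs_below 50 g" "regs_below 50 a" "regs_below 50 v" "counter_env B env"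
    and "set env' \<subseteq> set env" "regs_of g \<union> regs_of a \<union> regs_of v \<subseteq> fst ` set env'"
    and ev: "\<And>p. (eval g (lookup env' p) \<mu> \<noteq> 0) = act p" "\<And>p. eval a (lookup env' p) \<mu> = ad p"
      "\<And>p. eval v (lookup env' p) \<mu> = vl p"
    and "par_write P act ad vl \<mu> = \<mu>'"
  shows "triple P B (state env \<mu>) (Put g a v) (state env \<mu>')"
proof (rule triple_Put_state[OF assms(1-4) _ assms(10)[symmetric]])
  fix rg p assume "\<forall>(r, f)\<in>set env. rg r = f p"
  then have rg: "\<forall>(r, f)\<in>set env'. rg r = f p" using assms(5) by blast
  have "eval e rg \<mu> = eval e (lookup env' p) \<mu>" if "e = g \<or> e = a \<or> e = v" for e
    by (rule eval_lookup[OF rg]) (use that assms(6) in blast)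
  then show "(eval g rg \<mu> \<noteq> 0) = act p \<and> eval a rg \<mu> = ad p \<and> eval v rg \<mu> = vl p"
    using ev by simp
qed

section \<open>Start table, rounds and target\<close>

context word_input
begin

lemma base_index_env: "set base_env \<subseteq> set index_env"
  by (auto simp: index_env_def corner_env_def valid_env_def param_env_def marked_env_def)

lemmas all_env_defs = index_env_def corner_env_def env_defs

definition start_table :: "(rect \<times> rect) set" where
  "start_table = {(bot, (coord_x p, coord_y p, coord_x p, coord_y p)) | p. p < P \<and>
     fst (snd (rect_b p)) < n \<and> snd (snd (snd (rect_b p))) < n \<and>
     coord_x p < 2 ^ b \<and> coord_y p < 2 ^ b \<and>
     0 < parsed (f3 + (fst (snd (rect_b p)) * n + snd (snd (snd (rect_b p)))))}"

lemma corner_mod2: "fst (snd (rect_b p)) mod 2 ^ (4 * b) = fst (snd (rect_b p))"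
  by (simp add: rect_of_def coordinate_mod)

lemma table_empty: "table {} = parsed"
  using parsed_high by (auto simp: table_def fun_eq_iff)

lemma triple_start_points:
  "triple P (4 * b) (state index_env parsed) start_points (state index_env (table start_table))"
  unfolding start_points_def
proof (rule triple_Put_lookup[OF _ _ _ counter_base[OF base_index_env] subset_refl])
  define act where "act p \<longleftrightarrow> fst (snd (rect_b p)) < n \<and> snd (snd (snd (rect_b p))) < n \<and>
     coord_x p < 2 ^ b \<and> coord_y p < 2 ^ b \<and>
     0 < parsed (f3 + (fst (snd (rect_b p)) * n + snd (snd (snd (rect_b p)))))" for p
  let ?pt = "\<lambda>p. (coord_x p, coord_y p, coord_x p, coord_y p)"
  fix p
  show "(eval (e_conj (e_conj (e_conj (e_lt (Reg 23) (Reg 9)) (e_lt (Reg 25) (Reg 9)))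
        (e_conj (e_lt (Reg 39) (Reg 41)) (e_lt (Reg 40) (Reg 41))))
        (e_lt (Lit 0) (Fetch (Sum (Reg 8) (Sum (Prod (Reg 23) (Reg 9)) (Reg 25))))))
      (lookup index_env p) parsed \<noteq> 0) = act p"
    unfolding act_def by (simp add: all_env_defs corner_mod2) blast
  show "eval (Sum (Reg 38) (Sum (Shl 3 (Reg 37)) (e_code (Reg 39) (Reg 40) (Reg 39) (Reg 40))))
      (lookup index_env p) parsed = address (rect_code b bot) (rect_code b (?pt p))"
    by (simp add: all_env_defs address_def)
  show "eval (Lit 1) (lookup index_env p) parsed = 1" by simp
  have in_box: "?pt p \<in> box (2 ^ b)" if "act p" for p using that by (simp add: act_def box_def)
  have "par_write P act (\<lambda>p. address (rect_code b bot) (rect_code b (?pt p))) (\<lambda>_. 1) (table {}) =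
      table ({} \<union> {(rect_of b (rect_code b bot), rect_of b (rect_code b (?pt p))) | p. p < P \<and> act p})"
    by (rule table_write) (use rect_code_less bot_in_box in_box in blast)+
  also have "{(rect_of b (rect_code b bot), rect_of b (rect_code b (?pt p))) | p. p < P \<and> act p} = start_table"
    unfolding start_table_def act_def[symmetric] rect_of_code[OF bot_in_box]
    using rect_of_code[OF in_box] by (intro Collect_cong) metis
  finally show "par_write P act (\<lambda>p. address (rect_code b bot) (rect_code b (?pt p))) (\<lambda>_. 1) parsed =
      table start_table"
    by (simp add: table_empty)
qed (simp_all add: all_env_defs)

lemma start_table_in_box: "start_table \<subseteq> box (2 ^ b) \<times> box (2 ^ b)"
  using bot_in_box by (auto simp: start_table_def box_def)

lemma table_round_in_box:
  "G \<subseteq> box (2 ^ b) \<times> box (2 ^ b) \<Longrightarrow> table_round (2 ^ b) G \<subseteq> box (2 ^ b) \<times> box (2 ^ b)"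
  unfolding table_round_def by (intro join_in_box_round compose_in_box)

lemma table_rounds_in_box:
  "G \<subseteq> box (2 ^ b) \<times> box (2 ^ b) \<Longrightarrow> (table_round (2 ^ b) ^^ k) G \<subseteq> box (2 ^ b) \<times> box (2 ^ b)"
  by (induction k) (auto dest: table_round_in_box[THEN subsetD])

lemma triple_round_body:
  assumes env: "set index_env \<subseteq> set env" and G: "G \<subseteq> box (2 ^ b) \<times> box (2 ^ b)"
  shows "triple P (4 * b) (state env (table G)) round_body (state env (table (table_round (2 ^ b) G)))"
  unfolding round_body_def
proof (rule triple_Then)
  have c: "counter_env (4 * b) env" using counter_base base_index_env env by blast
  show "triple P (4 * b) (state env (table G)) (Put (e_conj (Fetch (Reg 26)) (Fetch (Reg 27))) (Reg 28) (Lit 1))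
    (state env (table (compose_round G)))"
  proof (rule triple_Put_lookup[OF _ _ _ c env _ _ _ _ table_compose[OF G]])
    fix p
    show "(eval (e_conj (Fetch (Reg 26)) (Fetch (Reg 27))) (lookup index_env p) (table G) \<noteq> 0) =
        ((rect_a p, rect_b p) \<in> G \<and> (rect_b p, rect_c p) \<in> G)"
      by (simp add: all_env_defs table_read[OF G] parts_less)
  qed (simp_all add: all_env_defs)
  let ?G = "compose_round G"
  have G': "?G \<subseteq> box (2 ^ b) \<times> box (2 ^ b)" by (rule compose_in_box[OF G])
  show "triple P (4 * b) (state env (table ?G)) (Put (e_conj (Reg 31) (Fetch (Reg 29))) (Reg 30) (Lit 1))
    (state env (table (table_round (2 ^ b) G)))"
    unfolding table_round_def
  proof (rule triple_Put_lookup[OF _ _ _ c env _ _ _ _ table_join])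
    fix p
    show "(eval (e_conj (Reg 31) (Fetch (Reg 29))) (lookup index_env p) (table ?G) \<noteq> 0) =
        (near (rect_a p) (rect_b p) \<and> (bot, rect_b p) \<in> ?G)"
      by (simp add: all_env_defs table_read[OF G'] parts_less rect_code_less[OF bot_in_box]
          rect_of_code[OF bot_in_box])
  qed (simp_all add: all_env_defs)
qed

lemma triple_rounds:
  "triple P (4 * b) (state index_env (table start_table))
     (Assign 33 (Reg 3) ;> For 33 (Assign 34 (Reg 3) ;> For 34 round_body))
     (state index_env (table ((table_round (2 ^ b) ^^ (4 * b * (4 * b))) start_table)))"
proof (rule triple_Then)
  \<comment> \<open>With \<open>k\<close> outer passes left, \<open>(4 * b - k) * (4 * b)\<close>
    rounds are complete; the inner loop adds \<open>4 * b - l\<close> to those of the finished outer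
    passes.\<close>
  define T where "T k = (table_round (2 ^ b) ^^ k) start_table" for k
  have in_box: "T k \<subseteq> box (2 ^ b) \<times> box (2 ^ b)" for k
    unfolding T_def by (rule table_rounds_in_box[OF start_table_in_box])
  have three: "(3, \<lambda>_. 4 * b) \<in> set index_env"
    by (rule subsetD[OF base_index_env]) (simp add: base_env_def)
  have fresh: "33 \<notin> fst ` set index_env" "34 \<notin> fst ` set index_env" by (simp_all add: all_env_defs)
  show "triple P (4 * b) (state index_env (table start_table)) (Assign 33 (Reg 3))
     (state ((33, \<lambda>_. 4 * b) # index_env) (table (T ((4 * b - 4 * b) * (4 * b)))))"
  proof -
    have "triple P (4 * b) (state index_env (table start_table)) (Assign 33 (Reg 3))
      (state ((33, \<lambda>_. 4 * b) # index_env) (table start_table))"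
      by (rule triple_Assign_state[OF _ _ _ fresh(1) counter_base[OF base_index_env]])
        (use three in auto)
    then show ?thesis by (simp add: T_def)
  qed
  have "triple P (4 * b) (state ((33, \<lambda>_. 4 * b) # index_env) (table (T ((4 * b - 4 * b) * (4 * b)))))
     (For 33 (Assign 34 (Reg 3) ;> For 34 round_body))
     (state index_env (table (T ((4 * b - 0) * (4 * b)))))"
  proof (rule triple_For_state[where \<mu> = "\<lambda>k. table (T ((4 * b - k) * (4 * b)))"])
    fix k assume k: "k < 4 * b"
    let ?env = "(33, \<lambda>_. Suc k) # index_env"
    let ?s = "(4 * b - Suc k) * (4 * b)"
    have fresh34: "34 \<notin> fst ` set ?env" using fresh(2) by simp
    have sub: "set index_env \<subseteq> set ?env" by auto
    show "triple P (4 * b) (state ?env (table (T ?s))) (Assign 34 (Reg 3) ;> For 34 round_body)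
      (state ?env (table (T ((4 * b - k) * (4 * b)))))"
    proof (rule triple_Then)
      show "triple P (4 * b) (state ?env (table (T ?s))) (Assign 34 (Reg 3))
        (state ((34, \<lambda>_. 4 * b) # ?env) (table (T ?s)))"
        by (rule triple_Assign_state[OF _ _ _ fresh34 counter_base])
          (use three base_index_env in auto)
      have "triple P (4 * b) (state ((34, \<lambda>_. 4 * b) # ?env) (table (T (?s + (4 * b - 4 * b)))))
        (For 34 round_body) (state ?env (table (T (?s + (4 * b - 0)))))"
      proof (rule triple_For_state[where \<mu> = "\<lambda>l. table (T (?s + (4 * b - l)))", OF _ _ fresh34])
        fix l assume l: "l < 4 * b"
        let ?env' = "(34, \<lambda>_. Suc l) # ?env"
        have "triple P (4 * b) (state ?env' (table (T (?s + (4 * b - Suc l))))) round_body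
          (state ?env' (table (table_round (2 ^ b) (T (?s + (4 * b - Suc l))))))"
          by (rule triple_round_body[OF _ in_box]) auto
        moreover have "table_round (2 ^ b) (T (?s + (4 * b - Suc l))) = T (Suc (?s + (4 * b - Suc l)))"
          by (simp add: T_def)
        moreover have "Suc (?s + (4 * b - Suc l)) = ?s + (4 * b - l)" using l by simp
        ultimately show "triple P (4 * b) (state ?env' (table (T (?s + (4 * b - Suc l))))) round_body
          (state ?env' (table (T (?s + (4 * b - l)))))"
          by (simp only:)
      qed simp_all
      moreover have "?s + (4 * b - 0) = (4 * b - k) * (4 * b)"
      proof -
        have "4 * b - k = Suc (4 * b - Suc k)" using k by simp
        then show ?thesis by simp
      qed
      ultimately show "triple P (4 * b) (state ((34, \<lambda>_. 4 * b) # ?env) (table (T ?s)))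
        (For 34 round_body) (state ?env (table (T ((4 * b - k) * (4 * b)))))"
        by (simp only: diff_self_eq_0 add_0_right)
    qed
  qed (use fresh in simp_all)
  then show "triple P (4 * b) (state ((33, \<lambda>_. 4 * b) # index_env) (table (T ((4 * b - 4 * b) * (4 * b)))))
     (For 33 (Assign 34 (Reg 3) ;> For 34 round_body))
     (state index_env (table ((table_round (2 ^ b) ^^ (4 * b * (4 * b))) start_table)))"
    by (simp only: T_def diff_zero)
qed

definition target :: cell where
  "target = (int (ci + n * n), int (cj + n * n))"

lemma triple_find_target:
  assumes G: "G \<subseteq> box (2 ^ b) \<times> box (2 ^ b)"
  shows "triple P (4 * b) (state index_env (table G)) find_target
    (state index_env ((table G)(length w + 3 := of_bool (\<exists>R. (bot, R) \<in> G \<and> target \<in> rect_cells R))))"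
  unfolding find_target_def
proof (rule triple_Put_lookup[OF _ _ _ counter_base[OF base_index_env] subset_refl])
  fix p
  show "(eval (e_conj (e_conj (e_conj (e_le (Reg 18) (Reg 13)) (e_le (Reg 13) (Reg 20)))
        (e_conj (e_le (Reg 19) (Reg 14)) (e_le (Reg 14) (Reg 21)))) (Fetch (Reg 32)))
      (lookup index_env p) (table G) \<noteq> 0) = (target \<in> rect_cells (rect_a p) \<and> (bot, rect_a p) \<in> G)"
  proof -
    have "target \<in> rect_cells R \<longleftrightarrow> fst R \<le> ci + n * n \<and> ci + n * n \<le> fst (snd (snd R)) \<and>
      fst (snd R) \<le> cj + n * n \<and> cj + n * n \<le> snd (snd (snd R))" for R
      unfolding target_def by (cases R) (simp only: rect_cells.simps mem_Collect_eq prod.case of_nat_le_iff fst_conv snd_conv)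
    then show ?thesis
      by (simp add: all_env_defs table_read[OF G] parts_less rect_code_less[OF bot_in_box]
          rect_of_code[OF bot_in_box]) blast
  qed
  show "eval (Sum (Reg 1) (Lit 3)) (lookup index_env p) (table G) = length w + 3"
    by (simp add: all_env_defs)
  show "eval (Lit 1) (lookup index_env p) (table G) = 1" by simp
  have ex: "(\<exists>p<P. target \<in> rect_cells (rect_a p) \<and> (bot, rect_a p) \<in> G) \<longleftrightarrow>
      (\<exists>R. (bot, R) \<in> G \<and> target \<in> rect_cells R)"
  proof
    assume "\<exists>R. (bot, R) \<in> G \<and> target \<in> rect_cells R"
    then obtain R where R: "(bot, R) \<in> G" "target \<in> rect_cells R" by blast
    then obtain p where "p < P" "rect_a p = R" using ex_processor_rects[of R R R] G by blast
    then show "\<exists>p<P. target \<in> rect_cells (rect_a p) \<and> (bot, rect_a p) \<in> G" using R by blast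
  qed blast
  have zero: "table G (length w + 3) = 0" using parsed_high[of "length w + 3"] by (simp add: table_def)
  show "par_write P (\<lambda>p. target \<in> rect_cells (rect_a p) \<and> (bot, rect_a p) \<in> G) (\<lambda>_. length w + 3) (\<lambda>_. 1) (table G) =
    (table G)(length w + 3 := of_bool (\<exists>R. (bot, R) \<in> G \<and> target \<in> rect_cells R))"
    unfolding ex[symmetric] by (rule ext) (use zero in \<open>auto simp: par_write_const\<close>)
qed (simp_all add: all_env_defs)

text \<open>The witness for a cell \<open>(x, y)\<close> is a processor whose second rectangle is
  \<open>(x div n, x mod n, y div n, y mod n)\<close>; these four digits are mere data and need not
  form a proper rectangle.\<close>

lemma start_table_valid:
  assumes "valid_word w"
  shows "start_table = points (2 ^ b) {v \<in> {0..<int (2 ^ b)} \<times> {0..<int (2 ^ b)}. periodic n (word_x w) v}"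
    (is "_ = points _ ?A")
proof -
  have n: "0 < n" "length w = f3 + n * n" using assms by (auto simp: valid_word_iff)
  have mem: "(0 < parsed (f3 + (i * n + j))) = word_x w (i, j)" if "i < n" "j < n" for i j
    using index_bound[OF that] n(2) by (simp add: parsed_low word_x_def word_eqs(4))
  have per: "periodic n (word_x w) (int x, int y) = word_x w (x mod n, y mod n)" for x y
    by (simp add: periodic_def flip: zmod_int)
  have in_A: "(int x, int y) \<in> ?A \<longleftrightarrow> x < 2 ^ b \<and> y < 2 ^ b \<and> word_x w (x mod n, y mod n)" for x y
    by (simp add: per)
  show ?thesis
  proof (intro equalityI subsetI)
    fix e assume "e \<in> start_table"
    then obtain p where p: "e = (bot, (coord_x p, coord_y p, coord_x p, coord_y p))"
      "fst (snd (rect_b p)) < n" "snd (snd (snd (rect_b p))) < n"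
      "coord_x p < 2 ^ b" "coord_y p < 2 ^ b"
      "0 < parsed (f3 + (fst (snd (rect_b p)) * n + snd (snd (snd (rect_b p)))))"
      unfolding start_table_def by blast
    have "coord_x p mod n = fst (snd (rect_b p))" "coord_y p mod n = snd (snd (snd (rect_b p)))"
      unfolding coord_x_def coord_y_def using p(2,3) by simp_all
    then have "(int (coord_x p), int (coord_y p)) \<in> ?A"
      unfolding in_A using p mem[OF p(2,3)] by simp
    then show "e \<in> points (2 ^ b) ?A" unfolding points_def using p(1) by blast
  next
    fix e assume "e \<in> points (2 ^ b) ?A"
    then obtain x y where e: "e = (bot, (x, y, x, y))" and xy: "x < 2 ^ b" "y < 2 ^ b"
      "word_x w (x mod n, y mod n)"
      unfolding points_def using in_A by blast
    have "n < 2 ^ b" using word_eqs(1) f_le(1) length_less(1) by linarith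
    then have "x mod n < 2 ^ b" "y mod n < 2 ^ b"
      using n(1) mod_less_divisor[of n x] mod_less_divisor[of n y] by linarith+
    moreover have "x div n < 2 ^ b" "y div n < 2 ^ b"
      using xy(1,2) div_le_dividend[of x n] div_le_dividend[of y n] by linarith+
    ultimately have R: "(x div n, x mod n, y div n, y mod n) \<in> box (2 ^ b)" by (simp add: box_def)
    obtain p where p: "p < P" "rect_b p = (x div n, x mod n, y div n, y mod n)"
      using ex_processor_rects[OF R R R] by blast
    have c: "coord_x p = x" "coord_y p = y" by (simp_all add: coord_x_def coord_y_def p(2))
    have "0 < parsed (f3 + (x mod n * n + y mod n))" using mem[of "x mod n" "y mod n"] n(1) xy(3) by simp
    then show "e \<in> start_table"
      unfolding start_table_def mem_Collect_eq
      by (intro exI[of _ p]) (use p n(1) xy in \<open>simp add: c e\<close>)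
  qed
qed

lemma target_spanned:
  assumes "valid_word w"
  shows "(\<exists>R. (bot, R) \<in> (table_round (2 ^ b) ^^ (4 * b * (4 * b))) start_table \<and> target \<in> rect_cells R) \<longleftrightarrow>
    \<not> stable {2, 3, 4} (periodic n (word_x w)) (int ci, int cj)"
proof -
  let ?A = "{v \<in> {0..<int (2 ^ b)} \<times> {0..<int (2 ^ b)}. periodic n (word_x w) v}"
  have ij: "ci < n" "cj < n" and len: "length w = f3 + n * n" "f1 < f3"
    using assms by (auto simp: valid_word_iff)
  have "n \<le> f1" using word_eqs(1) by simp
  \<comment> \<open>The unary part has at least \<open>n\<close> bits and the square
    \<open>n * n\<close> more, so a window of side \<open>2 ^ b\<close>, larger than
    \<open>8 * length w\<close>, is wide enough.\<close>
  then have bound: "n + 2 * (n * n) \<le> 2 ^ b" using len length_less(2) by linarith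
  have "0 < n" "0 < b" using ij by (simp_all add: b)
  have "target \<in> spanned ?A \<longleftrightarrow>
      (\<exists>R. (bot, R) \<in> (table_round (2 ^ b) ^^ (4 * b * (4 * b))) start_table \<and> target \<in> rect_cells R)"
    unfolding start_table_valid[OF assms]
    by (rule spanned_iff_rounds[OF _ refl \<open>0 < b\<close>]) auto
  then show ?thesis
    using not_stable_iff_spanned[OF \<open>0 < n\<close> ij bound, of "word_x w"] unfolding target_def by blast
qed

lemma triple_stability:
  "triple P (4 * b) (state [(0, \<lambda>p. p), (1, \<lambda>_. length w), (2, \<lambda>_. 0), (3, \<lambda>_. 0), (4, \<lambda>_. 0)] initial_memory)
     stability_stm (\<lambda>rg m. m 0 = of_bool (w \<in> STABILITY {2, 3, 4}))"
proof -
  let ?G = "(table_round (2 ^ b) ^^ (4 * b * (4 * b))) start_table"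
  define found where "found \<longleftrightarrow> (\<exists>R. (bot, R) \<in> ?G \<and> target \<in> rect_cells R)"
  let ?m = "(table ?G)(length w + 3 := of_bool found)"
  let ?v = "\<lambda>_ :: nat. of_bool (valid_word w \<and> \<not> found) :: nat"
  have G: "?G \<subseteq> box (2 ^ b) \<times> box (2 ^ b)" by (rule table_rounds_in_box[OF start_table_in_box])
  have ans: "(valid_word w \<and> \<not> found) \<longleftrightarrow> w \<in> STABILITY {2, 3, 4}"
    unfolding in_STABILITY_iff found_def using target_spanned by blast
  have found: "triple P (4 * b) (state index_env (table ?G)) find_target (state index_env ?m)"
    unfolding found_def by (rule triple_find_target[OF G])
  have 1: "triple P (4 * b) (state index_env ?m)
      (Assign 35 (e_conj (Reg 12) (e_is_zero (Fetch (Sum (Reg 1) (Lit 3)))))) (state ((35, ?v) # index_env) ?m)"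
  proof (rule triple_Assign_state[OF _ _ _ _ counter_base[OF base_index_env]])
    fix rg p assume "\<forall>(r, f)\<in>set index_env. rg r = f p"
    then have "eval (e_conj (Reg 12) (e_is_zero (Fetch (Sum (Reg 1) (Lit 3))))) rg ?m =
      eval (e_conj (Reg 12) (e_is_zero (Fetch (Sum (Reg 1) (Lit 3))))) (lookup index_env p) ?m"
      by (rule eval_lookup) (simp add: all_env_defs)
    also have "\<dots> = ?v p" by (simp add: all_env_defs)
    finally show "eval (e_conj (Reg 12) (e_is_zero (Fetch (Sum (Reg 1) (Lit 3))))) rg ?m = ?v p" .
  qed (simp_all add: all_env_defs)
  have 2: "triple P (4 * b) (state ((35, ?v) # index_env) ?m) (Put (Lit 1) (Lit 0) (Reg 35))
      (state ((35, ?v) # index_env) (?m(0 := of_bool (valid_word w \<and> \<not> found))))"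
  proof (rule triple_Put_lookup[where env' = "[(35, ?v)]" and act = "\<lambda>_. True" and ad = "\<lambda>_. 0" and vl = ?v])
    show "counter_env (4 * b) ((35, ?v) # index_env)" by (rule counter_base) (use base_index_env in auto)
    show "par_write P (\<lambda>_. True) (\<lambda>_. 0) ?v ?m = ?m(0 := of_bool (valid_word w \<and> \<not> found))"
      by (rule ext) (use P_ge(2) in \<open>auto simp: par_write_const\<close>)
  qed (simp_all add: lookup_def)
  have "triple P (4 * b) (state [(0, \<lambda>p. p), (1, \<lambda>_. length w), (2, \<lambda>_. 0), (3, \<lambda>_. 0), (4, \<lambda>_. 0)] initial_memory)
     stability_stm (state ((35, ?v) # index_env) (?m(0 := of_bool (valid_word w \<and> \<not> found))))"
    unfolding stability_stm_def
    by (rule triple_Then[OF triple_setup triple_marks[OF triple_parameters[OF triple_Then[OF triple_valid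
          triple_corners[OF triple_addresses[OF triple_Then[OF triple_start_points
          triple_Then[OF triple_rounds triple_Then[OF found triple_Then[OF 1 2]]]]]]]]]])
  then show ?thesis
  proof (rule triple_conseq)
    fix rg m
    assume "state ((35, ?v) # index_env) (?m(0 := of_bool (valid_word w \<and> \<not> found))) rg m"
    then have "m 0 = of_bool (valid_word w \<and> \<not> found)" by (simp only: state_def fun_upd_same)
    then show "m 0 = of_bool (w \<in> STABILITY {2, 3, 4})" unfolding ans .
  qed
qed

end

section \<open>Polynomially many processors and polylogarithmic time\<close>

lemma processors_suffice: "2 ^ (12 * (bit_length l + 3)) \<le> l ^ 2 ^ 48 + (2 ^ 48 :: nat)"
proof -
  \<comment> \<open>For \<open>l \<le> 1\<close> up to \<open>2 ^ 48\<close> processors are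
    required, and the summand of \<open>l ^ K + K\<close> supplies them; as an exponent
    \<open>K\<close> only has to reach 60.\<close>
  define K :: nat where "K = 2 ^ 48"
  have "60 \<le> (2 :: nat) ^ 6" by simp
  also have "\<dots> \<le> 2 ^ 48" by (intro power_increasing) auto
  finally have K60: "60 \<le> K" by (simp only: K_def)
  have split: "2 ^ (12 * (bit_length l + 3)) = (2 ^ bit_length l) ^ 12 * (2 :: nat) ^ 36"
    by (simp add: power_add power_mult mult.commute flip: power_mult)
  have "2 ^ (12 * (bit_length l + 3)) \<le> l ^ K + K"
  proof (cases "l \<le> 1")
    case True
    then have "bit_length l \<le> 1" by (cases "l = 0") (simp_all add: bit_length.simps)
    then have "12 * (bit_length l + 3) \<le> 48" by simp
    then have "2 ^ (12 * (bit_length l + 3)) \<le> K" unfolding K_def by (intro power_increasing) auto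
    then show ?thesis by simp
  next
    case False
    have "(2 ^ bit_length l) ^ 12 * (2 :: nat) ^ 36 \<le> (2 * l) ^ 12 * 2 ^ 36"
      using bit_length_le[of l] False by (intro mult_le_mono1 power_mono) auto
    also have "\<dots> = l ^ 12 * 2 ^ 48" by (simp add: power_mult_distrib)
    \<comment> \<open>From \<open>2 \<le> l\<close> on, the constant is absorbed by a power of
      \<open>l\<close>.\<close>
    also have "\<dots> \<le> l ^ 12 * l ^ 48" using False by (intro mult_le_mono2 power_mono) auto
    also have "\<dots> = l ^ 60" by (simp flip: power_add)
    also have "\<dots> \<le> l ^ K" using K60 False by (intro power_increasing) auto
    finally show ?thesis unfolding split by simp
  qed
  then show ?thesis by (simp only: K_def)
qed

text \<open>With \<open>y\<close> the logarithm, \<open>bit_length l \<le> 1 + y\<close> gives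
  \<open>4 * y + 17\<close>, and \<open>1 \<le> y\<close> turns this into
  \<open>21 * y\<close>.\<close>

lemma counters_log_le: "real (4 * (bit_length l + 3) + 1) \<le> 21 * log 2 (real l + 2)"
proof -
  define y where "y = log 2 (real l + 2)"
  have "1 \<le> y" by (simp add: y_def le_log_iff)
  moreover have "real (bit_length l) \<le> 1 + y"
  proof (cases "l = 0")
    case True
    then show ?thesis using \<open>1 \<le> y\<close> by (simp add: bit_length.simps)
  next
    case False
    have "real (bit_length l) = log 2 (2 ^ bit_length l)" by simp
    also have "\<dots> \<le> log 2 (2 * (real l + 2))"
    proof -
      have "real (2 ^ bit_length l) \<le> real (2 * l)" using bit_length_le[of l] False by (intro of_nat_mono) simp
      then have "2 ^ bit_length l \<le> 2 * (real l + 2)" by simp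
      then show ?thesis by (intro log_mono) auto
    qed
    also have "\<dots> = 1 + log 2 (real l + 2)" by (subst log_mult) auto
    finally show ?thesis unfolding y_def .
  qed
  ultimately show ?thesis unfolding y_def[symmetric] by simp
qed

theorem theorem6: "STABILITY {2, 3, 4} \<in> NC"
  unfolding NC_def
proof (intro CollectI exI allI)
  fix w :: "bool list"
  let ?K = "2 ^ 48 :: nat"
  let ?P = "length w ^ ?K + ?K" and ?b = "bit_length (length w) + 3"
  let ?prog = "code 0 (compile stability_stm)"
  let ?rg = "\<lambda>p. (\<lambda>_. 0)(0 := p, 1 := length w)"
  interpret word_input w ?P ?b by unfold_locales (simp_all only: processors_suffice)
  have init: "initial w = lockstep 0 ?rg initial_memory"
    by (simp add: initial_def lockstep_def initial_memory_def)
  have zero: "zeroed ?rg" by (simp add: zeroed_def)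
  have "state [(0, \<lambda>p. p), (1, \<lambda>_. length w), (2, \<lambda>_. 0), (3, \<lambda>_. 0), (4, \<lambda>_. 0)] initial_memory
      (vars ?rg) initial_memory"
    by (simp add: state_def holds_def vars_def)
  then obtain t rg' m' where run: "run ?P (compile stability_stm) ?rg initial_memory t rg' m'"
    and t: "t \<le> stm_cost stability_stm * (4 * ?b + 1) ^ depth stability_stm"
    and m': "m' 0 = of_bool (w \<in> STABILITY {2, 3, 4})"
    using triple_stability zero unfolding triple_def reaches_def by blast
  have steps: "(step ?prog ?P ^^ t) (initial w) = lockstep (code_size (compile stability_stm)) rg' m'"
    using run_code[OF run, of ?prog "[]" 0 "[]"] zero unfolding init zeroed_def by simp
  \<comment> \<open>The depth of the program is 3, two loops over rounds around expressions with
    loops of their own, so the time is of the order of the cube of the logarithm.\<close>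
  have "real t \<le> real (stm_cost stability_stm * (4 * ?b + 1) ^ depth stability_stm)"
    using t by (rule of_nat_mono)
  also have "\<dots> = real (stm_cost stability_stm) * real (4 * ?b + 1) ^ depth stability_stm"
    by (simp only: of_nat_mult of_nat_power)
  also have "\<dots> \<le> real (stm_cost stability_stm) * (21 * log 2 (real (length w) + 2)) ^ depth stability_stm"
    by (intro mult_left_mono power_mono counters_log_le) simp_all
  also have "\<dots> = real (stm_cost stability_stm * 21 ^ depth stability_stm) *
      log 2 (real (length w) + 2) ^ depth stability_stm"
    by (simp only: power_mult_distrib of_nat_mult of_nat_power of_nat_numeral mult.assoc)
  finally have time: "real t \<le> real (stm_cost stability_stm * 21 ^ depth stability_stm) *
      log 2 (real (length w) + 2) ^ depth stability_stm" .
  \<comment> \<open>The code has length \<open>code_size\<close>, so the common program counter is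
    just past its end.\<close>
  have "all_halted ?prog ?P (lockstep (code_size (compile stability_stm)) rg' m')"
    by (simp add: all_halted_def halted_def lockstep_def)
  then show "decides_within ?prog ?P
      (real (stm_cost stability_stm * 21 ^ depth stability_stm) *
       log 2 (real (length w) + 2) ^ depth stability_stm) (STABILITY {2, 3, 4}) w"
    unfolding decides_within_def using time steps m' by (intro exI[of _ t]) (simp add: lockstep_def)
qed

end
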